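(* Let $a,b,M,N\in\mathbb N$ (positive integers) with $\theta=a/M=b/N$, and put $d=aN$. Let $(g_j)$ be an $n$-tuple of functions in $\mathbf S_0(\mathbb R)^n$ such that $[(g_j),(g_j)]_\Lambda$, $\Lambda=\mathbb Z\times\theta\mathbb Z$, is a projection in $\mathrm M_n(\mathcal A^{\mathbb R}_\theta)$. Then: (i) The module norm of $(g_j)$ satisfies $$\|(g_j)\|_\Lambda\le C:=\theta^{-1}\sum_{j\in\mathbb Z_n}\ \sum_{\lambda^\circ\in\theta^{-1}\mathbb Z\times\mathbb Z}|\langle g_j,\pi(\lambda^\circ)g_j\rangle|.$$ (ii) The $n$-tuple $(\tilde g_j)=(a^{-1/2}\mathcal R_{a^{-1}\mathbb Z}\,g_j)$ in $\ell^1(a^{-1}\mathbb Z)^n$ is such that $[(\tilde g_j),(\tilde g_j)]_{\tilde\Lambda}$ is a projection in $\mathrm M_n(\mathcal A^{a^{-1}\mathbb Z}_\theta)$, and $\|(\tilde g_j)\|_{\tilde\Lambda}\le C$. (iii) The $n$-tuple $(\tilde{\tilde g}_j)=(a^{-1/2}\mathcal P_{a^{-1}d\mathbb Z}\mathcal R_{a^{-1}\mathbb Z}\,g_j)$ of vectors in $\mathbb C^d$ is such that $[(\tilde{\tilde g}_j),(\tilde{\tilde g}_j)]_{\tilde{\tilde\Lambda}}$ is a projection in $\mathrm M_n(\mathcal A^{\mathbb Z_d}_\theta)$, and $\|(\tilde{\tilde g}_j)\|_{\tilde{\tilde\Lambda}}\le C$.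
   Context: Time-frequency shifts: on $L^2(\mathbb R)$, $\pi(x,\omega)f(t)=e^{2\pi i\omega t}f(t-x)$, $(x,\omega)\in\mathbb R^2$; on $\ell^2(a^{-1}\mathbb Z)$, $\pi(x,\omega)f(t)=e^{2\pi i\omega t}f(t-x)$, $x\in a^{-1}\mathbb Z$, $\omega\in\mathbb R/a\mathbb Z$; on $\ell^2(\mathbb Z_d)\cong\mathbb C^d$ ($\mathbb Z_d=\mathbb Z/d\mathbb Z$), $\pi(x,\omega)f(t)=e^{2\pi i\omega t/d}f(t-x)$, $(x,\omega)\in\mathbb Z_d^2$. Inner products are $\langle f,g\rangle=\int_{\mathbb R}f\bar g$ (Lebesgue), $\sum_{t\in a^{-1}\mathbb Z}f(t)\overline{g(t)}$, and $\sum_{t=0}^{d-1}f(t)\overline{g(t)}$, respectively. $\mathbf S_0(\mathbb R)$ (Feichtinger's algebra) is the set of $f\in L^2(\mathbb R)$ with $(x,\omega)\mapsto\langle f,\pi(x,\omega)f\rangle$ in $L^1(\mathbb R^2)$; its elements are continuous. Lattices: $\Lambda=\mathbb Z\times\theta\mathbb Z\subset\mathbb R^2$; $\tilde\Lambda=\mathbb Z\times\{\theta m:m=0,\dots,M-1\}\subset a^{-1}\mathbb Z\times\mathbb R/a\mathbb Z$; $\tilde{\tilde\Lambda}=\{an:n=0,\dots,N-1\}\times\{bm:m=0,\dots,M-1\}\subset\mathbb Z_d^2$. The algebras $\mathcal A^{\mathbb R}_\theta$, $\mathcal A^{a^{-1}\mathbb Z}_\theta$, $\mathcal A^{\mathbb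 Z_d}_\theta$ consist of the operators $\sum_\lambda \mathsf a(\lambda)\pi(\lambda)$ with $\mathsf a\in\ell^1$ of the respective lattice, acting on $L^2(\mathbb R)$, $\ell^2(a^{-1}\mathbb Z)$, $\ell^2(\mathbb Z_d)$; the product is composition and the involution the adjoint. For $f,g$ in $\mathbf S_0(\mathbb R)$ (resp. $\ell^1(a^{-1}\mathbb Z)$, $\mathbb C^d$) and $L=\Lambda$ (resp. $\tilde\Lambda$, $\tilde{\tilde\Lambda}$) put ${}_L\langle f,g\rangle=\sum_{\lambda\in L}\langle f,\pi(\lambda)g\rangle\pi(\lambda)$. For $n$-tuples, $[(f_j),(g_j)]_L$ is the $n\times n$ matrix with $(j,k)$ entry ${}_L\langle f_j,g_k\rangle$, acting by matrix-vector multiplication on $n$-tuples of $L^2$-functions (resp. $\ell^2$-sequences, vectors). A projection is a self-adjoint idempotent. The module norm is $\|(g_j)\|_L=\|[(g_j),(g_j)]_L\|_{\rm op}^{1/2}$. $\mathcal R_{\gamma\mathbb Z}:\mathbf S_0(\mathbb R)\to\ell^1(\gamma\mathbb Z)$ is restriction to $\gamma\mathbb Z$, and $\mathcal P_{\gamma d\mathbb Z}:\ell^1(\gamma\mathbb Z)\to\mathbb C^d$ is $(\mathcal P_{\gamma d\mathbb Z}f)(t)=\sum_{k\in\gamma d\mathbb Z}f(\gamma t-k)$, $t\in\{0,\dots,d-1\}$. *)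

theory Defs
  imports "HOL-Analysis.Analysis"
begin

text \<open>
  The Hilbert spaces \<open>L\<^sup>2(\<real>)\<close>, \<open>\<ell>\<^sup>2(a\<^sup>-\<^sup>1\<int>)\<close> and
  \<open>\<ell>\<^sup>2(\<int>\<^sub>d)\<close> are all treated as \<open>L\<^sup>2(\<mu>)\<close>, with
  \<open>\<mu>\<close> the Lebesgue measure or the counting measure on the index set (so that the integral
  is the sum over that set).  Elements are functions, and equality in \<open>L\<^sup>2(\<mu>)\<close> is
  equality almost everywhere; for a counting measure this is equality on the index set.
\<close>

definition L2 :: "'a measure \<Rightarrow> ('a \<Rightarrow> complex) set" where
  "L2 \<mu> = {f \<in> borel_measurable \<mu>. integrable \<mu> (\<lambda>t. (cmod (f t))\<^sup>2)}"

definition L2_inner :: "'a measure \<Rightarrow> ('a \<Rightarrow> complex) \<Rightarrow> ('a \<Rightarrow> complex) \<Rightarrow> complex" where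
  "L2_inner \<mu> f g = (LINT t|\<mu>. f t * cnj (g t))"

definition L2_norm :: "'a measure \<Rightarrow> ('a \<Rightarrow> complex) \<Rightarrow> real" where
  "L2_norm \<mu> f = sqrt (LINT t|\<mu>. (cmod (f t))\<^sup>2)"

definition L2_tuples :: "'a measure \<Rightarrow> ('n \<Rightarrow> 'a \<Rightarrow> complex) set" where
  "L2_tuples \<mu> = {h. \<forall>j. h j \<in> L2 \<mu>}"

definition tuple_inner ::
  "'a measure \<Rightarrow> ('n::finite \<Rightarrow> 'a \<Rightarrow> complex) \<Rightarrow> ('n \<Rightarrow> 'a \<Rightarrow> complex) \<Rightarrow> complex" where
  "tuple_inner \<mu> h k = (\<Sum>j\<in>UNIV. L2_inner \<mu> (h j) (k j))"

definition tuple_norm :: "'a measure \<Rightarrow> ('n::finite \<Rightarrow> 'a \<Rightarrow> complex) \<Rightarrow> real" where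
  "tuple_norm \<mu> h = sqrt (\<Sum>j\<in>UNIV. (L2_norm \<mu> (h j))\<^sup>2)"


subsection \<open>Time-frequency shifts and lattices\<close>

definition multiples :: "real \<Rightarrow> real set" where
  "multiples c = range (\<lambda>k::int. c * of_int k)"

text \<open>
  The same formula serves for \<open>\<real>\<close> and for \<open>a\<^sup>-\<^sup>1\<int>\<close>.  In the latter
  case \<open>\<omega>\<close> represents a class in \<open>\<real>/a\<int>\<close>: replacing \<open>\<omega>\<close> by
  \<open>\<omega> + a\<close> does not change the values at points of \<open>a\<^sup>-\<^sup>1\<int>\<close>.
\<close>

definition tf_shift :: "real \<times> real \<Rightarrow> (real \<Rightarrow> complex) \<Rightarrow> real \<Rightarrow> complex" where
  "tf_shift = (\<lambda>(x, \<omega>) f t. exp (2 * pi * \<i> * \<omega> * t) * f (t - x))"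

text \<open>\<open>\<int>\<^sub>d\<close> is represented by \<open>{0..<d}\<close>.\<close>

definition tf_shift_mod :: "nat \<Rightarrow> int \<times> int \<Rightarrow> (int \<Rightarrow> complex) \<Rightarrow> int \<Rightarrow> complex" where
  "tf_shift_mod d = (\<lambda>(x, \<omega>) f t.
     exp (2 * pi * \<i> * of_int \<omega> * of_int t / of_nat d) * f ((t - x) mod int d))"

definition lattice_R :: "real \<Rightarrow> (real \<times> real) set" where
  "lattice_R \<theta> = multiples 1 \<times> multiples \<theta>"

definition lattice_aZ :: "real \<Rightarrow> nat \<Rightarrow> (real \<times> real) set" where
  "lattice_aZ \<theta> M = multiples 1 \<times> (\<lambda>m. \<theta> * real m) ` {..<M}"

definition lattice_Zd :: "nat \<Rightarrow> nat \<Rightarrow> nat \<Rightarrow> nat \<Rightarrow> (int \<times> int) set" where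
  "lattice_Zd a b M N = (\<lambda>n. int (a * n)) ` {..<N} \<times> (\<lambda>m. int (b * m)) ` {..<M}"

abbreviation measure_aZ :: "nat \<Rightarrow> real measure" where
  "measure_aZ a \<equiv> count_space (multiples (1 / real a))"

abbreviation measure_Zd :: "nat \<Rightarrow> int measure" where
  "measure_Zd d \<equiv> count_space {0..<int d}"


subsection \<open>Operator algebras\<close>

text \<open>
  \<open>has_op_sum \<mu> p L c T\<close>: the series of the operators \<open>c z p(z)\<close> over
  \<open>z \<in> L\<close> converges unconditionally to \<open>T\<close> in the operator norm of
  \<open>L\<^sup>2(\<mu>)\<close>.  This determines \<open>T\<close> up to equality in \<open>L\<^sup>2(\<mu>)\<close>
  of its values, and forces \<open>T\<close> to be bounded and linear in the same sense when the
  \<open>p(z)\<close> are.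
\<close>

definition has_op_sum ::
  "'a measure \<Rightarrow> ('l \<Rightarrow> ('a \<Rightarrow> complex) \<Rightarrow> 'a \<Rightarrow> complex) \<Rightarrow> 'l set \<Rightarrow> ('l \<Rightarrow> complex)
    \<Rightarrow> (('a \<Rightarrow> complex) \<Rightarrow> 'a \<Rightarrow> complex) \<Rightarrow> bool" where
  "has_op_sum \<mu> p L c T \<longleftrightarrow>
     (\<forall>h\<in>L2 \<mu>. T h \<in> L2 \<mu>) \<and>
     (\<forall>\<epsilon>>0. \<forall>\<^sub>F F in finite_subsets_at_top L. \<forall>h\<in>L2 \<mu>.
        L2_norm \<mu> (\<lambda>t. T h t - (\<Sum>z\<in>F. c z * p z h t)) \<le> \<epsilon> * L2_norm \<mu> h)"

definition tf_algebra ::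
  "'a measure \<Rightarrow> ('l \<Rightarrow> ('a \<Rightarrow> complex) \<Rightarrow> 'a \<Rightarrow> complex) \<Rightarrow> 'l set
    \<Rightarrow> (('a \<Rightarrow> complex) \<Rightarrow> 'a \<Rightarrow> complex) set" where
  "tf_algebra \<mu> p L =
     {T. \<exists>c. (\<lambda>z. cmod (c z)) summable_on L \<and> has_op_sum \<mu> p L c T}"

text \<open>The choice is immaterial, the sum being unique up to equality in \<open>L\<^sup>2(\<mu>)\<close>.\<close>

definition alg_inner ::
  "'a measure \<Rightarrow> ('l \<Rightarrow> ('a \<Rightarrow> complex) \<Rightarrow> 'a \<Rightarrow> complex) \<Rightarrow> 'l set
    \<Rightarrow> ('a \<Rightarrow> complex) \<Rightarrow> ('a \<Rightarrow> complex) \<Rightarrow> ('a \<Rightarrow> complex) \<Rightarrow> 'a \<Rightarrow> complex" where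
  "alg_inner \<mu> p L f g = (SOME T. has_op_sum \<mu> p L (\<lambda>z. L2_inner \<mu> f (p z g)) T)"

definition alg_gram ::
  "'a measure \<Rightarrow> ('l \<Rightarrow> ('a \<Rightarrow> complex) \<Rightarrow> 'a \<Rightarrow> complex) \<Rightarrow> 'l set
    \<Rightarrow> ('n \<Rightarrow> 'a \<Rightarrow> complex) \<Rightarrow> ('n \<Rightarrow> 'a \<Rightarrow> complex)
    \<Rightarrow> 'n \<Rightarrow> 'n \<Rightarrow> ('a \<Rightarrow> complex) \<Rightarrow> 'a \<Rightarrow> complex" where
  "alg_gram \<mu> p L f g = (\<lambda>j k. alg_inner \<mu> p L (f j) (g k))"

definition mat_apply ::
  "('n::finite \<Rightarrow> 'n \<Rightarrow> ('a \<Rightarrow> complex) \<Rightarrow> 'a \<Rightarrow> complex)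
    \<Rightarrow> ('n \<Rightarrow> 'a \<Rightarrow> complex) \<Rightarrow> 'n \<Rightarrow> 'a \<Rightarrow> complex" where
  "mat_apply P h = (\<lambda>j t. \<Sum>k\<in>UNIV. P j k (h k) t)"

definition is_projection_in ::
  "'a measure \<Rightarrow> (('a \<Rightarrow> complex) \<Rightarrow> 'a \<Rightarrow> complex) set
    \<Rightarrow> ('n::finite \<Rightarrow> 'n \<Rightarrow> ('a \<Rightarrow> complex) \<Rightarrow> 'a \<Rightarrow> complex) \<Rightarrow> bool" where
  "is_projection_in \<mu> A P \<longleftrightarrow>
     (\<forall>j k. P j k \<in> A) \<and>
     (\<forall>h\<in>L2_tuples \<mu>. \<forall>k\<in>L2_tuples \<mu>.
        tuple_inner \<mu> (mat_apply P h) k = tuple_inner \<mu> h (mat_apply P k)) \<and>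
     (\<forall>h\<in>L2_tuples \<mu>. \<forall>j. AE t in \<mu>. mat_apply P (mat_apply P h) j t = mat_apply P h j t)"

text \<open>Meaningful for bounded operators only, in particular for matrices over \<open>tf_algebra\<close>.\<close>

definition mat_opnorm ::
  "'a measure \<Rightarrow> ('n::finite \<Rightarrow> 'n \<Rightarrow> ('a \<Rightarrow> complex) \<Rightarrow> 'a \<Rightarrow> complex) \<Rightarrow> real" where
  "mat_opnorm \<mu> P =
     (SUP h\<in>{h \<in> L2_tuples \<mu>. tuple_norm \<mu> h \<le> 1}. tuple_norm \<mu> (mat_apply P h))"

definition module_norm ::
  "'a measure \<Rightarrow> ('l \<Rightarrow> ('a \<Rightarrow> complex) \<Rightarrow> 'a \<Rightarrow> complex) \<Rightarrow> 'l set
    \<Rightarrow> ('n::finite \<Rightarrow> 'a \<Rightarrow> complex) \<Rightarrow> real" where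
  "module_norm \<mu> p L g = sqrt (mat_opnorm \<mu> (alg_gram \<mu> p L g g))"


subsection \<open>Feichtinger's algebra, sampling and periodization\<close>

text \<open>
  Every class in \<open>L\<^sup>2(\<real>)\<close> with integrable ambiguity function has exactly one continuous
  representative; it is this representative that is sampled, hence the continuity requirement.
\<close>

definition S0 :: "(real \<Rightarrow> complex) set" where
  "S0 = {f \<in> L2 lborel. continuous_on UNIV f \<and>
          integrable (lborel \<Otimes>\<^sub>M lborel) (\<lambda>z. L2_inner lborel f (tf_shift z f))}"

definition ell1 :: "'a set \<Rightarrow> ('a \<Rightarrow> complex) set" where
  "ell1 X = {f. (\<lambda>t. cmod (f t)) summable_on X}"

text \<open>Functions on \<open>\<gamma>\<int>\<close> are extended by zero.\<close>

definition restr :: "real \<Rightarrow> (real \<Rightarrow> complex) \<Rightarrow> real \<Rightarrow> complex" where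
  "restr \<gamma> f = (\<lambda>t. if t \<in> multiples \<gamma> then f t else 0)"

definition periodize :: "real \<Rightarrow> nat \<Rightarrow> (real \<Rightarrow> complex) \<Rightarrow> int \<Rightarrow> complex" where
  "periodize \<gamma> d f = (\<lambda>t. \<Sum>\<^sub>\<infinity>k\<in>multiples (\<gamma> * real d). f (\<gamma> * of_int t - k))"

definition adjoint_const :: "real \<Rightarrow> ('n::finite \<Rightarrow> real \<Rightarrow> complex) \<Rightarrow> real" where
  "adjoint_const \<theta> g = (1 / \<theta>) *
     (\<Sum>j\<in>UNIV. \<Sum>\<^sub>\<infinity>z\<in>multiples (1 / \<theta>) \<times> multiples 1.
        cmod (L2_inner lborel (g j) (tf_shift z (g j))))"

end

theory Submission
  imports Defs "HOL-Probability.Characteristic_Functions" "HOL-Probability.Sinc_Integral"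
begin

text \<open>
  Write \<open>c = 1 / \<theta>\<close> and
  \<open>\<kappa>\<^sub>j\<^sub>i(t, s) = c (\<Sum>k\<in>\<int>. g\<^sub>j(t + c k) cnj (g\<^sub>i(s + c k)))\<close>.
  Poisson summation over the modulations of \<open>\<int> \<times> \<theta>\<int>\<close> turns the matrix of the \<open>g\<^sub>j\<close> into
  the operator \<open>h \<mapsto> (t \<mapsto> \<Sum>i n. \<kappa>\<^sub>j\<^sub>i(t, t - n) h\<^sub>i(t - n))\<close>, which only relates values at
  points that differ by integers (\<open>alg_inner_kernel\<close>).  After sampling, a finite sum over roots of
  unity takes the place of Poisson summation and gives the same kernel at the points of
  \<open>a\<^sup>-\<^sup>1\<int>\<close>; after periodization it gives the periodized kernel.  So all three matrices are
  read off from \<open>\<kappa>\<close> on the cosets \<open>t + \<int>\<close>.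

  On such a coset \<open>\<kappa> = c A A\<^sup>*\<close>, where \<open>A\<close> has the rows \<open>(i, n)\<close>, the columns \<open>k\<close> and the entries
  \<open>g\<^sub>i(t - n + c k)\<close>.  Apply \<open>P P = P\<close> to the tuple \<open>g\<close> itself: for almost every \<open>t\<close>, the
  column \<open>b\<close> of \<open>A\<close> with \<open>k = 0\<close> satisfies \<open>S (S b) = S b\<close> with \<open>S = c A A\<^sup>*\<close>.  For
  \<open>u = S b - b\<close> this gives \<open>A A\<^sup>* u = 0\<close>, hence \<open>A\<^sup>* u = 0\<close>, and then
  \<open>\<langle>u, u\<rangle> = c \<langle>A\<^sup>* b, A\<^sup>* u\<rangle> - \<langle>b, u\<rangle> = 0\<close> (\<open>idempotent_fixes_columns\<close>).  So
  \<open>c A A\<^sup>* A = A\<close> for almost every \<open>t\<close>, and by continuity for \<^emph>\<open>every\<close> \<open>t\<close>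
  (\<open>column_fixed\<close>).  This pointwise identity is what survives sampling: \<open>\<kappa>\<close> is idempotent on
  every coset, in particular on those that make up \<open>a\<^sup>-\<^sup>1\<int>\<close>, and so is its
  periodization, because \<open>\<kappa>\<close> is invariant under a common shift of both arguments by \<open>N = b c\<close>.
  Hermitian idempotent kernels with bounded row sums are projections (\<open>kernel_projection\<close>).

  A projection has norm at most 1, so the three norm bounds reduce to \<open>1 \<le> C\<close>, unless \<open>g = 0\<close>.
  Now \<open>c A A\<^sup>* A = A\<close> says \<open>g\<^sub>j(t) = c (\<Sum>k. g\<^sub>j(t + c k) G\<^sub>k(t))\<close>, where \<open>G\<^sub>k\<close> is the
  \<open>1\<close>-periodic function with the Fourier coefficients
  \<open>\<Sum>i. \<langle>g\<^sub>i, \<pi>(- c k, m) g\<^sub>i\<rangle>\<close>.  Bounding each \<open>\<bar>G\<^sub>k\<bar>\<close> by the sum of the absolute values of its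
  coefficients yields \<open>sup \<bar>g\<bar> \<le> C sup \<bar>g\<bar>\<close> (\<open>one_le_adjoint_const\<close>).

  That these series converge is the part of the theory of Feichtinger's algebra that is developed
  first.  Fourier inversion in the frequency variable writes \<open>f\<close> as a superposition, with an integrable
  density, of time-frequency shifts of one explicit compactly supported bump (\<open>S0_atomic\<close>).  Hence \<open>f\<close>
  has absolutely summable samples on every lattice, locally uniformly, and \<open>\<langle>f, \<pi>(\<lambda>) g\<rangle>\<close> is
  summable over every lattice, because the corresponding sums for two bumps are bounded uniformly
  over all translates of the lattice (\<open>S0_lattice_bounded\<close>).
\<close>

section \<open>Sums as integrals\<close>

lemma summable_on_iff_integrable:
  fixes f :: "'a \<Rightarrow> complex"
  shows "f summable_on A \<longleftrightarrow> integrable (count_space A) f"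
  using summable_on_iff_abs_summable_on_complex[of f A] abs_summable_equivalent[of f A]
  by (simp add: Infinite_Set_Sum.abs_summable_on_def)

lemma infsum_eq_integral:
  fixes f :: "'a \<Rightarrow> complex"
  shows "infsum f A = (LINT x|count_space A. f x)"
proof (cases "f summable_on A")
  case True
  then have "Infinite_Set_Sum.abs_summable_on f A"
    by (simp add: summable_on_iff_integrable Infinite_Set_Sum.abs_summable_on_def)
  from infsetsum_infsum[OF this] show ?thesis by (simp add: infsetsum_def)
next
  case False
  then show ?thesis
    by (simp add: infsum_not_exists not_integrable_integral_eq summable_on_iff_integrable)
qed

lemma summable_on_iff_integrable_real:
  fixes f :: "'a \<Rightarrow> real"
  shows "f summable_on A \<longleftrightarrow> integrable (count_space A) f"
  using summable_on_iff_abs_summable_on_real[of f A] abs_summable_equivalent[of f A]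
  by (simp add: Infinite_Set_Sum.abs_summable_on_def)

lemma infsum_eq_integral_real:
  fixes f :: "'a \<Rightarrow> real"
  shows "infsum f A = (LINT x|count_space A. f x)"
proof (cases "f summable_on A")
  case True
  then have "Infinite_Set_Sum.abs_summable_on f A"
    by (simp add: summable_on_iff_integrable_real Infinite_Set_Sum.abs_summable_on_def)
  from infsetsum_infsum[OF this] show ?thesis by (simp add: infsetsum_def)
next
  case False
  then show ?thesis
    by (simp add: infsum_not_exists not_integrable_integral_eq summable_on_iff_integrable_real)
qed

lemma nn_integral_count_space_eq_infsum:
  fixes f :: "'a \<Rightarrow> real"
  assumes "f summable_on A" "\<And>x. x \<in> A \<Longrightarrow> 0 \<le> f x"
  shows "(\<integral>\<^sup>+x. ennreal (f x) \<partial>count_space A) = ennreal (infsum f A)"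
  using assms by (subst nn_integral_eq_integral)
    (auto simp: summable_on_iff_integrable_real infsum_eq_integral_real AE_count_space)

lemma summable_on_iff_nn_integral:
  fixes f :: "'a \<Rightarrow> real"
  assumes "\<And>x. x \<in> A \<Longrightarrow> 0 \<le> f x"
  shows "f summable_on A \<longleftrightarrow> (\<integral>\<^sup>+x. ennreal (f x) \<partial>count_space A) < \<infinity>"
proof -
  have "(\<integral>\<^sup>+x. ennreal (norm (f x)) \<partial>count_space A) = (\<integral>\<^sup>+x. ennreal (f x) \<partial>count_space A)"
    by (intro nn_integral_cong) (simp add: assms)
  then show ?thesis
    by (simp add: summable_on_iff_integrable_real integrable_iff_bounded)
qed

lemma borel_measurable_infsum:
  fixes f :: "'z \<Rightarrow> 'a \<Rightarrow> complex"
  assumes "countable A" and [measurable]: "\<And>z. z \<in> A \<Longrightarrow> f z \<in> borel_measurable M"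
  shows "(\<lambda>t. \<Sum>\<^sub>\<infinity>z\<in>A. f z t) \<in> borel_measurable M"
proof -
  interpret sigma_finite_measure "count_space A"
    by (rule sigma_finite_measure_count_space_countable[OF assms(1)])
  have "(\<lambda>x. f (fst x) (snd x)) \<in> borel_measurable (count_space A \<Otimes>\<^sub>M M)"
    by (rule measurable_pair_measure_countable1[OF assms(1)]) simp
  from measurable_compose[OF measurable_pair_swap' this]
  have [measurable]: "(\<lambda>x. f (snd x) (fst x)) \<in> borel_measurable (M \<Otimes>\<^sub>M count_space A)"
    by (simp add: split_beta)
  show ?thesis unfolding infsum_eq_integral
    by (rule borel_measurable_lebesgue_integral) (simp add: split_beta)
qed

text \<open>
  The quadratic polynomial \<open>s \<mapsto> \<Sum>z. \<bar>c z\<bar> (\<bar>u z\<bar> - s)\<^sup>2\<close> is nonnegative; its value at the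
  weighted mean of \<open>\<bar>u\<bar>\<close> is the second claim.
\<close>

lemma weighted_Cauchy_Schwarz:
  fixes c u :: "'z \<Rightarrow> complex"
  assumes c: "(\<lambda>z. cmod (c z)) summable_on A"
    and cu: "(\<lambda>z. cmod (c z) * (cmod (u z))\<^sup>2) summable_on A"
  shows "(\<lambda>z. c z * u z) summable_on A"
    and "(cmod (\<Sum>\<^sub>\<infinity>z\<in>A. c z * u z))\<^sup>2
          \<le> (\<Sum>\<^sub>\<infinity>z\<in>A. cmod (c z)) * (\<Sum>\<^sub>\<infinity>z\<in>A. cmod (c z) * (cmod (u z))\<^sup>2)"
proof -
  have le: "cmod (u z) \<le> 1 + (cmod (u z))\<^sup>2" for z
    using sum_squares_bound[of 1 "cmod (u z)"] by (simp add: power2_eq_square) (smt (verit) norm_ge_zero)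
  have abs: "(\<lambda>z. cmod (c z) * cmod (u z)) summable_on A"
  proof (rule summable_on_comparison_test)
    show "(\<lambda>z. cmod (c z) + cmod (c z) * (cmod (u z))\<^sup>2) summable_on A"
      by (intro summable_on_add c cu)
    show "cmod (c z) * cmod (u z) \<le> cmod (c z) + cmod (c z) * (cmod (u z))\<^sup>2" for z
      using mult_left_mono[OF le[of z], of "cmod (c z)"] by (simp add: algebra_simps)
  qed auto
  then show "(\<lambda>z. c z * u z) summable_on A"
    by (subst summable_on_iff_abs_summable_on_complex) (simp add: norm_mult)
  define W where "W = (\<Sum>\<^sub>\<infinity>z\<in>A. cmod (c z))"
  define X where "X = (\<Sum>\<^sub>\<infinity>z\<in>A. cmod (c z) * cmod (u z))"
  define Y where "Y = (\<Sum>\<^sub>\<infinity>z\<in>A. cmod (c z) * (cmod (u z))\<^sup>2)"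
  have hW: "((\<lambda>z. cmod (c z)) has_sum W) A" and hX: "((\<lambda>z. cmod (c z) * cmod (u z)) has_sum X) A"
    and hY: "((\<lambda>z. cmod (c z) * (cmod (u z))\<^sup>2) has_sum Y) A"
    unfolding W_def X_def Y_def using c abs cu by auto
  have X0: "X \<ge> 0" and W0: "W \<ge> 0" unfolding X_def W_def by (auto intro!: infsum_nonneg)
  have q: "0 \<le> Y - 2 * s * X + s\<^sup>2 * W" for s
  proof -
    have "((\<lambda>z. cmod (c z) * (cmod (u z))\<^sup>2 + (- 2 * s) * (cmod (c z) * cmod (u z)) + s\<^sup>2 * cmod (c z))
        has_sum (Y + (- 2 * s) * X + s\<^sup>2 * W)) A"
      by (intro has_sum_add has_sum_cmult_right hW hX hY)
    moreover have "cmod (c z) * (cmod (u z))\<^sup>2 + (- 2 * s) * (cmod (c z) * cmod (u z)) + s\<^sup>2 * cmod (c z)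
        = cmod (c z) * (cmod (u z) - s)\<^sup>2" for z
      by (simp add: algebra_simps power2_eq_square)
    ultimately show ?thesis
      using has_sum_nonneg[of "\<lambda>z. cmod (c z) * (cmod (u z) - s)\<^sup>2"] by fastforce
  qed
  have "X\<^sup>2 \<le> W * Y"
  proof (cases "W = 0")
    case True
    have "X = 0"
    proof -
      have "\<not> X > 0"
      proof
        assume "X > 0"
        show False using q[of "(Y + 1) / (2 * X)"] True \<open>X > 0\<close> by (simp add: field_simps)
      qed
      with X0 show ?thesis by simp
    qed
    with True show ?thesis by simp
  next
    case False
    with W0 have "W > 0" by simp
    with q[of "X / W"] show ?thesis by (simp add: field_simps power2_eq_square)
  qed
  moreover have "cmod (\<Sum>\<^sub>\<infinity>z\<in>A. c z * u z) \<le> X"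
    unfolding X_def using norm_infsum_bound[of "\<lambda>z. c z * u z" A] abs by (simp add: norm_mult)
  ultimately show "(cmod (\<Sum>\<^sub>\<infinity>z\<in>A. c z * u z))\<^sup>2
          \<le> (\<Sum>\<^sub>\<infinity>z\<in>A. cmod (c z)) * (\<Sum>\<^sub>\<infinity>z\<in>A. cmod (c z) * (cmod (u z))\<^sup>2)"
    unfolding W_def[symmetric] Y_def[symmetric]
    by (meson norm_ge_zero order_trans power_mono)
qed

section \<open>Square integrable functions\<close>

lemma borel_measurable_cnj' [measurable (raw)]:
  "f \<in> borel_measurable M \<Longrightarrow> (\<lambda>x. cnj (f x)) \<in> borel_measurable M"
  by (rule borel_measurable_continuous_on[of cnj]) (auto intro: continuous_intros)

lemma L2_zero [simp]: "(\<lambda>t. 0) \<in> L2 \<mu>"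
  by (simp add: L2_def)

lemma L2_cmult: "f \<in> L2 \<mu> \<Longrightarrow> (\<lambda>t. c * f t) \<in> L2 \<mu>"
  by (auto simp: L2_def norm_mult power_mult_distrib)

lemma L2_add:
  assumes "f \<in> L2 \<mu>" "g \<in> L2 \<mu>" shows "(\<lambda>t. f t + g t) \<in> L2 \<mu>"
proof -
  have [measurable]: "f \<in> borel_measurable \<mu>" "g \<in> borel_measurable \<mu>" using assms by (auto simp: L2_def)
  have le: "(cmod (a + b))\<^sup>2 \<le> 2 * (cmod a)\<^sup>2 + 2 * (cmod b)\<^sup>2" for a b
  proof -
    have "(cmod (a + b))\<^sup>2 \<le> (cmod a + cmod b)\<^sup>2" by (intro power_mono norm_triangle_ineq) auto
    then show ?thesis using sum_squares_bound[of "cmod a" "cmod b"] by (simp add: power2_sum)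
  qed
  have "integrable \<mu> (\<lambda>t. 2 * (cmod (f t))\<^sup>2 + 2 * (cmod (g t))\<^sup>2)"
    using assms by (auto simp: L2_def)
  then have "integrable \<mu> (\<lambda>t. (cmod (f t + g t))\<^sup>2)"
    by (rule Bochner_Integration.integrable_bound) (use le in auto)
  then show ?thesis by (simp add: L2_def)
qed

lemma L2_diff: "f \<in> L2 \<mu> \<Longrightarrow> g \<in> L2 \<mu> \<Longrightarrow> (\<lambda>t. f t - g t) \<in> L2 \<mu>"
  using L2_add[of f \<mu> "\<lambda>t. -1 * g t"] L2_cmult[of g \<mu> "-1"] by simp

lemma L2_sum: "(\<And>i. i \<in> I \<Longrightarrow> f i \<in> L2 \<mu>) \<Longrightarrow> (\<lambda>t. \<Sum>i\<in>I. f i t) \<in> L2 \<mu>"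
  by (induction I rule: infinite_finite_induct) (auto intro: L2_add)

lemma L2_mult_integrable:
  assumes "f \<in> L2 \<mu>" "g \<in> L2 \<mu>" shows "integrable \<mu> (\<lambda>t. f t * cnj (g t))"
proof -
  have [measurable]: "f \<in> borel_measurable \<mu>" "g \<in> borel_measurable \<mu>" using assms by (auto simp: L2_def)
  have "integrable \<mu> (\<lambda>t. (cmod (f t))\<^sup>2 + (cmod (g t))\<^sup>2)" using assms by (auto simp: L2_def)
  then show ?thesis
  proof (rule Bochner_Integration.integrable_bound)
    have "cmod (f t * cnj (g t)) \<le> (cmod (f t))\<^sup>2 + (cmod (g t))\<^sup>2" for t
      using sum_squares_bound[of "cmod (f t)" "cmod (g t)"] mult_nonneg_nonneg[of "cmod (f t)" "cmod (g t)"]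
      by (simp add: norm_mult del: mult_nonneg_nonneg)
    then show "AE t in \<mu>. cmod (f t * cnj (g t)) \<le> norm ((cmod (f t))\<^sup>2 + (cmod (g t))\<^sup>2)"
      by (auto intro!: AE_I2 order_trans[OF _ abs_ge_self])
  qed measurable
qed

lemma L2_norm_nonneg: "L2_norm \<mu> f \<ge> 0"
  by (simp add: L2_norm_def)

lemma L2_norm_sq: "(L2_norm \<mu> f)\<^sup>2 = (LINT t|\<mu>. (cmod (f t))\<^sup>2)"
  by (simp add: L2_norm_def)

lemma nn_integral_L2: "f \<in> L2 \<mu> \<Longrightarrow> (\<integral>\<^sup>+t. ennreal ((cmod (f t))\<^sup>2) \<partial>\<mu>) = ennreal ((L2_norm \<mu> f)\<^sup>2)"
  unfolding L2_norm_sq by (rule nn_integral_eq_integral) (auto simp: L2_def)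

lemma L2_norm_cong_AE:
  assumes "AE t in \<mu>. f t = g t" "f \<in> borel_measurable \<mu>" "g \<in> borel_measurable \<mu>"
  shows "L2_norm \<mu> f = L2_norm \<mu> g"
  unfolding L2_norm_def using assms by (intro arg_cong[where f=sqrt] integral_cong_AE) auto

lemma L2_dist_sq:
  assumes "f \<in> L2 \<mu>" "g \<in> L2 \<mu>"
  shows "(L2_norm \<mu> (\<lambda>t. f t - g t))\<^sup>2 \<le> 2 * (L2_norm \<mu> f)\<^sup>2 + 2 * (L2_norm \<mu> g)\<^sup>2"
proof -
  have le: "(cmod (a - b))\<^sup>2 \<le> 2 * (cmod a)\<^sup>2 + 2 * (cmod b)\<^sup>2" for a b
  proof -
    have "(cmod (a - b))\<^sup>2 \<le> (cmod a + cmod b)\<^sup>2" by (intro power_mono norm_triangle_ineq4) auto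
    then show ?thesis using sum_squares_bound[of "cmod a" "cmod b"] by (simp add: power2_sum)
  qed
  have "(LINT t|\<mu>. (cmod (f t - g t))\<^sup>2) \<le> (LINT t|\<mu>. 2 * (cmod (f t))\<^sup>2 + 2 * (cmod (g t))\<^sup>2)"
    by (rule integral_mono) (use assms L2_diff[OF assms] le in \<open>auto simp: L2_def\<close>)
  also have "\<dots> = 2 * (LINT t|\<mu>. (cmod (f t))\<^sup>2) + 2 * (LINT t|\<mu>. (cmod (g t))\<^sup>2)"
    using assms by (subst Bochner_Integration.integral_add) (auto simp: L2_def)
  finally show ?thesis by (simp add: L2_norm_sq)
qed

lemma L2_norm_eq_0_AE:
  assumes "f \<in> L2 \<mu>" "L2_norm \<mu> f = 0" shows "AE t in \<mu>. f t = 0"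
proof -
  have "(LINT t|\<mu>. (cmod (f t))\<^sup>2) = 0" using assms L2_norm_sq[of \<mu> f] by simp
  then have "AE t in \<mu>. (cmod (f t))\<^sup>2 = 0"
    using assms by (subst (asm) integral_nonneg_eq_0_iff_AE) (auto simp: L2_def)
  then show ?thesis by simp
qed

section \<open>Unconditionally convergent operator series\<close>

lemma has_op_sumD: "has_op_sum \<mu> p L c T \<Longrightarrow> h \<in> L2 \<mu> \<Longrightarrow> T h \<in> L2 \<mu>"
  unfolding has_op_sum_def by (drule conjunct1) (erule bspec)

lemma has_op_sum_eventually:
  assumes "has_op_sum \<mu> p L c T" "h \<in> L2 \<mu>" "\<epsilon> > 0"
  shows "\<forall>\<^sub>F F in finite_subsets_at_top L.
    L2_norm \<mu> (\<lambda>t. T h t - (\<Sum>z\<in>F. c z * p z h t)) \<le> \<epsilon> * L2_norm \<mu> h"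
  using assms(1)[unfolded has_op_sum_def, THEN conjunct2, rule_format, OF assms(3)]
  by (rule eventually_mono) (erule bspec[OF _ assms(2)])

locale contractions =
  fixes \<mu> :: "'a measure" and p :: "'l \<Rightarrow> ('a \<Rightarrow> complex) \<Rightarrow> 'a \<Rightarrow> complex" and L :: "'l set"
  assumes countable_L: "countable L"
    and p_L2: "\<And>z h. z \<in> L \<Longrightarrow> h \<in> L2 \<mu> \<Longrightarrow> p z h \<in> L2 \<mu>"
    and p_le: "\<And>z h. z \<in> L \<Longrightarrow> h \<in> L2 \<mu> \<Longrightarrow> L2_norm \<mu> (p z h) \<le> L2_norm \<mu> h"
begin

definition op_series :: "('l \<Rightarrow> complex) \<Rightarrow> ('a \<Rightarrow> complex) \<Rightarrow> 'a \<Rightarrow> complex" where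
  "op_series c h = (\<lambda>t. \<Sum>\<^sub>\<infinity>z\<in>L. c z * p z h t)"

text \<open>
  This is Minkowski's inequality for infinitely many summands: pointwise, the square of the sum
  is at most \<open>(\<Sum>\<bar>c z\<bar>) (\<Sum>\<bar>c z\<bar> \<bar>p z h t\<bar>\<^sup>2)\<close> by the weighted Cauchy-Schwarz
  inequality, and the second factor is integrable, which also gives convergence almost everywhere.
\<close>

lemma
  assumes c: "(\<lambda>z. cmod (c z)) summable_on L" and h: "h \<in> L2 \<mu>" and A: "A \<subseteq> L"
  shows AE_summable_op_series: "AE t in \<mu>. (\<lambda>z. c z * p z h t) summable_on A"
    and L2_op_series: "(\<lambda>t. \<Sum>\<^sub>\<infinity>z\<in>A. c z * p z h t) \<in> L2 \<mu>"
    and L2_norm_op_series: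
      "L2_norm \<mu> (\<lambda>t. \<Sum>\<^sub>\<infinity>z\<in>A. c z * p z h t) \<le> (\<Sum>\<^sub>\<infinity>z\<in>A. cmod (c z)) * L2_norm \<mu> h"
proof -
  have cA: "(\<lambda>z. cmod (c z)) summable_on A" using summable_on_subset[OF c A] .
  have ctA: "countable A" using countable_L A countable_subset by blast
  have [measurable]: "p z h \<in> borel_measurable \<mu>" if "z \<in> A" for z
    using p_L2[of z h] that A h by (auto simp: L2_def)
  define W where "W = (\<Sum>\<^sub>\<infinity>z\<in>A. cmod (c z))"
  have W0: "W \<ge> 0" unfolding W_def by (auto intro!: infsum_nonneg)
  define E where "E t = (\<integral>\<^sup>+z. ennreal (cmod (c z) * (cmod (p z h t))\<^sup>2) \<partial>count_space A)" for t
  have "(\<integral>\<^sup>+t. E t \<partial>\<mu>) = (\<integral>\<^sup>+z. \<integral>\<^sup>+t. ennreal (cmod (c z) * (cmod (p z h t))\<^sup>2) \<partial>\<mu> \<partial>count_space A)"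
    unfolding E_def by (rule nn_integral_count_space_nn_integral[OF ctA]) simp
  also have "\<dots> \<le> (\<integral>\<^sup>+z. ennreal (cmod (c z) * (L2_norm \<mu> h)\<^sup>2) \<partial>count_space A)"
  proof (rule nn_integral_mono)
    fix z assume "z \<in> space (count_space A)"
    then have z: "z \<in> A" "z \<in> L" using A by auto
    have "(\<integral>\<^sup>+t. ennreal (cmod (c z) * (cmod (p z h t))\<^sup>2) \<partial>\<mu>)
        = ennreal (cmod (c z)) * ennreal ((L2_norm \<mu> (p z h))\<^sup>2)"
      using z by (simp add: ennreal_mult nn_integral_cmult nn_integral_L2 p_L2 h)
    also have "\<dots> \<le> ennreal (cmod (c z)) * ennreal ((L2_norm \<mu> h)\<^sup>2)"
      by (intro mult_left_mono ennreal_leI power_mono p_le z h L2_norm_nonneg) simp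
    finally show "(\<integral>\<^sup>+t. ennreal (cmod (c z) * (cmod (p z h t))\<^sup>2) \<partial>\<mu>)
        \<le> ennreal (cmod (c z) * (L2_norm \<mu> h)\<^sup>2)"
      by (simp add: ennreal_mult)
  qed
  also have "\<dots> = ennreal (W * (L2_norm \<mu> h)\<^sup>2)"
    unfolding W_def by (subst nn_integral_count_space_eq_infsum)
      (auto intro!: summable_on_cmult_left cA simp: infsum_cmult_left' simp del: )
  finally have E_le: "(\<integral>\<^sup>+t. E t \<partial>\<mu>) \<le> ennreal (W * (L2_norm \<mu> h)\<^sup>2)" .
  have E_meas [measurable]: "E \<in> borel_measurable \<mu>"
  proof -
    interpret sigma_finite_measure "count_space A"
      by (rule sigma_finite_measure_count_space_countable[OF ctA])
    have "(\<lambda>x. ennreal (cmod (c (fst x)) * (cmod (p (fst x) h (snd x)))\<^sup>2))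
        \<in> borel_measurable (count_space A \<Otimes>\<^sub>M \<mu>)"
      by (rule measurable_pair_measure_countable1[OF ctA]) simp
    from measurable_compose[OF measurable_pair_swap' this]
    have "(\<lambda>x. ennreal (cmod (c (snd x)) * (cmod (p (snd x) h (fst x)))\<^sup>2))
        \<in> borel_measurable (\<mu> \<Otimes>\<^sub>M count_space A)"
      by (simp add: split_beta)
    then show ?thesis unfolding E_def
      by (intro borel_measurable_nn_integral) (simp add: split_beta)
  qed
  have "(\<integral>\<^sup>+t. E t \<partial>\<mu>) \<noteq> \<infinity>" using E_le by (metis ennreal_neq_top infinity_ennreal_def neq_top_trans)
  then have fin: "AE t in \<mu>. E t \<noteq> \<infinity>" by (intro nn_integral_PInf_AE) auto
  have key: "(\<lambda>z. c z * p z h t) summable_on A \<and>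
      ennreal ((cmod (\<Sum>\<^sub>\<infinity>z\<in>A. c z * p z h t))\<^sup>2) \<le> ennreal W * E t" if "E t \<noteq> \<infinity>" for t
  proof -
    have s: "(\<lambda>z. cmod (c z) * (cmod (p z h t))\<^sup>2) summable_on A"
      using that unfolding E_def by (subst summable_on_iff_nn_integral) (auto simp: top.not_eq_extremum)
    have "E t = ennreal (\<Sum>\<^sub>\<infinity>z\<in>A. cmod (c z) * (cmod (p z h t))\<^sup>2)"
      unfolding E_def by (rule nn_integral_count_space_eq_infsum[OF s]) auto
    with weighted_Cauchy_Schwarz[OF cA s] W0 show ?thesis
      by (auto simp: W_def ennreal_mult[symmetric] infsum_nonneg intro!: ennreal_leI)
  qed
  show "AE t in \<mu>. (\<lambda>z. c z * p z h t) summable_on A" using fin by eventually_elim (use key in auto)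
  have meas [measurable]: "(\<lambda>t. \<Sum>\<^sub>\<infinity>z\<in>A. c z * p z h t) \<in> borel_measurable \<mu>"
    by (rule borel_measurable_infsum[OF ctA]) simp
  have "(\<integral>\<^sup>+t. ennreal ((cmod (\<Sum>\<^sub>\<infinity>z\<in>A. c z * p z h t))\<^sup>2) \<partial>\<mu>) \<le> (\<integral>\<^sup>+t. ennreal W * E t \<partial>\<mu>)"
    by (rule nn_integral_mono_AE) (use fin in eventually_elim, use key in auto)
  also have "\<dots> = ennreal W * (\<integral>\<^sup>+t. E t \<partial>\<mu>)" by (rule nn_integral_cmult) simp
  also have "\<dots> \<le> ennreal W * ennreal (W * (L2_norm \<mu> h)\<^sup>2)"
    by (rule mult_left_mono[OF E_le]) simp
  also have "\<dots> = ennreal ((W * L2_norm \<mu> h)\<^sup>2)"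
    using W0 by (simp add: ennreal_mult[symmetric] power2_eq_square mult_ac)
  finally have bd: "(\<integral>\<^sup>+t. ennreal ((cmod (\<Sum>\<^sub>\<infinity>z\<in>A. c z * p z h t))\<^sup>2) \<partial>\<mu>)
      \<le> ennreal ((W * L2_norm \<mu> h)\<^sup>2)" .
  show L2: "(\<lambda>t. \<Sum>\<^sub>\<infinity>z\<in>A. c z * p z h t) \<in> L2 \<mu>"
    unfolding L2_def using order.strict_trans1[OF bd ennreal_less_top]
    by (auto simp: integrable_iff_bounded)
  have "(L2_norm \<mu> (\<lambda>t. \<Sum>\<^sub>\<infinity>z\<in>A. c z * p z h t))\<^sup>2 \<le> (W * L2_norm \<mu> h)\<^sup>2"
    using bd unfolding nn_integral_L2[OF L2] by (subst (asm) ennreal_le_iff) auto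
  then show "L2_norm \<mu> (\<lambda>t. \<Sum>\<^sub>\<infinity>z\<in>A. c z * p z h t) \<le> (\<Sum>\<^sub>\<infinity>z\<in>A. cmod (c z)) * L2_norm \<mu> h"
    unfolding W_def[symmetric] by (rule power2_le_imp_le) (simp add: W0 L2_norm_nonneg)
qed

lemma has_op_sum_op_series:
  assumes c: "(\<lambda>z. cmod (c z)) summable_on L"
  shows "has_op_sum \<mu> p L c (op_series c)"
  unfolding has_op_sum_def
proof (intro conjI ballI allI impI)
  show "op_series c h \<in> L2 \<mu>" if "h \<in> L2 \<mu>" for h
    unfolding op_series_def using L2_op_series[OF c that subset_refl] .
  fix \<epsilon> :: real assume "\<epsilon> > 0"
  obtain F0 where F0: "finite F0" "F0 \<subseteq> L" "dist (\<Sum>z\<in>F0. cmod (c z)) (\<Sum>\<^sub>\<infinity>z\<in>L. cmod (c z)) \<le> \<epsilon>"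
    using infsum_finite_approximation[OF c \<open>\<epsilon> > 0\<close>] by auto
  show "\<forall>\<^sub>F F in finite_subsets_at_top L. \<forall>h\<in>L2 \<mu>.
        L2_norm \<mu> (\<lambda>t. op_series c h t - (\<Sum>z\<in>F. c z * p z h t)) \<le> \<epsilon> * L2_norm \<mu> h"
    unfolding eventually_finite_subsets_at_top
  proof (intro exI[of _ F0] conjI allI impI ballI F0)
    fix F h assume F: "finite F \<and> F0 \<subseteq> F \<and> F \<subseteq> L" and h: "h \<in> L2 \<mu>"
    have "(\<Sum>\<^sub>\<infinity>z\<in>L. cmod (c z)) = (\<Sum>z\<in>F. cmod (c z)) + (\<Sum>\<^sub>\<infinity>z\<in>L - F. cmod (c z))"
      using infsum_Un_disjoint[of "\<lambda>z. cmod (c z)" F "L - F"] F c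
      by (auto simp: Un_absorb1 intro: summable_on_subset)
    moreover have "(\<Sum>z\<in>F. cmod (c z)) \<ge> (\<Sum>z\<in>F0. cmod (c z))"
      using F by (intro sum_mono2) auto
    ultimately have tail: "(\<Sum>\<^sub>\<infinity>z\<in>L - F. cmod (c z)) \<le> \<epsilon>"
      using F0(3) by (auto simp: dist_real_def)
    have AE: "AE t in \<mu>. op_series c h t - (\<Sum>z\<in>F. c z * p z h t) = (\<Sum>\<^sub>\<infinity>z\<in>L - F. c z * p z h t)"
      using AE_summable_op_series[OF c h Diff_subset[of L F]]
    proof eventually_elim
      case (elim t)
      show ?case unfolding op_series_def
        using infsum_Un_disjoint[of "\<lambda>z. c z * p z h t" F "L - F"] F elim
        by (auto simp: Un_absorb1)
    qed
    have 1: "(\<lambda>t. \<Sum>z\<in>F. c z * p z h t) \<in> L2 \<mu>"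
      using F h by (intro L2_sum L2_cmult p_L2) auto
    have 2: "op_series c h \<in> L2 \<mu>"
      unfolding op_series_def using L2_op_series[OF c h subset_refl] .
    have "L2_norm \<mu> (\<lambda>t. op_series c h t - (\<Sum>z\<in>F. c z * p z h t))
        = L2_norm \<mu> (\<lambda>t. \<Sum>\<^sub>\<infinity>z\<in>L - F. c z * p z h t)"
      by (rule L2_norm_cong_AE[OF AE])
        (use L2_diff[OF 2 1] L2_op_series[OF c h Diff_subset[of L F]] in \<open>auto simp: L2_def\<close>)
    also have "\<dots> \<le> (\<Sum>\<^sub>\<infinity>z\<in>L - F. cmod (c z)) * L2_norm \<mu> h"
      by (rule L2_norm_op_series[OF c h Diff_subset])
    also have "\<dots> \<le> \<epsilon> * L2_norm \<mu> h" by (rule mult_right_mono[OF tail L2_norm_nonneg])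
    finally show "L2_norm \<mu> (\<lambda>t. op_series c h t - (\<Sum>z\<in>F. c z * p z h t)) \<le> \<epsilon> * L2_norm \<mu> h" .
  qed
qed

text \<open>
  Both operators are within \<open>\<epsilon>\<close> of a common finite partial sum.
\<close>

lemma has_op_sum_unique:
  assumes "has_op_sum \<mu> p L c T" "has_op_sum \<mu> p L c T'" and h: "h \<in> L2 \<mu>"
  shows "AE t in \<mu>. T h t = T' h t"
proof -
  have T: "T h \<in> L2 \<mu>" and T': "T' h \<in> L2 \<mu>" by (rule has_op_sumD[OF assms(1) h] has_op_sumD[OF assms(2) h])+
  define D where "D = (L2_norm \<mu> (\<lambda>t. T h t - T' h t))\<^sup>2"
  have bd: "D \<le> 4 * (\<epsilon> * L2_norm \<mu> h)\<^sup>2" if "\<epsilon> > 0" for \<epsilon>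
  proof -
    have "\<forall>\<^sub>F F in finite_subsets_at_top L. (finite F \<and> F \<subseteq> L) \<and>
        L2_norm \<mu> (\<lambda>t. T h t - (\<Sum>z\<in>F. c z * p z h t)) \<le> \<epsilon> * L2_norm \<mu> h \<and>
        L2_norm \<mu> (\<lambda>t. T' h t - (\<Sum>z\<in>F. c z * p z h t)) \<le> \<epsilon> * L2_norm \<mu> h"
      by (intro eventually_conj eventually_finite_subsets_at_top_weakI conjI
          has_op_sum_eventually[OF assms(1) h that] has_op_sum_eventually[OF assms(2) h that])
    from eventually_happens'[OF finite_subsets_at_top_neq_bot this] obtain F where F: "finite F" "F \<subseteq> L"
        "L2_norm \<mu> (\<lambda>t. T h t - (\<Sum>z\<in>F. c z * p z h t)) \<le> \<epsilon> * L2_norm \<mu> h"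
        "L2_norm \<mu> (\<lambda>t. T' h t - (\<Sum>z\<in>F. c z * p z h t)) \<le> \<epsilon> * L2_norm \<mu> h"
      by (elim exE conjE)
    have S: "(\<lambda>t. \<Sum>z\<in>F. c z * p z h t) \<in> L2 \<mu>"
      using F h by (intro L2_sum L2_cmult p_L2) auto
    have "D \<le> 2 * (L2_norm \<mu> (\<lambda>t. T h t - (\<Sum>z\<in>F. c z * p z h t)))\<^sup>2
        + 2 * (L2_norm \<mu> (\<lambda>t. T' h t - (\<Sum>z\<in>F. c z * p z h t)))\<^sup>2"
      using L2_dist_sq[OF L2_diff[OF T S] L2_diff[OF T' S]] by (simp add: D_def)
    also have "\<dots> \<le> 2 * (\<epsilon> * L2_norm \<mu> h)\<^sup>2 + 2 * (\<epsilon> * L2_norm \<mu> h)\<^sup>2"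
      by (intro add_mono mult_left_mono power_mono F L2_norm_nonneg) auto
    finally show ?thesis by simp
  qed
  have "D \<le> 0"
  proof (rule tendsto_lowerbound)
    show "((\<lambda>\<epsilon>. 4 * (\<epsilon> * L2_norm \<mu> h)\<^sup>2) \<longlongrightarrow> 0) (at_right 0)"
      by (auto intro!: tendsto_eq_intros)
    show "\<forall>\<^sub>F \<epsilon> in at_right 0. D \<le> 4 * (\<epsilon> * L2_norm \<mu> h)\<^sup>2"
      using bd by (rule eventually_mono[OF eventually_at_right_less])
  qed auto
  then have "L2_norm \<mu> (\<lambda>t. T h t - T' h t) = 0" unfolding D_def by simp
  from L2_norm_eq_0_AE[OF L2_diff[OF T T'] this] show ?thesis by simp
qed

text \<open>
  Replaces the operator chosen in the definition of \<open>alg_inner\<close> by the pointwise series.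
\<close>

lemma alg_inner_op_series:
  assumes c: "(\<lambda>z. cmod (L2_inner \<mu> f (p z g))) summable_on L"
  shows "alg_inner \<mu> p L f g \<in> tf_algebra \<mu> p L"
    and "h \<in> L2 \<mu> \<Longrightarrow> AE t in \<mu>. alg_inner \<mu> p L f g h t
          = (\<Sum>\<^sub>\<infinity>z\<in>L. L2_inner \<mu> f (p z g) * p z h t)"
proof -
  have *: "has_op_sum \<mu> p L (\<lambda>z. L2_inner \<mu> f (p z g)) (alg_inner \<mu> p L f g)"
    unfolding alg_inner_def
    by (rule someI[where P="has_op_sum \<mu> p L (\<lambda>z. L2_inner \<mu> f (p z g))", OF has_op_sum_op_series[OF c]])
  then show "alg_inner \<mu> p L f g \<in> tf_algebra \<mu> p L"
    using c by (auto simp: tf_algebra_def)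
  show "h \<in> L2 \<mu> \<Longrightarrow> AE t in \<mu>. alg_inner \<mu> p L f g h t
          = (\<Sum>\<^sub>\<infinity>z\<in>L. L2_inner \<mu> f (p z g) * p z h t)"
    using has_op_sum_unique[OF * has_op_sum_op_series[OF c]] by (simp add: op_series_def)
qed

end

section \<open>Projections have norm at most one\<close>

lemma tf_algebra_L2: "T \<in> tf_algebra \<mu> p L \<Longrightarrow> h \<in> L2 \<mu> \<Longrightarrow> T h \<in> L2 \<mu>"
proof -
  assume "T \<in> tf_algebra \<mu> p L" and h: "h \<in> L2 \<mu>"
  then obtain c where "has_op_sum \<mu> p L c T" unfolding tf_algebra_def by (elim CollectE exE conjE)
  from has_op_sumD[OF this h] show ?thesis .
qed

lemma mat_apply_L2:
  assumes "\<And>j k. P j k \<in> tf_algebra \<mu> p L" "h \<in> L2_tuples \<mu>"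
  shows "mat_apply P h \<in> L2_tuples \<mu>"
proof -
  have "P j k (h k) \<in> L2 \<mu>" for j k
    using tf_algebra_L2[OF assms(1)] assms(2) by (simp add: L2_tuples_def)
  then show ?thesis unfolding L2_tuples_def mat_apply_def by (simp add: L2_sum)
qed

lemma tuple_norm_sq:
  "(tuple_norm \<mu> h)\<^sup>2 = (\<Sum>j\<in>UNIV. LINT t|\<mu>. (cmod (h j t))\<^sup>2)"
  unfolding tuple_norm_def by (subst real_sqrt_pow2) (auto simp: L2_norm_sq intro!: sum_nonneg)

text \<open>
  \<open>\<parallel>P h\<parallel>\<^sup>2 = \<langle>h, P (P h)\<rangle> = \<langle>h, P h\<rangle> \<le> (\<parallel>h\<parallel>\<^sup>2 + \<parallel>P h\<parallel>\<^sup>2) / 2\<close>.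
\<close>

lemma tuple_norm_le_one:
  fixes P :: "'n::finite \<Rightarrow> 'n \<Rightarrow> ('a \<Rightarrow> complex) \<Rightarrow> 'a \<Rightarrow> complex"
  assumes P: "is_projection_in \<mu> (tf_algebra \<mu> p L) P" and h: "h \<in> L2_tuples \<mu>"
  shows "tuple_norm \<mu> (mat_apply P h) \<le> tuple_norm \<mu> h"
proof -
  define u where "u = mat_apply P h"
  have u: "u \<in> L2_tuples \<mu>" and Pu: "mat_apply P u \<in> L2_tuples \<mu>"
    unfolding u_def using P h by (auto intro!: mat_apply_L2 simp: is_projection_in_def)
  have [measurable]: "u j \<in> borel_measurable \<mu>" "mat_apply P u j \<in> borel_measurable \<mu>"
      "h j \<in> borel_measurable \<mu>" for j
    using u Pu h by (auto simp: L2_tuples_def L2_def)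
  have "tuple_inner \<mu> u u = tuple_inner \<mu> h (mat_apply P u)"
    using P h u unfolding is_projection_in_def u_def by blast
  also have "\<dots> = tuple_inner \<mu> h u"
  proof -
    have "AE t in \<mu>. h j t * cnj (mat_apply P u j t) = h j t * cnj (u j t)" for j
    proof -
      have "AE t in \<mu>. mat_apply P u j t = u j t"
        using P h unfolding is_projection_in_def u_def by blast
      then show ?thesis by (rule eventually_mono) simp
    qed
    then show ?thesis unfolding tuple_inner_def L2_inner_def
      by (intro sum.cong refl integral_cong_AE) measurable
  qed
  finally have eq: "tuple_inner \<mu> u u = tuple_inner \<mu> h u" .
  have int: "integrable \<mu> (\<lambda>t. (cmod (h j t))\<^sup>2)" "integrable \<mu> (\<lambda>t. (cmod (u j t))\<^sup>2)"
      "integrable \<mu> (\<lambda>t. h j t * cnj (u j t))" for j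
    using h u L2_mult_integrable[of "h j" \<mu> "u j"] by (auto simp: L2_tuples_def L2_def)
  have "tuple_inner \<mu> u u = of_real ((tuple_norm \<mu> u)\<^sup>2)"
    by (simp add: tuple_inner_def L2_inner_def tuple_norm_sq complex_norm_square[symmetric]
        integral_complex_of_real[symmetric] del: integral_complex_of_real)
  then have "(tuple_norm \<mu> u)\<^sup>2 = cmod (tuple_inner \<mu> h u)"
    using eq by (metis norm_of_real abs_of_nonneg zero_le_power2)
  also have "\<dots> \<le> (\<Sum>j\<in>UNIV. LINT t|\<mu>. ((cmod (h j t))\<^sup>2 + (cmod (u j t))\<^sup>2) / 2)"
    unfolding tuple_inner_def L2_inner_def
  proof (intro sum_norm_le)
    fix j
    have "cmod (LINT t|\<mu>. h j t * cnj (u j t)) \<le> (LINT t|\<mu>. cmod (h j t * cnj (u j t)))"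
      by (rule integral_norm_bound)
    also have "\<dots> \<le> (LINT t|\<mu>. ((cmod (h j t))\<^sup>2 + (cmod (u j t))\<^sup>2) / 2)"
    proof (intro integral_mono)
      show "integrable \<mu> (\<lambda>t. cmod (h j t * cnj (u j t)))" using int(3) by (rule integrable_norm)
      show "integrable \<mu> (\<lambda>t. ((cmod (h j t))\<^sup>2 + (cmod (u j t))\<^sup>2) / 2)" using int[of j] by simp
      show "cmod (h j t * cnj (u j t)) \<le> ((cmod (h j t))\<^sup>2 + (cmod (u j t))\<^sup>2) / 2" for t
        using sum_squares_bound[of "cmod (h j t)" "cmod (u j t)"] by (simp add: norm_mult)
    qed
    finally show "cmod (LINT t|\<mu>. h j t * cnj (u j t))
        \<le> (LINT t|\<mu>. ((cmod (h j t))\<^sup>2 + (cmod (u j t))\<^sup>2) / 2)" .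
  qed
  also have "\<dots> = ((tuple_norm \<mu> h)\<^sup>2 + (tuple_norm \<mu> u)\<^sup>2) / 2"
    using int by (simp add: tuple_norm_sq sum.distrib sum_divide_distrib[symmetric])
  finally have "(tuple_norm \<mu> u)\<^sup>2 \<le> (tuple_norm \<mu> h)\<^sup>2" by simp
  then show ?thesis unfolding u_def
    by (rule power2_le_imp_le) (simp add: tuple_norm_def sum_nonneg)
qed

lemma module_norm_le_one:
  fixes g :: "'n::finite \<Rightarrow> 'a \<Rightarrow> complex"
  assumes P: "is_projection_in \<mu> (tf_algebra \<mu> p L) (alg_gram \<mu> p L g g)"
  shows "module_norm \<mu> p L g \<le> 1"
proof -
  have "mat_opnorm \<mu> (alg_gram \<mu> p L g g) \<le> 1"
    unfolding mat_opnorm_def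
  proof (rule cSUP_least)
    have "(\<lambda>j t. 0) \<in> {h \<in> L2_tuples \<mu>. tuple_norm \<mu> h \<le> 1}"
      by (simp add: L2_tuples_def tuple_norm_def L2_norm_def)
    then show "{h \<in> L2_tuples \<mu>. tuple_norm \<mu> h \<le> 1} \<noteq> {}" by blast
  qed (use tuple_norm_le_one[OF P] in force)
  then show ?thesis unfolding module_norm_def by simp
qed

lemma (in contractions) module_norm_zero:
  fixes g :: "'n::finite \<Rightarrow> 'a \<Rightarrow> complex"
  assumes g: "\<And>j k z. z \<in> L \<Longrightarrow> L2_inner \<mu> (g j) (p z (g k)) = 0"
  shows "module_norm \<mu> p L g = 0"
proof -
  have s: "(\<lambda>z. cmod (L2_inner \<mu> (g j) (p z (g k)))) summable_on L" for j k
    using g by (subst summable_on_cong[of _ _ "\<lambda>_. 0"]) auto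
  have z: "tuple_norm \<mu> (mat_apply (alg_gram \<mu> p L g g) h) = 0" if h: "h \<in> L2_tuples \<mu>" for h
  proof -
    have "AE t in \<mu>. mat_apply (alg_gram \<mu> p L g g) h j t = 0" for j
    proof -
      have "AE t in \<mu>. \<forall>k\<in>UNIV. alg_gram \<mu> p L g g j k (h k) t = 0"
      proof (intro AE_finite_allI finite)
        fix k
        have "AE t in \<mu>. alg_inner \<mu> p L (g j) (g k) (h k) t
            = (\<Sum>\<^sub>\<infinity>z\<in>L. L2_inner \<mu> (g j) (p z (g k)) * p z (h k) t)"
          using h by (intro alg_inner_op_series(2)[OF s]) (auto simp: L2_tuples_def)
        then show "AE t in \<mu>. alg_gram \<mu> p L g g j k (h k) t = 0"
          by eventually_elim (auto simp: alg_gram_def g intro!: infsum_0)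
      qed
      then show ?thesis by eventually_elim (simp add: mat_apply_def)
    qed
    moreover have "mat_apply (alg_gram \<mu> p L g g) h \<in> L2_tuples \<mu>"
      by (rule mat_apply_L2[OF _ h]) (auto simp: alg_gram_def intro!: alg_inner_op_series(1) s)
    ultimately have "(LINT t|\<mu>. (cmod (mat_apply (alg_gram \<mu> p L g g) h j t))\<^sup>2) = (LINT t|\<mu>. 0)" for j
      by (intro integral_cong_AE) (auto simp: L2_tuples_def L2_def)
    then show ?thesis by (simp add: tuple_norm_def L2_norm_sq)
  qed
  have "(\<lambda>j t. 0) \<in> {h \<in> L2_tuples \<mu>. tuple_norm \<mu> h \<le> 1}"
    by (simp add: L2_tuples_def tuple_norm_def L2_norm_def)
  then have "(\<lambda>h. tuple_norm \<mu> (mat_apply (alg_gram \<mu> p L g g) h)) ` {h \<in> L2_tuples \<mu>. tuple_norm \<mu> h \<le> 1} = {0}"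
    using z by (auto simp: image_iff intro!: exI[of _ "\<lambda>j t. 0"])
  then show ?thesis unfolding module_norm_def mat_opnorm_def by simp
qed

section \<open>Fourier inversion\<close>

lemma measurable_cis [measurable]: "cis \<in> borel_measurable borel"
  by (intro borel_measurable_continuous_onI continuous_on_cis continuous_intros)

definition fourier :: "(real \<Rightarrow> complex) \<Rightarrow> real \<Rightarrow> complex" where
  "fourier h \<omega> = (LINT s|lborel. h s * cis (- (2 * pi * \<omega> * s)))"

text \<open>
  A rescaled form of the characteristic function of the standard normal distribution.
\<close>

lemma gaussian_integral:
  assumes "\<epsilon> > 0"
  shows "integrable lborel (\<lambda>\<omega>. cis (2 * pi * \<omega> * u) * of_real (exp (- (2 * pi * \<epsilon> * \<omega>)\<^sup>2 / 2)))"
    and "(LINT \<omega>|lborel. cis (2 * pi * \<omega> * u) * of_real (exp (- (2 * pi * \<epsilon> * \<omega>)\<^sup>2 / 2)))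
          = of_real (std_normal_density (u / \<epsilon>) / \<epsilon>)"
proof -
  define c where "c = 2 * pi * \<epsilon>"
  have c: "c > 0" using assms by (simp add: c_def)
  define F where "F x = cis (x * (u / \<epsilon>)) * of_real (exp (- x\<^sup>2 / 2))" for x
  have Fd: "F x = sqrt (2 * pi) * (std_normal_density x *\<^sub>R iexp ((u / \<epsilon>) * x))" for x
    by (simp add: F_def std_normal_density_def cis_conv_exp scaleR_conv_of_real mult_ac)
  have I: "integrable lborel (\<lambda>x. std_normal_density x *\<^sub>R iexp ((u / \<epsilon>) * x))"
  proof (rule Bochner_Integration.integrable_bound)
    show "integrable lborel (\<lambda>x. std_normal_density x)" by simp
  qed (auto simp: std_normal_density_def)
  then have intF: "integrable lborel F" unfolding Fd by (rule integrable_mult_right)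
  have "char std_normal_distribution (u / \<epsilon>) = (LINT x|lborel. std_normal_density x *\<^sub>R iexp ((u / \<epsilon>) * x))"
    unfolding char_def by (subst integral_density) auto
  then have FI: "(LINT x|lborel. F x) = sqrt (2 * pi) * complex_of_real (exp (- (u / \<epsilon>)\<^sup>2 / 2))"
    unfolding Fd integral_mult_right_zero by (simp add: char_std_normal_distribution)
  have eq: "cis (2 * pi * \<omega> * u) * of_real (exp (- (2 * pi * \<epsilon> * \<omega>)\<^sup>2 / 2)) = F (0 + c * \<omega>)" for \<omega>
    using assms by (simp add: F_def c_def mult_ac)
  show "integrable lborel (\<lambda>\<omega>. cis (2 * pi * \<omega> * u) * of_real (exp (- (2 * pi * \<epsilon> * \<omega>)\<^sup>2 / 2)))"
    unfolding eq using c intF by (subst lborel_integrable_real_affine_iff) auto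
  have "(LINT x|lborel. F x) = c *\<^sub>R (LINT \<omega>|lborel. F (0 + c * \<omega>))"
    using lborel_integral_real_affine[of c F 0] c by simp
  then have "(LINT \<omega>|lborel. F (0 + c * \<omega>)) = (sqrt (2 * pi) / c) * exp (- (u / \<epsilon>)\<^sup>2 / 2)"
    using c unfolding FI by (simp add: scaleR_conv_of_real field_simps)
  also have "sqrt (2 * pi) / c = 1 / (sqrt (2 * pi) * \<epsilon>)"
  proof -
    have "sqrt (2 * pi) * sqrt (2 * pi) = 2 * pi" by simp
    then show ?thesis using assms unfolding c_def
      by (metis (no_types, opaque_lifting) div_by_1 divide_divide_eq_left' mult.assoc nonzero_divide_mult_cancel_left pi_gt_zero less_irrefl mult_eq_0_iff real_sqrt_eq_zero_cancel_iff zero_neq_numeral)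
  qed
  finally show "(LINT \<omega>|lborel. cis (2 * pi * \<omega> * u) * of_real (exp (- (2 * pi * \<epsilon> * \<omega>)\<^sup>2 / 2)))
          = of_real (std_normal_density (u / \<epsilon>) / \<epsilon>)"
    unfolding eq by (simp add: std_normal_density_def field_simps)
qed

lemma std_normal_density_le: "u \<noteq> 0 \<Longrightarrow> std_normal_density u \<le> 2 / u\<^sup>2"
proof -
  assume u: "u \<noteq> 0"
  have "std_normal_density u \<le> exp (- u\<^sup>2 / 2)"
  proof -
    have "1 \<le> sqrt (2 * pi)" using pi_ge_two by (simp)
    then show ?thesis unfolding std_normal_density_def by (simp add: field_simps)
  qed
  also have "\<dots> = 1 / exp (u\<^sup>2 / 2)" by (simp add: exp_minus field_simps)
  also have "\<dots> \<le> 1 / (u\<^sup>2 / 2)"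
    using exp_ge_add_one_self[of "u\<^sup>2 / 2"] u
    by (intro divide_left_mono) (auto intro!: mult_pos_pos simp del: exp_ge_add_one_self, linarith?)
  finally show ?thesis by simp
qed

text \<open>
  The function \<open>h\<close> need not be bounded, so it is cut at distance 1 from \<open>t\<close>.  Away from \<open>t\<close>
  the Gaussian is at most \<open>2 \<epsilon>\<close>; near \<open>t\<close>, where \<open>h\<close> is bounded, dominated convergence applies.
\<close>

lemma gaussian_approximate_identity:
  fixes h :: "real \<Rightarrow> complex"
  assumes h: "integrable lborel h" and cont: "continuous_on UNIV h"
  defines "\<epsilon> \<equiv> \<lambda>n. 1 / real (Suc n)"
  shows "(\<lambda>n. LINT s|lborel. h s * of_real (std_normal_density ((t - s) / \<epsilon> n) / \<epsilon> n)) \<longlonglongrightarrow> h t"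
proof -
  have \<epsilon>0: "\<epsilon> n > 0" for n by (simp add: \<epsilon>_def)
  have \<epsilon>_lim: "\<epsilon> \<longlonglongrightarrow> 0" unfolding \<epsilon>_def using LIMSEQ_Suc[OF lim_1_over_n] by simp
  have [measurable]: "h \<in> borel_measurable borel" using h by auto
  define K where "K n s = std_normal_density ((t - s) / \<epsilon> n) / \<epsilon> n" for n s
  define h1 where "h1 s = (if \<bar>t - s\<bar> < 1 then h s else 0)" for s
  define h2 where "h2 s = (if \<bar>t - s\<bar> < 1 then 0 else h s)" for s
  have m [measurable]: "h1 \<in> borel_measurable borel" "h2 \<in> borel_measurable borel"
    unfolding h1_def h2_def by measurable
  have i1: "integrable lborel h1" and i2: "integrable lborel h2"
    by (rule Bochner_Integration.integrable_bound[OF h]; force simp: h1_def h2_def)+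
  have K0: "0 \<le> K n s" for n s using \<epsilon>0 by (auto simp: K_def std_normal_density_def intro!: divide_nonneg_pos)
  have Kb: "K n s \<le> 1 / \<epsilon> n" for n s
  proof -
    have "std_normal_density x \<le> 1" for x
    proof -
      have "1 \<le> sqrt (2 * pi)" using pi_ge_two by simp
      then have "exp (- x\<^sup>2 / 2) \<le> sqrt (2 * pi)" by (rule order_trans[rotated]) simp
      then show ?thesis unfolding std_normal_density_def by (simp add: field_simps)
    qed
    then show ?thesis unfolding K_def using \<epsilon>0[of n] by (intro divide_right_mono) auto
  qed
  have int: "integrable lborel (\<lambda>s. q s * of_real (K n s))" if "integrable lborel q" for q :: "real \<Rightarrow> complex" and n
  proof (rule Bochner_Integration.integrable_bound)
    show "integrable lborel (\<lambda>s. q s * of_real (1 / \<epsilon> n))" using that by simp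
    have "(\<lambda>s. K n s) \<in> borel_measurable borel" unfolding K_def by measurable
    then show "(\<lambda>s. q s * of_real (K n s)) \<in> borel_measurable lborel"
      using that by measurable
    show "AE s in lborel. norm (q s * of_real (K n s)) \<le> norm (q s * of_real (1 / \<epsilon> n))"
    proof (rule AE_I2)
      fix s
      have "norm (q s * of_real (K n s)) = norm (q s) * K n s" using K0[of n s] by (simp add: norm_mult)
      also have "\<dots> \<le> norm (q s) * (1 / \<epsilon> n)" by (rule mult_left_mono[OF Kb]) simp
      also have "\<dots> = norm (q s * of_real (1 / \<epsilon> n))" using \<epsilon>0[of n] by (simp add: norm_divide)
      finally show "norm (q s * of_real (K n s)) \<le> norm (q s * of_real (1 / \<epsilon> n))" .
    qed
  qed
  have far: "(\<lambda>n. LINT s|lborel. h2 s * of_real (K n s)) \<longlonglongrightarrow> 0"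
  proof (rule Lim_null_comparison)
    show "\<forall>\<^sub>F n in sequentially. norm (LINT s|lborel. h2 s * of_real (K n s))
        \<le> (LINT s|lborel. norm (h s)) * (2 * \<epsilon> n)"
    proof (intro always_eventually allI)
      fix n
      have "norm (LINT s|lborel. h2 s * of_real (K n s)) \<le> (LINT s|lborel. norm (h2 s * of_real (K n s)))"
        by (rule integral_norm_bound)
      also have "\<dots> \<le> (LINT s|lborel. norm (h s) * (2 * \<epsilon> n))"
      proof (rule integral_mono)
        show "integrable lborel (\<lambda>s. norm (h2 s * of_real (K n s)))" using int[OF i2] by (rule integrable_norm)
        show "integrable lborel (\<lambda>s. norm (h s) * (2 * \<epsilon> n))" using h by simp
        fix s
        show "norm (h2 s * of_real (K n s)) \<le> norm (h s) * (2 * \<epsilon> n)"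
        proof (cases "\<bar>t - s\<bar> < 1")
          case False
          then have ge: "1 \<le> (t - s)\<^sup>2" using abs_le_square_iff[of 1 "t - s"] by simp
          have "K n s \<le> (2 / ((t - s) / \<epsilon> n)\<^sup>2) / \<epsilon> n"
            unfolding K_def using False \<epsilon>0[of n] by (intro divide_right_mono std_normal_density_le) auto
          also have "\<dots> = 2 * \<epsilon> n / (t - s)\<^sup>2" using \<epsilon>0[of n] by (simp add: power_divide power2_eq_square)
          also have "\<dots> \<le> 2 * \<epsilon> n" using ge \<epsilon>0[of n] by (simp add: divide_le_eq mult_le_cancel_left1)
          finally show ?thesis using False K0[of n s] by (simp add: h2_def norm_mult mult_left_mono)
        qed (use \<epsilon>0[of n] in \<open>auto simp: h2_def\<close>)
      qed
      finally show "norm (LINT s|lborel. h2 s * of_real (K n s)) \<le> (LINT s|lborel. norm (h s)) * (2 * \<epsilon> n)"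
        by simp
    qed
    show "(\<lambda>n. (LINT s|lborel. norm (h s)) * (2 * \<epsilon> n)) \<longlonglongrightarrow> 0"
      by (auto intro!: tendsto_eq_intros \<epsilon>_lim)
  qed
  have "bounded (h ` cball t 1)"
    by (intro compact_imp_bounded compact_continuous_image continuous_on_subset[OF cont]) auto
  then obtain B where B: "\<And>s. s \<in> cball t 1 \<Longrightarrow> norm (h s) \<le> B" 
    unfolding bounded_iff by blast
  have B': "norm (h1 s) \<le> \<bar>B\<bar>" for s
    using B[of s] by (auto simp: h1_def dist_real_def)
  have near: "(\<lambda>n. LINT s|lborel. h1 s * of_real (K n s)) \<longlonglongrightarrow> h t"
  proof -
    have sub: "(LINT s|lborel. h1 s * of_real (K n s))
        = (LINT u|lborel. h1 (t + (- \<epsilon> n) * u) * of_real (std_normal_density u))" for n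
    proof -
      have "(LINT s|lborel. h1 s * of_real (K n s))
          = \<epsilon> n *\<^sub>R (LINT u|lborel. h1 (t + (- \<epsilon> n) * u) * of_real (K n (t + (- \<epsilon> n) * u)))"
        using lborel_integral_real_affine[of "- \<epsilon> n" "\<lambda>s. h1 s * of_real (K n s)" t] \<epsilon>0[of n] by simp
      also have "\<dots> = (LINT u|lborel. h1 (t + (- \<epsilon> n) * u) * of_real (std_normal_density u))"
        using \<epsilon>0[of n] unfolding integral_scaleR_right[symmetric]
        by (intro Bochner_Integration.integral_cong refl) (simp add: K_def scaleR_conv_of_real)
      finally show ?thesis .
    qed
    have "(\<lambda>n. LINT u|lborel. h1 (t + (- \<epsilon> n) * u) * of_real (std_normal_density u))
        \<longlonglongrightarrow> (LINT u|lborel. h t * of_real (std_normal_density u))"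
    proof (rule integral_dominated_convergence)
      show "integrable lborel (\<lambda>u. \<bar>B\<bar> * std_normal_density u)" by simp
      show "AE u in lborel. (\<lambda>n. h1 (t + (- \<epsilon> n) * u) * of_real (std_normal_density u))
          \<longlonglongrightarrow> h t * of_real (std_normal_density u)"
      proof (intro AE_I2 tendsto_mult tendsto_const)
        fix u
        have l: "(\<lambda>n. t + (- \<epsilon> n) * u) \<longlonglongrightarrow> t" by (auto intro!: tendsto_eq_intros \<epsilon>_lim)
        have "(\<lambda>n. h (t + (- \<epsilon> n) * u)) \<longlonglongrightarrow> h t"
          using cont l by (rule continuous_on_tendsto_compose) auto
        moreover have "\<forall>\<^sub>F n in sequentially. h (t + (- \<epsilon> n) * u) = h1 (t + (- \<epsilon> n) * u)"
          using tendstoD[OF l zero_less_one] by (rule eventually_mono) (auto simp: h1_def dist_real_def)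
        ultimately show "(\<lambda>n. h1 (t + (- \<epsilon> n) * u)) \<longlonglongrightarrow> h t" by (rule Lim_transform_eventually)
      qed
      show "AE u in lborel. norm (h1 (t + (- \<epsilon> n) * u) * of_real (std_normal_density u)) \<le> \<bar>B\<bar> * std_normal_density u" for n
        using B' by (intro AE_I2) (simp add: norm_mult mult_right_mono normal_density_nonneg)
    qed measurable
    also have "(LINT u|lborel. h t * of_real (std_normal_density u)) = h t"
      by simp
    finally show ?thesis unfolding sub .
  qed
  have "(LINT s|lborel. h1 s * of_real (K n s)) + (LINT s|lborel. h2 s * of_real (K n s))
      = (LINT s|lborel. h s * of_real (K n s))" for n
    unfolding Bochner_Integration.integral_add[OF int[OF i1] int[OF i2], symmetric]
    by (intro Bochner_Integration.integral_cong refl) (simp add: h1_def h2_def)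
  with tendsto_add[OF near far] show ?thesis by (simp add: K_def)
qed

text \<open>
  A Gaussian factor in the inversion integral makes Fubini's theorem applicable and turns the
  integral into the mean of \<open>h\<close> against a Gaussian of width \<open>\<epsilon>\<close> around \<open>t\<close>.
\<close>

lemma Fourier_inversion:
  fixes h :: "real \<Rightarrow> complex"
  assumes h: "integrable lborel h" and cont: "continuous_on UNIV h"
    and ft: "integrable lborel (fourier h)"
  shows "h t = (LINT \<omega>|lborel. fourier h \<omega> * cis (2 * pi * \<omega> * t))"
proof -
  define \<epsilon> where "\<epsilon> n = 1 / real (Suc n)" for n
  have \<epsilon>0: "\<epsilon> n > 0" for n by (simp add: \<epsilon>_def)
  have \<epsilon>_lim: "\<epsilon> \<longlonglongrightarrow> 0" unfolding \<epsilon>_def using LIMSEQ_Suc[OF lim_1_over_n] by simp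
  have [measurable]: "h \<in> borel_measurable borel" using h by auto
  have [measurable]: "fourier h \<in> borel_measurable borel" using ft by auto
  have "(LINT s|lborel. h s * of_real (std_normal_density ((t - s) / \<epsilon> n) / \<epsilon> n))
      = (LINT \<omega>|lborel. fourier h \<omega> * cis (2 * pi * \<omega> * t) * of_real (exp (- (2 * pi * \<epsilon> n * \<omega>)\<^sup>2 / 2)))" for n
  proof -
    define E where "E \<omega> = exp (- (2 * pi * \<epsilon> n * \<omega>)\<^sup>2 / 2)" for \<omega> :: real
    have [measurable]: "E \<in> borel_measurable borel" unfolding E_def by measurable
    have E0: "\<bar>E \<omega>\<bar> = E \<omega>" for \<omega> by (simp add: E_def)
    have iE: "integrable lborel E"
      using integrable_norm[OF gaussian_integral(1)[OF \<epsilon>0[of n], of 0]] by (simp add: E_def[abs_def] norm_mult)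
    define G where "G = (\<lambda>(s, \<omega>). h s * cis (2 * pi * \<omega> * (t - s)) * of_real (E \<omega>))"
    have G: "integrable (lborel \<Otimes>\<^sub>M lborel) G"
    proof (rule Bochner_Integration.integrable_bound)
      have "integrable (lborel \<Otimes>\<^sub>M lborel) (\<lambda>(s, \<omega>). norm (h s) * E \<omega>)"
      proof (rule lborel_pair.Fubini_integrable)
        show "integrable lborel (\<lambda>s. LINT \<omega>|lborel. norm (case (s, \<omega>) of (s, \<omega>) \<Rightarrow> norm (h s) * E \<omega>))"
          using h by (simp add: abs_mult)
      qed (use iE in auto)
      then show "integrable (lborel \<Otimes>\<^sub>M lborel) (\<lambda>x. norm (h (fst x)) * E (snd x))" by (simp only: case_prod_unfold)
    qed (auto simp: G_def norm_mult E0)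
    have "(LINT s|lborel. h s * of_real (std_normal_density ((t - s) / \<epsilon> n) / \<epsilon> n))
        = (LINT s|lborel. LINT \<omega>|lborel. G (s, \<omega>))"
    proof (rule Bochner_Integration.integral_cong[OF refl])
      fix s
      show "h s * of_real (std_normal_density ((t - s) / \<epsilon> n) / \<epsilon> n) = (LINT \<omega>|lborel. G (s, \<omega>))"
        unfolding gaussian_integral(2)[OF \<epsilon>0[of n], of "t - s", symmetric]
        by (simp add: G_def E_def mult.assoc)
    qed
    also have "\<dots> = (LINT \<omega>|lborel. LINT s|lborel. G (s, \<omega>))"
      by (rule lborel_pair.Fubini_integral[symmetric]) (use G in \<open>simp add: split_beta\<close>)
    also have "\<dots> = (LINT \<omega>|lborel. fourier h \<omega> * cis (2 * pi * \<omega> * t) * of_real (E \<omega>))"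
    proof (rule Bochner_Integration.integral_cong[OF refl])
      fix \<omega>
      have "(LINT s|lborel. G (s, \<omega>)) = (LINT s|lborel. (h s * cis (- (2 * pi * \<omega> * s))) * (cis (2 * pi * \<omega> * t) * of_real (E \<omega>)))"
        by (intro Bochner_Integration.integral_cong refl)
          (simp add: G_def cis_mult algebra_simps)
      then show "(LINT s|lborel. G (s, \<omega>)) = fourier h \<omega> * cis (2 * pi * \<omega> * t) * of_real (E \<omega>)"
        unfolding integral_mult_left_zero fourier_def[symmetric] by (simp add: mult.assoc)
    qed
    finally show ?thesis unfolding E_def .
  qed
  then have "(\<lambda>n. LINT \<omega>|lborel. fourier h \<omega> * cis (2 * pi * \<omega> * t) * of_real (exp (- (2 * pi * \<epsilon> n * \<omega>)\<^sup>2 / 2)))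
      \<longlonglongrightarrow> h t"
    using gaussian_approximate_identity[OF h cont, of t] by (simp add: \<epsilon>_def)
  moreover have "(\<lambda>n. LINT \<omega>|lborel. fourier h \<omega> * cis (2 * pi * \<omega> * t) * of_real (exp (- (2 * pi * \<epsilon> n * \<omega>)\<^sup>2 / 2)))
      \<longlonglongrightarrow> (LINT \<omega>|lborel. fourier h \<omega> * cis (2 * pi * \<omega> * t))"
  proof (rule integral_dominated_convergence)
    show "integrable lborel (\<lambda>\<omega>. norm (fourier h \<omega>))" using ft by (rule integrable_norm)
    show "AE \<omega> in lborel. (\<lambda>n. fourier h \<omega> * cis (2 * pi * \<omega> * t) * of_real (exp (- (2 * pi * \<epsilon> n * \<omega>)\<^sup>2 / 2)))
        \<longlonglongrightarrow> fourier h \<omega> * cis (2 * pi * \<omega> * t)"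
      by (rule AE_I2) (auto intro!: tendsto_eq_intros \<epsilon>_lim)
    show "AE \<omega> in lborel. norm (fourier h \<omega> * cis (2 * pi * \<omega> * t) * of_real (exp (- (2 * pi * \<epsilon> n * \<omega>)\<^sup>2 / 2)))
        \<le> norm (fourier h \<omega>)" for n
      by (rule AE_I2) (simp add: norm_mult mult_left_le)
  qed measurable
  ultimately show ?thesis by (rule LIMSEQ_unique)
qed

section \<open>Atoms and lattice sums\<close>

lemma tf_shift_eq: "tf_shift (x, \<omega>) f t = cis (2 * pi * \<omega> * t) * f (t - x)"
  by (simp add: tf_shift_def cis_conv_exp mult_ac)

lemma tf_shift_eq': "tf_shift z f t = cis (2 * pi * snd z * t) * f (t - fst z)"
  by (cases z) (simp add: tf_shift_eq)

lemma integrable_indicator_Icc: "integrable lborel (indicator {a..b::real} :: real \<Rightarrow> real)"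
  by (rule integrable_real_indicator) (auto simp: emeasure_lborel_Icc_eq)

text \<open>
  The square makes a bump vanish to second order at both ends of its support.  A product of two
  shifted bumps can therefore be integrated by parts twice without boundary terms.
\<close>

definition bump :: "real \<Rightarrow> real \<Rightarrow> real \<Rightarrow> complex" where
  "bump \<alpha> \<beta> t = (if \<alpha> \<le> t \<and> t \<le> \<beta> then of_real (((t - \<alpha>) * (\<beta> - t))\<^sup>2) else 0)"

lemma measurable_bump [measurable]: "bump \<alpha> \<beta> \<in> borel_measurable borel"
  unfolding bump_def[abs_def] by measurable

lemma norm_bump_le: "cmod (bump \<alpha> \<beta> t) \<le> ((\<beta> - \<alpha>) * (\<beta> - \<alpha>))\<^sup>2"
proof (cases "\<alpha> \<le> t \<and> t \<le> \<beta>")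
  case True
  then have "((t - \<alpha>) * (\<beta> - t))\<^sup>2 \<le> ((\<beta> - \<alpha>) * (\<beta> - \<alpha>))\<^sup>2"
    by (intro power_mono mult_mono mult_nonneg_nonneg) auto
  then show ?thesis unfolding bump_def if_P[OF True] norm_of_real by simp
qed (auto simp: bump_def)

lemma bump_zero: "t \<notin> {\<alpha>..\<beta>} \<Longrightarrow> bump \<alpha> \<beta> t = 0"
  by (auto simp: bump_def)

lemma integrable_bump: "integrable lborel (bump \<alpha> \<beta>)"
proof (rule Bochner_Integration.integrable_bound)
  show "integrable lborel (\<lambda>t. indicator {\<alpha>..\<beta>} t *\<^sub>R ((\<beta> - \<alpha>) * (\<beta> - \<alpha>))\<^sup>2)"
    by (intro integrable_scaleR_left integrable_indicator_Icc)
  show "AE t in lborel. cmod (bump \<alpha> \<beta> t) \<le> norm (indicator {\<alpha>..\<beta>} t *\<^sub>R ((\<beta> - \<alpha>) * (\<beta> - \<alpha>))\<^sup>2)"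
  proof (rule AE_I2)
    show "cmod (bump \<alpha> \<beta> t) \<le> norm (indicator {\<alpha>..\<beta>} t *\<^sub>R ((\<beta> - \<alpha>) * (\<beta> - \<alpha>))\<^sup>2)" for t
      using norm_bump_le[of \<alpha> \<beta> t] by (cases "t \<in> {\<alpha>..\<beta>}") (simp_all add: bump_zero)
  qed
qed measurable

lemma L2_translate:
  fixes f :: "real \<Rightarrow> complex"
  shows "f \<in> L2 lborel \<Longrightarrow> (\<lambda>t. f (t - x)) \<in> L2 lborel"
  unfolding L2_def using lborel_integrable_real_affine[of "\<lambda>t. (cmod (f t))\<^sup>2" 1 "- x"]
  by (auto simp: algebra_simps)

lemma L2_inner_tf_shift_eq_fourier:
  "L2_inner lborel f (tf_shift (x, \<omega>) g) = fourier (\<lambda>s. f s * cnj (g (s - x))) \<omega>"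
  unfolding L2_inner_def fourier_def by (simp add: tf_shift_eq cis_cnj mult_ac)

text \<open>
  For almost every \<open>x\<close> the function \<open>V(x, \<cdot>)\<close> is integrable.  It is the Fourier transform
  of \<open>s \<mapsto> f s cnj (f (s - x))\<close>, whose value at \<open>t\<close> is recovered by Fourier inversion; multiply by
  \<open>\<gamma>(t - x)\<close> and integrate over \<open>x\<close>.
\<close>

lemma S0_inversion:
  assumes f: "f \<in> S0" and \<gamma> [measurable]: "\<gamma> \<in> borel_measurable borel" and M: "\<And>t. cmod (\<gamma> t) \<le> M"
  defines "V \<equiv> \<lambda>z. L2_inner lborel f (tf_shift z f)"
  shows "f t * (LINT u|lborel. \<gamma> u * cnj (f u))
          = (LINT z|(lborel \<Otimes>\<^sub>M lborel). V z * tf_shift z \<gamma> t)"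
proof -
  have L2: "f \<in> L2 lborel" and cont: "continuous_on UNIV f"
    and V: "integrable (lborel \<Otimes>\<^sub>M lborel) V"
    using f by (auto simp: S0_def V_def)
  have [measurable]: "f \<in> borel_measurable borel" using L2 by (simp add: L2_def)
  have Vm [measurable]: "V \<in> borel_measurable (borel \<Otimes>\<^sub>M borel)"
    using borel_measurable_integrable[OF V] by (simp cong: measurable_cong_sets)
  have M0: "M \<ge> 0" using M[of 0] norm_ge_zero order_trans by blast
  have int: "integrable (lborel \<Otimes>\<^sub>M lborel) (\<lambda>z. V z * tf_shift z \<gamma> t)"
  proof (rule Bochner_Integration.integrable_bound)
    show "integrable (lborel \<Otimes>\<^sub>M lborel) (\<lambda>z. V z * of_real M)" using V by simp
    have "(\<lambda>z. V z * (cis (2 * pi * snd z * t) * \<gamma> (t - fst z))) \<in> borel_measurable (lborel \<Otimes>\<^sub>M lborel)"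
      by measurable
    then show "(\<lambda>z. V z * tf_shift z \<gamma> t) \<in> borel_measurable (lborel \<Otimes>\<^sub>M lborel)"
      by (simp add: tf_shift_eq')
    show "AE z in (lborel \<Otimes>\<^sub>M lborel). cmod (V z * tf_shift z \<gamma> t) \<le> cmod (V z * of_real M)"
      using M M0 by (intro AE_I2) (auto simp: norm_mult tf_shift_eq intro!: mult_left_mono)
  qed
  have "(LINT z|(lborel \<Otimes>\<^sub>M lborel). V z * tf_shift z \<gamma> t)
      = (LINT x|lborel. LINT \<omega>|lborel. V (x, \<omega>) * tf_shift (x, \<omega>) \<gamma> t)"
    by (rule lborel_pair.integral_fst'[OF int, symmetric])
  also have "\<dots> = (LINT x|lborel. f t * (\<gamma> (t - x) * cnj (f (t - x))))"
  proof (rule integral_cong_AE)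
    show "(\<lambda>x. LINT \<omega>|lborel. V (x, \<omega>) * tf_shift (x, \<omega>) \<gamma> t) \<in> borel_measurable lborel"
      using lborel_pair.integrable_fst'[OF int] by auto
    show "AE x in lborel. (LINT \<omega>|lborel. V (x, \<omega>) * tf_shift (x, \<omega>) \<gamma> t) = f t * (\<gamma> (t - x) * cnj (f (t - x)))"
      using lborel_pair.AE_integrable_fst'[OF V]
    proof eventually_elim
      case (elim x)
      define h where "h s = f s * cnj (f (s - x))" for s
      have Vh: "V (x, \<omega>) = fourier h \<omega>" for \<omega>
        by (simp add: V_def L2_inner_tf_shift_eq_fourier h_def[abs_def])
      have "h t = (LINT \<omega>|lborel. fourier h \<omega> * cis (2 * pi * \<omega> * t))"
      proof (rule Fourier_inversion)
        show "integrable lborel h"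
          unfolding h_def by (rule L2_mult_integrable[OF L2 L2_translate[OF L2]])
        show "continuous_on UNIV h"
          unfolding h_def by (intro continuous_intros continuous_on_compose2[OF cont] cont) auto
        show "integrable lborel (fourier h)" using elim by (simp add: Vh)
      qed
      then have "h t * \<gamma> (t - x) = (LINT \<omega>|lborel. V (x, \<omega>) * tf_shift (x, \<omega>) \<gamma> t)"
        unfolding tf_shift_eq Vh mult.assoc[symmetric] integral_mult_left_zero by simp
      then show ?case by (simp add: h_def mult_ac)
    qed
  qed measurable
  also have "\<dots> = f t * (LINT x|lborel. \<gamma> (t + (-1) * x) * cnj (f (t + (-1) * x)))"
    by simp
  also have "(LINT x|lborel. \<gamma> (t + (-1) * x) * cnj (f (t + (-1) * x))) = (LINT u|lborel. \<gamma> u * cnj (f u))"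
    using lborel_integral_real_affine[of "-1" "\<lambda>u. \<gamma> u * cnj (f u)" t] by simp
  finally show ?thesis by simp
qed

text \<open>
  On a small interval around \<open>t0\<close> the real part of \<open>cnj (f u) f t0\<close> is positive.
\<close>

lemma S0_bump_nonzero:
  assumes cont: "continuous_on UNIV f" and "f t0 \<noteq> 0"
  obtains \<alpha> \<beta> where "\<alpha> < \<beta>" "(LINT u|lborel. bump \<alpha> \<beta> u * cnj (f u)) \<noteq> 0"
proof -
  define q where "q u = Re (cnj (f u) * f t0)" for u
  have cq: "continuous_on UNIV q" unfolding q_def by (intro continuous_intros cont)
  have [measurable]: "f \<in> borel_measurable borel" using cont by (rule borel_measurable_continuous_onI)
  have [measurable]: "q \<in> borel_measurable borel" using cq by (rule borel_measurable_continuous_onI)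
  have "q t0 = (cmod (f t0))\<^sup>2"
    unfolding q_def using complex_norm_square[of "f t0"] by (metis Re_complex_of_real mult.commute)
  then have "q t0 > 0" using assms(2) by simp
  moreover have "isCont q t0" using cq by (simp add: continuous_on_eq_continuous_at)
  ultimately have "\<forall>\<^sub>F u in at t0. q u > 0"
    unfolding isCont_def by (rule order_tendstoD(1)[rotated])
  then obtain \<delta> where \<delta>: "\<delta> > 0" "\<And>u. u \<noteq> t0 \<Longrightarrow> dist u t0 < \<delta> \<Longrightarrow> q u > 0"
    unfolding eventually_at by auto
  then have \<delta>': "q u > 0" if "\<bar>u - t0\<bar> < \<delta>" for u
    using that \<open>q t0 > 0\<close> by (cases "u = t0") (auto simp: dist_real_def)
  define \<alpha> \<beta> where "\<alpha> = t0 - \<delta> / 2" and "\<beta> = t0 + \<delta> / 2"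
  have in_\<delta>: "q u > 0" if "u \<in> {\<alpha>..\<beta>}" for u
    using that \<delta>(1) by (intro \<delta>') (auto simp: \<alpha>_def \<beta>_def abs_if)
  have ab: "\<alpha> < \<beta>" using \<delta> by (simp add: \<alpha>_def \<beta>_def)
  have "bounded (f ` {\<alpha>..\<beta>})"
    by (intro compact_imp_bounded compact_continuous_image continuous_on_subset[OF cont]) auto
  then obtain B where B: "\<And>s. s \<in> {\<alpha>..\<beta>} \<Longrightarrow> norm (f s) \<le> B" unfolding bounded_iff by blast
  have int: "integrable lborel (\<lambda>u. bump \<alpha> \<beta> u * cnj (f u))"
  proof (rule Bochner_Integration.integrable_bound)
    show "integrable lborel (\<lambda>u. bump \<alpha> \<beta> u * of_real B)" using integrable_bump by simp
    show "AE u in lborel. cmod (bump \<alpha> \<beta> u * cnj (f u)) \<le> cmod (bump \<alpha> \<beta> u * of_real B)"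
    proof (rule AE_I2)
      show "cmod (bump \<alpha> \<beta> u * cnj (f u)) \<le> cmod (bump \<alpha> \<beta> u * of_real B)" for u
        using B[of u] by (cases "u \<in> {\<alpha>..\<beta>}") (auto simp: norm_mult bump_def intro!: mult_left_mono)
    qed
  qed measurable
  have "(LINT u|lborel. bump \<alpha> \<beta> u * cnj (f u)) \<noteq> 0"
  proof
    assume "(LINT u|lborel. bump \<alpha> \<beta> u * cnj (f u)) = 0"
    then have "(LINT u|lborel. bump \<alpha> \<beta> u * cnj (f u) * f t0) = 0" by simp
    then have "Re (LINT u|lborel. bump \<alpha> \<beta> u * cnj (f u) * f t0) = 0" by (simp only: zero_complex.sel)
    moreover have "Re (bump \<alpha> \<beta> u * cnj (f u) * f t0) = Re (bump \<alpha> \<beta> u) * q u" for u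
      by (auto simp: q_def bump_def algebra_simps)
    ultimately have I0: "(LINT u|lborel. Re (bump \<alpha> \<beta> u) * q u) = 0"
      using int by (subst (asm) integral_Re[symmetric]) auto
    have iR: "integrable lborel (\<lambda>u. Re (bump \<alpha> \<beta> u * cnj (f u) * f t0))"
      using int by (intro integrable_Re integrable_mult_left)
    then have iR': "integrable lborel (\<lambda>u. Re (bump \<alpha> \<beta> u) * q u)"
      by (rule Bochner_Integration.integrable_cong[THEN iffD1, rotated 2])
        (auto simp: q_def bump_def algebra_simps)
    have "AE u in lborel. Re (bump \<alpha> \<beta> u) * q u = 0"
    proof (subst integral_nonneg_eq_0_iff_AE[symmetric, OF iR'])
      show "AE u in lborel. 0 \<le> Re (bump \<alpha> \<beta> u) * q u"
      proof (rule AE_I2)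
        show "0 \<le> Re (bump \<alpha> \<beta> u) * q u" for u
          using in_\<delta>[of u] by (cases "u \<in> {\<alpha>..\<beta>}") (auto simp: bump_def)
      qed
    qed (rule I0)
    then have "AE u in lborel. u \<notin> {\<alpha><..<\<beta>}"
    proof (rule eventually_mono)
      fix u assume *: "Re (bump \<alpha> \<beta> u) * q u = 0"
      show "u \<notin> {\<alpha><..<\<beta>}"
      proof
        assume u: "u \<in> {\<alpha><..<\<beta>}"
        then have "Re (bump \<alpha> \<beta> u) > 0" by (auto simp: bump_def)
        moreover have "q u > 0" using u by (intro in_\<delta>) auto
        ultimately show False using * by simp
      qed
    qed
    then have "emeasure lborel {\<alpha><..<\<beta>} = 0"
      by (subst (asm) AE_iff_measurable[of "{\<alpha><..<\<beta>}"]) auto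
    then show False using ab by simp
  qed
  with ab show ?thesis by (rule that)
qed

definition atomic :: "(real \<Rightarrow> complex) \<Rightarrow> bool" where
  "atomic f \<longleftrightarrow> (\<exists>V \<alpha> \<beta>. integrable (lborel \<Otimes>\<^sub>M lborel) V \<and> \<alpha> < \<beta> \<and>
     (\<forall>t. f t = (LINT z|(lborel \<Otimes>\<^sub>M lborel). V z * tf_shift z (bump \<alpha> \<beta>) t)))"

lemma S0_atomic: assumes f: "f \<in> S0" shows "atomic f"
proof (cases "\<exists>t0. f t0 \<noteq> 0")
  case False
  then show ?thesis unfolding atomic_def by (intro exI[of _ "\<lambda>_. 0"] exI[of _ 0] exI[of _ 1]) auto
next
  case True
  then obtain t0 where "f t0 \<noteq> 0" by auto
  moreover have "continuous_on UNIV f" using f by (simp add: S0_def)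
  ultimately obtain \<alpha> \<beta> where ab: "\<alpha> < \<beta>" "(LINT u|lborel. bump \<alpha> \<beta> u * cnj (f u)) \<noteq> 0"
    using S0_bump_nonzero by blast
  define k where "k = (LINT u|lborel. bump \<alpha> \<beta> u * cnj (f u))"
  define V where "V z = inverse k * L2_inner lborel f (tf_shift z f)" for z
  have "integrable (lborel \<Otimes>\<^sub>M lborel) V"
    unfolding V_def using f by (intro integrable_mult_right) (simp add: S0_def)
  moreover have "f t = (LINT z|(lborel \<Otimes>\<^sub>M lborel). V z * tf_shift z (bump \<alpha> \<beta>) t)" for t
  proof -
    have "(LINT z|(lborel \<Otimes>\<^sub>M lborel). V z * tf_shift z (bump \<alpha> \<beta>) t)
        = inverse k * (LINT z|(lborel \<Otimes>\<^sub>M lborel). L2_inner lborel f (tf_shift z f) * tf_shift z (bump \<alpha> \<beta>) t)"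
      unfolding V_def mult.assoc integral_mult_right_zero ..
    also have "\<dots> = inverse k * (f t * k)"
      unfolding k_def using S0_inversion[OF f measurable_bump norm_bump_le, of t \<alpha> \<beta>] by simp
    finally show ?thesis using ab by (simp add: k_def)
  qed
  ultimately show ?thesis unfolding atomic_def using ab(1) by blast
qed

lemma card_int_interval:
  fixes p q :: real
  assumes "finite F" "p \<le> q" "\<And>k. k \<in> F \<Longrightarrow> p \<le> real_of_int k \<and> real_of_int k \<le> q"
  shows "real (card F) \<le> q - p + 1"
proof -
  have "F \<subseteq> {\<lceil>p\<rceil>..\<lfloor>q\<rfloor>}" using assms by (auto simp: ceiling_le_iff le_floor_iff)
  then have "card F \<le> card {\<lceil>p\<rceil>..\<lfloor>q\<rfloor>}" by (rule card_mono[rotated]) simp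
  moreover have "real (card {\<lceil>p\<rceil>..\<lfloor>q\<rfloor>}) \<le> q - p + 1"
  proof (cases "\<lceil>p\<rceil> \<le> \<lfloor>q\<rfloor> + 1")
    case True
    then have "real (card {\<lceil>p\<rceil>..\<lfloor>q\<rfloor>}) = real_of_int (\<lfloor>q\<rfloor> + 1 - \<lceil>p\<rceil>)" by simp
    also have "\<dots> \<le> q - p + 1" by simp linarith
    finally show ?thesis .
  qed (use assms(2) in auto)
  ultimately show ?thesis by linarith
qed

definition window :: "(real \<Rightarrow> real) \<Rightarrow> real \<Rightarrow> real \<Rightarrow> real" where
  "window \<Phi> r t = (LINT x|lborel. indicator {t - r..t + r} x * \<Phi> x)"

lemma window_integrable:
  fixes \<Phi> :: "real \<Rightarrow> real" shows
  "integrable lborel \<Phi> \<Longrightarrow> integrable lborel (\<lambda>x. indicator {s..t} x * \<Phi> x)"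
  using integrable_mult_indicator[of "{s..t}" lborel \<Phi>] by simp

text \<open>
  Every \<open>x\<close> lies in at most \<open>2 r / c + 1\<close> of the intervals of radius \<open>r\<close> around the points
  \<open>t + c k\<close>.
\<close>

lemma window_sum_le:
  assumes \<Phi>: "integrable lborel \<Phi>" "\<And>x. 0 \<le> \<Phi> x" and r: "0 \<le> r" and c: "0 < c" and F: "finite F"
  shows "(\<Sum>k\<in>F. window \<Phi> r (t + c * real_of_int k)) \<le> (2 * r / c + 1) * (LINT x|lborel. \<Phi> x)"
proof -
  have "(\<Sum>k\<in>F. window \<Phi> r (t + c * real_of_int k))
      = (LINT x|lborel. (\<Sum>k\<in>F. indicator {t + c * real_of_int k - r..t + c * real_of_int k + r} x * \<Phi> x))"
    unfolding window_def by (rule Bochner_Integration.integral_sum[symmetric]) (rule window_integrable[OF \<Phi>(1)])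
  also have "\<dots> \<le> (LINT x|lborel. (2 * r / c + 1) * \<Phi> x)"
  proof (rule integral_mono)
    fix x
    define F' where "F' = {k \<in> F. x \<in> {t + c * real_of_int k - r..t + c * real_of_int k + r}}"
    have "real (card F') \<le> (x - t + r) / c - (x - t - r) / c + 1"
      by (rule card_int_interval) (use F r c in \<open>auto simp: F'_def field_simps\<close>)
    also have "\<dots> = 2 * r / c + 1" using c by (simp add: field_simps)
    finally have "real (card F') * \<Phi> x \<le> (2 * r / c + 1) * \<Phi> x" by (rule mult_right_mono) (rule \<Phi>)
    moreover have "(\<Sum>k\<in>F. indicator {t + c * real_of_int k - r..t + c * real_of_int k + r} x * \<Phi> x) = real (card F') * \<Phi> x"
      unfolding F'_def using F by (simp add: sum_distrib_right[symmetric] indicator_def sum.If_cases Int_def)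
    ultimately show "(\<Sum>k\<in>F. indicator {t + c * real_of_int k - r..t + c * real_of_int k + r} x * \<Phi> x)
        \<le> (2 * r / c + 1) * \<Phi> x" by simp
  qed (use \<Phi> in \<open>auto intro!: window_integrable Bochner_Integration.integrable_sum\<close>)
  finally show ?thesis using \<Phi> by simp
qed

lemma window_mono:
  assumes \<Phi>: "integrable lborel \<Phi>" "\<And>x. 0 \<le> \<Phi> x" and "\<bar>s - t\<bar> \<le> R"
  shows "window \<Phi> r s \<le> window \<Phi> (r + R) t"
  unfolding window_def
proof (rule integral_mono)
  show "indicator {s - r..s + r} x * \<Phi> x \<le> indicator {t - (r + R)..t + (r + R)} x * \<Phi> x" for x
    using assms(2)[of x] assms(3) by (auto simp: indicator_def)
qed (rule window_integrable[OF \<Phi>(1)])+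

lemma window_nonneg: "(\<And>x. 0 \<le> \<Phi> x) \<Longrightarrow> 0 \<le> window \<Phi> r t"
  unfolding window_def by (intro integral_nonneg_AE AE_I2) auto

text \<open>
  For measurable \<open>f\<close> this is the Wiener amalgam space \<open>W(L\<^sup>\<infinity>, \<ell>\<^sup>1)\<close>: the majorant is the
  convolution of an integrable function with the indicator of an interval.  In this form sums over lattices of any
  step reduce to one counting argument.
\<close>

definition wiener :: "(real \<Rightarrow> complex) \<Rightarrow> bool" where
  "wiener f \<longleftrightarrow> (\<exists>\<Phi> r. integrable lborel \<Phi> \<and> (\<forall>x. 0 \<le> \<Phi> x) \<and> 0 < r \<and> (\<forall>t. cmod (f t) \<le> window \<Phi> r t))"

lemma atomic_imp_wiener: assumes "atomic f" shows "wiener f"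
proof -
  obtain V \<alpha> \<beta> where V: "integrable (lborel \<Otimes>\<^sub>M lborel) V" and ab: "\<alpha> < \<beta>"
    and f: "\<And>t. f t = (LINT z|(lborel \<Otimes>\<^sub>M lborel). V z * tf_shift z (bump \<alpha> \<beta>) t)"
    using assms unfolding atomic_def by blast
  define M where "M = ((\<beta> - \<alpha>) * (\<beta> - \<alpha>))\<^sup>2"
  define r where "r = \<bar>\<alpha>\<bar> + \<bar>\<beta>\<bar> + 1"
  define \<Phi> where "\<Phi> x = M * (LINT \<omega>|lborel. cmod (V (x, \<omega>)))" for x
  have Vn: "integrable (lborel \<Otimes>\<^sub>M lborel) (\<lambda>z. cmod (V z))" using V by (rule integrable_norm)
  have \<Phi>: "integrable lborel \<Phi>" unfolding \<Phi>_def using lborel_pair.integrable_fst'[OF Vn] by simp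
  have \<Phi>0: "0 \<le> \<Phi> x" for x unfolding \<Phi>_def M_def by (auto intro!: mult_nonneg_nonneg integral_nonneg_AE)
  have "cmod (f t) \<le> window \<Phi> r t" for t
  proof -
    define W where "W z = indicator {t - r..t + r} (fst z) * (M * cmod (V z))" for z :: "real \<times> real"
    have W: "integrable (lborel \<Otimes>\<^sub>M lborel) W"
    proof -
      have "integrable (lborel \<Otimes>\<^sub>M lborel) (\<lambda>z. indicator ({t - r..t + r} \<times> UNIV) z *\<^sub>R (M * cmod (V z)))"
        by (intro integrable_mult_indicator integrable_mult_right Vn) auto
      then show ?thesis unfolding W_def by (simp add: indicator_times)
    qed
    have "cmod (f t) \<le> (LINT z|(lborel \<Otimes>\<^sub>M lborel). cmod (V z * tf_shift z (bump \<alpha> \<beta>) t))"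
      unfolding f by (rule integral_norm_bound)
    also have "\<dots> \<le> (LINT z|(lborel \<Otimes>\<^sub>M lborel). W z)"
    proof (rule integral_mono_AE')
      show "AE z in (lborel \<Otimes>\<^sub>M lborel). cmod (V z * tf_shift z (bump \<alpha> \<beta>) t) \<le> W z"
      proof (rule AE_I2)
        fix z :: "real \<times> real"
        obtain x \<omega> where z: "z = (x, \<omega>)" by force
        show "cmod (V z * tf_shift z (bump \<alpha> \<beta>) t) \<le> W z"
        proof (cases "bump \<alpha> \<beta> (t - x) = 0")
          case False
          then have "x \<in> {t - r..t + r}" by (auto simp: bump_def r_def split: if_splits)
          then show ?thesis using norm_bump_le[of \<alpha> \<beta> "t - x"]
            by (simp add: z W_def norm_mult tf_shift_eq M_def mult.commute mult_left_mono)
        qed (simp add: z W_def tf_shift_eq M_def)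
      qed
      show "AE z in (lborel \<Otimes>\<^sub>M lborel). 0 \<le> W z" by (auto simp: W_def M_def)
    qed (rule W)
    also have "\<dots> = (LINT x|lborel. LINT \<omega>|lborel. W (x, \<omega>))"
      by (rule lborel_pair.integral_fst'[OF W, symmetric])
    also have "\<dots> = window \<Phi> r t"
      unfolding window_def \<Phi>_def W_def by simp
    finally show ?thesis .
  qed
  moreover have "r > 0" by (simp add: r_def)
  ultimately show ?thesis unfolding wiener_def using \<Phi> \<Phi>0 by blast
qed

lemma wiener_bounded: assumes "wiener f" obtains B where "\<And>t. cmod (f t) \<le> B"
proof -
  obtain \<Phi> r where \<Phi>: "integrable lborel \<Phi>" "\<And>x. 0 \<le> \<Phi> x" "0 < r" "\<And>t. cmod (f t) \<le> window \<Phi> r t"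
    using assms unfolding wiener_def by blast
  have "window \<Phi> r t \<le> (LINT x|lborel. \<Phi> x)" for t
    unfolding window_def
  proof (rule integral_mono)
    show "indicator {t - r..t + r} x * \<Phi> x \<le> \<Phi> x" for x
      using \<Phi>(2)[of x] by (auto simp: indicator_def)
  qed (use window_integrable \<Phi> in auto)
  with \<Phi>(4) show ?thesis by (intro that) (rule order_trans)
qed

lemma wiener_lattice_sum:
  assumes "wiener f" "c > 0"
  obtains B where "\<And>t F. finite F \<Longrightarrow> (\<Sum>k\<in>F. cmod (f (t + c * real_of_int k))) \<le> B"
proof -
  obtain \<Phi> r where \<Phi>: "integrable lborel \<Phi>" "\<And>x. 0 \<le> \<Phi> x" "0 < r" "\<And>t. cmod (f t) \<le> window \<Phi> r t"
    using assms unfolding wiener_def by blast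
  show ?thesis
  proof (rule that)
    fix t and F :: "int set" assume "finite F"
    have "(\<Sum>k\<in>F. cmod (f (t + c * real_of_int k))) \<le> (\<Sum>k\<in>F. window \<Phi> r (t + c * real_of_int k))"
      by (intro sum_mono \<Phi>)
    also have "\<dots> \<le> (2 * r / c + 1) * (LINT x|lborel. \<Phi> x)"
      by (rule window_sum_le) (use \<Phi> \<open>finite F\<close> assms in auto)
    finally show "(\<Sum>k\<in>F. cmod (f (t + c * real_of_int k))) \<le> (2 * r / c + 1) * (LINT x|lborel. \<Phi> x)" .
  qed
qed

lemma wiener_integrable:
  assumes "wiener f" and [measurable]: "f \<in> borel_measurable borel"
  shows "integrable lborel f"
proof -
  obtain \<Phi> r where \<Phi>: "integrable lborel \<Phi>" "\<And>x. 0 \<le> \<Phi> x" "0 < r" "\<And>t. cmod (f t) \<le> window \<Phi> r t"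
    using assms unfolding wiener_def by blast
  have [measurable]: "\<Phi> \<in> borel_measurable borel" using \<Phi> by auto
  define W where "W z = indicator {snd z - r..snd z + r} (fst z) * \<Phi> (fst z)" for z :: "real \<times> real"
  have Wx: "W (x, t) = indicator {x - r..x + r} t * \<Phi> x" for x t
    by (auto simp: W_def indicator_def)
  have iw: "integrable lborel (indicator {x - r..x + r} :: real \<Rightarrow> real)" for x
    by (rule integrable_indicator_Icc)
  have [measurable]: "W \<in> borel_measurable (borel \<Otimes>\<^sub>M borel)"
  proof -
    have "W = (\<lambda>z. if snd z - r \<le> fst z \<and> fst z \<le> snd z + r then \<Phi> (fst z) else 0)"
      by (rule ext) (simp add: W_def indicator_def)
    then show ?thesis by simp
  qed
  have "integrable (lborel \<Otimes>\<^sub>M lborel) W"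
  proof (rule lborel_pair.Fubini_integrable)
    show "integrable lborel (\<lambda>x. LINT t|lborel. norm (W (x, t)))"
      using \<Phi> iw by (simp add: Wx abs_mult)
  qed (use iw in \<open>auto simp: Wx\<close>)
  then have "integrable lborel (\<lambda>t. LINT x|lborel. W (x, t))"
    using lborel_pair.integrable_snd[of "\<lambda>x t. W (x, t)"] by simp
  then have "integrable lborel (window \<Phi> r)" by (simp add: window_def[abs_def] W_def)
  then show ?thesis
    by (rule Bochner_Integration.integrable_bound)
      (use \<Phi>(4) in \<open>auto intro!: AE_I2 intro: order_trans abs_ge_self\<close>)
qed

section \<open>Summability of the ambiguity function over lattices\<close>

text \<open>
  The uniformity in the translation \<open>w\<close> is what makes the condition stable under integral
  superpositions of time-frequency shifts of \<open>f\<close>.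
\<close>

definition lattice_bounded :: "real \<Rightarrow> real \<Rightarrow> (real \<Rightarrow> complex) \<Rightarrow> (real \<Rightarrow> complex) \<Rightarrow> bool" where
  "lattice_bounded c1 c2 f h \<longleftrightarrow> (\<exists>B. \<forall>w1 w2. \<forall>F :: (int \<times> int) set. finite F \<longrightarrow>
     (\<Sum>(m, n)\<in>F. cmod (L2_inner lborel f (tf_shift (w1 + c1 * of_int m, w2 + c2 * of_int n) h))) \<le> B)"

lemma cmod_L2_inner_tf_shift_swap:
  "cmod (L2_inner lborel f (tf_shift (x, \<omega>) h)) = cmod (L2_inner lborel h (tf_shift (- x, - \<omega>) f))"
proof -
  have "L2_inner lborel f (tf_shift (x, \<omega>) h)
      = (LINT t|lborel. f (x + 1 * t) * cnj (tf_shift (x, \<omega>) h (x + 1 * t)))"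
    unfolding L2_inner_def by (subst lborel_integral_real_affine[of 1 _ x]) auto
  also have "\<dots> = (LINT t|lborel. cis (- (2 * pi * \<omega> * x)) * cnj (h t * cnj (tf_shift (- x, - \<omega>) f t)))"
    by (intro Bochner_Integration.integral_cong refl)
      (simp add: tf_shift_eq cis_cnj cis_mult[symmetric] ring_distribs add.commute)
  also have "\<dots> = cis (- (2 * pi * \<omega> * x)) * cnj (L2_inner lborel h (tf_shift (- x, - \<omega>) f))"
    unfolding integral_mult_right_zero L2_inner_def Bochner_Integration.integral_cnj ..
  finally show ?thesis by (simp add: norm_mult)
qed

lemma cmod_L2_inner_tf_shift_shift:
  "cmod (L2_inner lborel (tf_shift (y, \<eta>) f) (tf_shift (x, \<omega>) h))
    = cmod (L2_inner lborel f (tf_shift (x - y, \<omega> - \<eta>) h))"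
proof -
  have "L2_inner lborel (tf_shift (y, \<eta>) f) (tf_shift (x, \<omega>) h)
      = (LINT t|lborel. tf_shift (y, \<eta>) f (y + 1 * t) * cnj (tf_shift (x, \<omega>) h (y + 1 * t)))"
    unfolding L2_inner_def by (subst lborel_integral_real_affine[of 1 _ y]) auto
  also have "\<dots> = (LINT t|lborel. cis (2 * pi * (\<eta> - \<omega>) * y) * (f t * cnj (tf_shift (x - y, \<omega> - \<eta>) h t)))"
    by (intro Bochner_Integration.integral_cong refl)
      (simp add: tf_shift_eq cis_cnj cis_mult algebra_simps)
  also have "\<dots> = cis (2 * pi * (\<eta> - \<omega>) * y) * L2_inner lborel f (tf_shift (x - y, \<omega> - \<eta>) h)"
    unfolding integral_mult_right_zero L2_inner_def ..
  finally show ?thesis by (simp add: norm_mult)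
qed

lemma lattice_bounded_sym: assumes "lattice_bounded c1 c2 f h" shows "lattice_bounded c1 c2 h f"
proof -
  obtain B where B: "\<And>w1 w2 F. finite (F :: (int \<times> int) set) \<Longrightarrow>
     (\<Sum>(m, n)\<in>F. cmod (L2_inner lborel f (tf_shift (w1 + c1 * of_int m, w2 + c2 * of_int n) h))) \<le> B"
    using assms unfolding lattice_bounded_def by blast
  show ?thesis unfolding lattice_bounded_def
  proof (intro exI[of _ B] allI impI)
    fix w1 w2 and F :: "(int \<times> int) set" assume F: "finite F"
    have inj: "inj_on (\<lambda>(m, n). (- m, - n)) F" by (auto simp: inj_on_def)
    have "(\<Sum>(m, n)\<in>F. cmod (L2_inner lborel h (tf_shift (w1 + c1 * of_int m, w2 + c2 * of_int n) f)))
        = (\<Sum>(m, n)\<in>F. cmod (L2_inner lborel f (tf_shift (- w1 + c1 * of_int (- m), - w2 + c2 * of_int (- n)) h)))"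
    proof (intro sum.cong refl, clarify)
      fix m n :: int
      have "- (w1 + c1 * of_int m) = - w1 + c1 * of_int (- m)" "- (w2 + c2 * of_int n) = - w2 + c2 * of_int (- n)"
        by simp_all
      then show "cmod (L2_inner lborel h (tf_shift (w1 + c1 * of_int m, w2 + c2 * of_int n) f))
          = cmod (L2_inner lborel f (tf_shift (- w1 + c1 * of_int (- m), - w2 + c2 * of_int (- n)) h))"
        by (simp only: cmod_L2_inner_tf_shift_swap[of h])
    qed
    also have "\<dots> = (\<Sum>(m, n)\<in>(\<lambda>(m, n). (- m, - n)) ` F.
        cmod (L2_inner lborel f (tf_shift (- w1 + c1 * of_int m, - w2 + c2 * of_int n) h)))"
      by (subst sum.reindex[OF inj]) (simp only: o_def case_prod_unfold fst_conv snd_conv)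
    also have "\<dots> \<le> B" by (rule B) (use F in auto)
    finally show "(\<Sum>(m, n)\<in>F. cmod (L2_inner lborel h (tf_shift (w1 + c1 * of_int m, w2 + c2 * of_int n) f))) \<le> B" .
  qed
qed

lemma measurable_tf_shift [measurable]:
  assumes [measurable]: "f \<in> borel_measurable borel"
  shows "tf_shift z f \<in> borel_measurable borel"
proof -
  have "(\<lambda>t. cis (2 * pi * snd z * t) * f (t - fst z)) \<in> borel_measurable borel" by measurable
  then show ?thesis by (simp add: tf_shift_eq'[abs_def])
qed

text \<open>
  Fubini's theorem for the superposition that represents \<open>f\<close>.
\<close>

lemma atomic_L2_inner:
  fixes h :: "real \<Rightarrow> complex"
  assumes V: "integrable (lborel \<Otimes>\<^sub>M lborel) V"
    and f: "\<And>t. f t = (LINT z|(lborel \<Otimes>\<^sub>M lborel). V z * tf_shift z (bump \<alpha> \<beta>) t)"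
    and h: "integrable lborel h"
  shows "integrable (lborel \<Otimes>\<^sub>M lborel) (\<lambda>z. V z * L2_inner lborel (tf_shift z (bump \<alpha> \<beta>)) (tf_shift (x, \<omega>) h))"
    and "L2_inner lborel f (tf_shift (x, \<omega>) h)
      = (LINT z|(lborel \<Otimes>\<^sub>M lborel). V z * L2_inner lborel (tf_shift z (bump \<alpha> \<beta>)) (tf_shift (x, \<omega>) h))"
proof -
  define M where "M = ((\<beta> - \<alpha>) * (\<beta> - \<alpha>))\<^sup>2"
  define k where "k = tf_shift (x, \<omega>) h"
  have M0: "M \<ge> 0" by (simp add: M_def)
  have [measurable]: "h \<in> borel_measurable borel" using h by auto
  have [measurable]: "V \<in> borel_measurable (borel \<Otimes>\<^sub>M borel)"
    using borel_measurable_integrable[OF V] by (simp cong: measurable_cong_sets)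
  have [measurable]: "k \<in> borel_measurable borel" by (simp add: k_def)
  have "integrable lborel (\<lambda>t. h (- x + 1 * t))"
    using h by (intro lborel_integrable_real_affine) auto
  then have k: "integrable lborel k"
    by (rule Bochner_Integration.integrable_bound) (auto simp: k_def tf_shift_eq norm_mult)
  define G where "G = (\<lambda>(z, t). V z * (tf_shift z (bump \<alpha> \<beta>) t * cnj (k t)))"
  interpret P2: pair_sigma_finite "lborel \<Otimes>\<^sub>M lborel :: (real \<times> real) measure" "lborel :: real measure"
    by (intro pair_sigma_finite.intro) (simp_all add: lborel_prod sigma_finite_lborel)
  have GV: "integrable ((lborel \<Otimes>\<^sub>M lborel) \<Otimes>\<^sub>M lborel) G"
  proof (rule Bochner_Integration.integrable_bound)
    have "integrable ((lborel \<Otimes>\<^sub>M lborel) \<Otimes>\<^sub>M lborel) (\<lambda>(z, t). cmod (V z) * (M * cmod (k t)))"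
    proof (rule P2.Fubini_integrable)
      show "integrable (lborel \<Otimes>\<^sub>M lborel)
          (\<lambda>z. LINT t|lborel. norm (case (z, t) of (z, t) \<Rightarrow> cmod (V z) * (M * cmod (k t))))"
        using V M0 by (simp add: abs_mult)
    qed (use k in \<open>auto\<close>)
    then show "integrable ((lborel \<Otimes>\<^sub>M lborel) \<Otimes>\<^sub>M lborel) (\<lambda>zt. cmod (V (fst zt)) * (M * cmod (k (snd zt))))"
      by (simp only: case_prod_unfold)
    have "(\<lambda>zt. V (fst zt) * ((cis (2 * pi * snd (fst zt) * snd zt) * bump \<alpha> \<beta> (snd zt - fst (fst zt))) * cnj (k (snd zt))))
        \<in> borel_measurable ((lborel \<Otimes>\<^sub>M lborel) \<Otimes>\<^sub>M lborel)"
      by measurable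
    then show "G \<in> borel_measurable ((lborel \<Otimes>\<^sub>M lborel) \<Otimes>\<^sub>M lborel)"
      by (simp add: G_def case_prod_unfold tf_shift_eq')
    show "AE zt in ((lborel \<Otimes>\<^sub>M lborel) \<Otimes>\<^sub>M lborel).
        cmod (G zt) \<le> norm (cmod (V (fst zt)) * (M * cmod (k (snd zt))))"
    proof (rule AE_I2)
      fix zt :: "(real \<times> real) \<times> real"
      have "cmod (tf_shift (fst zt) (bump \<alpha> \<beta>) (snd zt)) \<le> M"
        using norm_bump_le by (simp add: tf_shift_eq' norm_mult M_def)
      then show "cmod (G zt) \<le> norm (cmod (V (fst zt)) * (M * cmod (k (snd zt))))"
        using M0 by (simp add: G_def case_prod_unfold norm_mult abs_mult mult_left_mono mult_right_mono)
    qed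
  qed
  have inner: "(LINT t|lborel. G (z, t)) = V z * L2_inner lborel (tf_shift z (bump \<alpha> \<beta>)) k" for z
    unfolding G_def prod.case L2_inner_def integral_mult_right_zero ..
  show "integrable (lborel \<Otimes>\<^sub>M lborel) (\<lambda>z. V z * L2_inner lborel (tf_shift z (bump \<alpha> \<beta>)) (tf_shift (x, \<omega>) h))"
    using P2.integrable_fst'[OF GV] unfolding inner k_def .
  have GV': "integrable ((lborel \<Otimes>\<^sub>M lborel) \<Otimes>\<^sub>M lborel) (case_prod (\<lambda>z t. G (z, t)))"
    using GV by simp
  have "L2_inner lborel f k = (LINT t|lborel. LINT z|(lborel \<Otimes>\<^sub>M lborel). G (z, t))"
    unfolding L2_inner_def f integral_mult_left_zero[symmetric] G_def prod.case mult.assoc ..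
  also have "\<dots> = (LINT z|(lborel \<Otimes>\<^sub>M lborel). LINT t|lborel. G (z, t))"
    by (rule P2.Fubini_integral[OF GV'])
  finally show "L2_inner lborel f (tf_shift (x, \<omega>) h)
      = (LINT z|(lborel \<Otimes>\<^sub>M lborel). V z * L2_inner lborel (tf_shift z (bump \<alpha> \<beta>)) (tf_shift (x, \<omega>) h))"
    unfolding inner k_def .
qed

text \<open>
  Up to a phase, \<open>\<langle>\<pi>(z) \<gamma>, \<pi>(\<lambda>) h\<rangle>\<close> is \<open>\<langle>\<gamma>, \<pi>(\<lambda> - z) h\<rangle>\<close>, so the sum over
  \<open>\<lambda>\<close> is at most \<open>\<integral> \<bar>V z\<bar> dz\<close> times the uniform bound for \<open>\<gamma>\<close>.
\<close>

lemma lattice_bounded_atomic: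
  fixes h :: "real \<Rightarrow> complex"
  assumes f: "atomic f" and h: "integrable lborel h"
    and bump: "\<And>\<alpha> \<beta>. lattice_bounded c1 c2 (bump \<alpha> \<beta>) h"
  shows "lattice_bounded c1 c2 f h"
proof -
  obtain V \<alpha> \<beta> where V: "integrable (lborel \<Otimes>\<^sub>M lborel) V"
    and f: "\<And>t. f t = (LINT z|(lborel \<Otimes>\<^sub>M lborel). V z * tf_shift z (bump \<alpha> \<beta>) t)"
    using f unfolding atomic_def by blast
  obtain B where B: "\<And>w1 w2 F. finite (F :: (int \<times> int) set) \<Longrightarrow>
     (\<Sum>(m, n)\<in>F. cmod (L2_inner lborel (bump \<alpha> \<beta>) (tf_shift (w1 + c1 * of_int m, w2 + c2 * of_int n) h))) \<le> B"
    using bump[of \<alpha> \<beta>] unfolding lattice_bounded_def by blast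
  show ?thesis unfolding lattice_bounded_def
  proof (intro exI[of _ "(LINT z|(lborel \<Otimes>\<^sub>M lborel). cmod (V z) * B)"] allI impI)
    fix w1 w2 and F :: "(int \<times> int) set" assume F: "finite F"
    define l where "l m n = (w1 + c1 * of_int m, w2 + c2 * of_int n)" for m n :: int
    define U where "U m n z = V z * L2_inner lborel (tf_shift z (bump \<alpha> \<beta>)) (tf_shift (l m n) h)" for m n z
    have U: "integrable (lborel \<Otimes>\<^sub>M lborel) (U m n)"
        "L2_inner lborel f (tf_shift (l m n) h) = (LINT z|(lborel \<Otimes>\<^sub>M lborel). U m n z)" for m n
      unfolding U_def l_def using atomic_L2_inner[OF V f h] by auto
    have "(\<Sum>(m, n)\<in>F. cmod (L2_inner lborel f (tf_shift (l m n) h)))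
        \<le> (\<Sum>(m, n)\<in>F. (LINT z|(lborel \<Otimes>\<^sub>M lborel). cmod (U m n z)))"
      unfolding U by (intro sum_mono) (auto intro: integral_norm_bound)
    also have "\<dots> = (LINT z|(lborel \<Otimes>\<^sub>M lborel). (\<Sum>(m, n)\<in>F. cmod (U m n z)))"
      unfolding case_prod_unfold
      by (rule Bochner_Integration.integral_sum[symmetric]) (intro integrable_norm U)
    also have "\<dots> \<le> (LINT z|(lborel \<Otimes>\<^sub>M lborel). cmod (V z) * B)"
    proof (rule integral_mono)
      show "integrable (lborel \<Otimes>\<^sub>M lborel) (\<lambda>z. \<Sum>(m, n)\<in>F. cmod (U m n z))"
        unfolding case_prod_unfold by (intro Bochner_Integration.integrable_sum integrable_norm U)
      show "integrable (lborel \<Otimes>\<^sub>M lborel) (\<lambda>z. cmod (V z) * B)"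
        using V by (intro integrable_mult_left integrable_norm)
      fix z :: "real \<times> real"
      obtain y \<eta> where z: "z = (y, \<eta>)" by force
      have "(\<Sum>(m, n)\<in>F. cmod (U m n z)) = cmod (V z) * (\<Sum>(m, n)\<in>F.
          cmod (L2_inner lborel (bump \<alpha> \<beta>) (tf_shift ((w1 - y) + c1 * of_int m, (w2 - \<eta>) + c2 * of_int n) h)))"
        unfolding sum_distrib_left
        by (intro sum.cong refl)
          (auto simp: U_def norm_mult z l_def cmod_L2_inner_tf_shift_shift algebra_simps)
      also have "\<dots> \<le> cmod (V z) * B"
        by (intro mult_left_mono B F) auto
      finally show "(\<Sum>(m, n)\<in>F. cmod (U m n z)) \<le> cmod (V z) * B" .
    qed
    finally show "(\<Sum>(m, n)\<in>F. cmod (L2_inner lborel f (tf_shift (w1 + c1 * of_int m, w2 + c2 * of_int n) h)))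
        \<le> (LINT z|(lborel \<Otimes>\<^sub>M lborel). cmod (V z) * B)" unfolding l_def .
  qed
qed

lemma integral_by_parts_twice:
  fixes F F' F'' :: "real \<Rightarrow> real"
  assumes AB: "A \<le> B"
    and F: "\<And>t. (F has_real_derivative F' t) (at t)" "\<And>t. (F' has_real_derivative F'' t) (at t)"
    and cont: "continuous_on UNIV F''"
    and zero: "F A = 0" "F B = 0" "F' A = 0" "F' B = 0"
    and K: "\<And>t. A \<le> t \<Longrightarrow> t \<le> B \<Longrightarrow> \<bar>F'' t\<bar> \<le> K"
  shows "\<omega>\<^sup>2 * cmod (LINT t|lborel. indicator {A..B} t *\<^sub>R (of_real (F t) * cis (\<omega> * t))) \<le> K * (B - A)"
proof (cases "\<omega> = 0")
  case True
  have "0 \<le> K" using K[of A] AB by auto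
  then show ?thesis using AB True by simp
next
  case \<omega>: False
  define \<kappa> where "\<kappa> = \<i> * complex_of_real \<omega>"
  have \<kappa>0: "\<kappa> \<noteq> 0" and \<kappa>n: "cmod (\<kappa>\<^sup>2) = \<omega>\<^sup>2" using \<omega> by (auto simp: \<kappa>_def norm_mult norm_power)
  define e where "e t = cis (\<omega> * t)" for t
  have e: "(e has_vector_derivative \<kappa> * e t) (at t within S)" for t S
  proof -
    have "((\<lambda>t. exp (\<kappa> * complex_of_real t)) has_vector_derivative \<kappa> * exp (\<kappa> * of_real t)) (at t within S)"
      by (auto intro!: derivative_eq_intros has_vector_derivative_real_field)
    then show ?thesis by (simp add: e_def[abs_def] \<kappa>_def cis_conv_exp mult_ac)
  qed
  have dF: "((\<lambda>t. complex_of_real (F t)) has_vector_derivative of_real (F' t)) (at t within S)"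
      "((\<lambda>t. complex_of_real (F' t)) has_vector_derivative of_real (F'' t)) (at t within S)" for t S
    using F[of t, THEN DERIV_subset[of _ _ _ UNIV S]]
    by (auto intro!: has_vector_derivative_of_real simp: has_real_derivative_iff_has_vector_derivative)
  have cF: "continuous_on X F" "continuous_on X F'" "continuous_on X F''" for X
    using F[THEN DERIV_isCont] cont
    by (auto intro: continuous_at_imp_continuous_on continuous_on_subset)
  \<comment> \<open>since \<open>e' = \<kappa> e\<close>, the derivative of \<open>G\<close> is \<open>e F - e F'' / \<kappa>\<^sup>2\<close>; and \<open>G\<close> vanishes at both ends\<close>
  define G where "G t = e t * (of_real (F t) * inverse \<kappa> - of_real (F' t) * inverse (\<kappa>\<^sup>2))" for t
  have G: "(G has_vector_derivative (e t * of_real (F t) - e t * of_real (F'' t) / \<kappa>\<^sup>2)) (at t within S)" for t S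
    unfolding G_def
    by (rule has_vector_derivative_eq_rhs, (rule has_vector_derivative_mult has_vector_derivative_diff
          has_vector_derivative_mult_left e dF)+)
      (use \<kappa>0 in \<open>simp add: field_simps power2_eq_square\<close>)
  have ce: "continuous_on X e" for X unfolding e_def by (intro continuous_intros)
  have ind: "integrable lborel (\<lambda>t. indicator {A..B} t *\<^sub>R (q t :: complex))" if "continuous_on UNIV q" for q
    using borel_integrable_atLeastAtMost'[OF continuous_on_subset[OF that]]
    by (simp add: set_integrable_def)
  have c1: "continuous_on X (\<lambda>t. e t * of_real (F t))" for X
    by (intro continuous_intros ce cF)
  have c2: "continuous_on X (\<lambda>t. e t * of_real (F'' t) / \<kappa>\<^sup>2)" for X
    by (intro continuous_intros ce cF) (use \<kappa>0 in auto)
  have "(LINT t|lborel. indicator {A..B} t *\<^sub>R (e t * of_real (F t) - e t * of_real (F'' t) / \<kappa>\<^sup>2)) = G B - G A"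
    by (rule integral_FTC_Icc[OF AB]) (use G c1 c2 in \<open>auto intro: continuous_on_diff\<close>)
  also have "\<dots> = 0" using zero by (simp add: G_def)
  finally have eq: "(LINT t|lborel. indicator {A..B} t *\<^sub>R (e t * of_real (F t)))
      = (LINT t|lborel. indicator {A..B} t *\<^sub>R (e t * of_real (F'' t) / \<kappa>\<^sup>2))"
    using ind[OF c1] ind[OF c2] by (simp add: scaleR_diff_right)
  have "cmod (LINT t|lborel. indicator {A..B} t *\<^sub>R (e t * of_real (F t)))
      \<le> (LINT t|lborel. cmod (indicator {A..B} t *\<^sub>R (e t * of_real (F'' t) / \<kappa>\<^sup>2)))"
    unfolding eq by (rule integral_norm_bound)
  also have "\<dots> \<le> (LINT t|lborel. indicator {A..B} t *\<^sub>R (K / \<omega>\<^sup>2))"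
  proof (rule integral_mono)
    show "integrable lborel (\<lambda>t. cmod (indicator {A..B} t *\<^sub>R (e t * of_real (F'' t) / \<kappa>\<^sup>2)))"
      by (intro integrable_norm ind c2)
    show "cmod (indicator {A..B} t *\<^sub>R (e t * of_real (F'' t) / \<kappa>\<^sup>2)) \<le> indicator {A..B} t *\<^sub>R (K / \<omega>\<^sup>2)" for t
      using K[of t] \<kappa>n by (auto simp: indicator_def norm_mult norm_divide e_def intro!: divide_right_mono)
  qed (intro integrable_scaleR_left integrable_indicator_Icc)
  also have "\<dots> = (B - A) * (K / \<omega>\<^sup>2)"
    using AB by (subst integral_scaleR_left) (auto intro: integrable_indicator_Icc)
  finally show ?thesis using \<omega> by (simp add: e_def field_simps mult.commute)
qed


lemma card_multiples_le:
  assumes "c > 0" "R \<ge> 0" "finite F" "\<And>k. k \<in> F \<Longrightarrow> \<bar>w + c * real_of_int k\<bar> \<le> R"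
  shows "real (card F) \<le> 2 * R / c + 1"
proof -
  have "real (card F) \<le> (R - w) / c - (- R - w) / c + 1"
  proof (rule card_int_interval)
    fix k assume "k \<in> F"
    from assms(4)[OF this] show "(- R - w) / c \<le> real_of_int k \<and> real_of_int k \<le> (R - w) / c"
      using assms(1) by (auto simp: field_simps)
  qed (use assms in \<open>auto simp: divide_right_mono\<close>)
  also have "\<dots> = 2 * R / c + 1" using assms(1) by (simp add: field_simps)
  finally show ?thesis .
qed

text \<open>
  \<open>1 / (1 + w\<^sup>2)\<close> is at most the integral of \<open>3 / (2 (1 + x\<^sup>2))\<close> over the interval of radius 1
  around \<open>w\<close>.
\<close>

lemma quadratic_decay_sum:
  assumes "c > 0"
  obtains B where "\<And>w F. finite F \<Longrightarrow> (\<Sum>k\<in>F. 1 / (1 + (w + c * real_of_int k)\<^sup>2)) \<le> B"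
proof -
  define \<Phi> where "\<Phi> x = 3 / 2 * inverse (1 + x\<^sup>2)" for x :: real
  have i: "integrable lborel \<Phi>"
    unfolding \<Phi>_def using integrable_inverse_1_plus_square by (simp add: set_integrable_def)
  have \<Phi>0: "0 \<le> \<Phi> x" for x by (simp add: \<Phi>_def)
  have le: "1 / (1 + w\<^sup>2) \<le> window \<Phi> 1 w" for w
  proof -
    have "(LINT x|lborel. indicator {w - 1..w + 1} x * (1 / (2 * (1 + w\<^sup>2)))) \<le> window \<Phi> 1 w"
      unfolding window_def
    proof (rule integral_mono)
      fix x
      have "1 / (2 * (1 + w\<^sup>2)) \<le> \<Phi> x" if "x \<in> {w - 1..w + 1}"
      proof -
        have "\<bar>x - w\<bar> \<le> 1" using that by auto
        then have "(x - w)\<^sup>2 \<le> 1" using abs_le_square_iff[of "x - w" 1] by simp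
        moreover have "x\<^sup>2 \<le> 2 * w\<^sup>2 + 2 * (x - w)\<^sup>2"
          using zero_le_power2[of "x - 2 * w"] by (simp add: power2_eq_square algebra_simps)
        moreover have "p \<le> 1 \<Longrightarrow> X \<le> 2 * W + 2 * p \<Longrightarrow> 0 \<le> W \<Longrightarrow> 1 + X \<le> 3 + 3 * W" for p X W :: real
          by linarith
        ultimately have "1 + x\<^sup>2 \<le> 3 + 3 * w\<^sup>2" using zero_le_power2[of w] by blast
        moreover have "0 < 1 + x\<^sup>2" "0 < 1 + w\<^sup>2" by (simp_all add: add_pos_nonneg)
        ultimately show ?thesis unfolding \<Phi>_def by (simp add: divide_simps)
      qed
      then show "indicator {w - 1..w + 1} x * (1 / (2 * (1 + w\<^sup>2))) \<le> indicator {w - 1..w + 1} x * \<Phi> x"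
        by (cases "x \<in> {w - 1..w + 1}") auto
      show "integrable lborel (\<lambda>x. indicator {w - 1..w + 1} x * (1 / (2 * (1 + w\<^sup>2))))"
        by (intro integrable_mult_left integrable_indicator_Icc)
    qed (rule window_integrable[OF i])
    moreover have "1 + w\<^sup>2 \<noteq> 0" using zero_le_power2[of w] by linarith
    then have "(LINT x|lborel. indicator {w - 1..w + 1} x * (1 / (2 * (1 + w\<^sup>2)))) = 1 / (1 + w\<^sup>2)"
      by (simp add: field_simps)
    ultimately show ?thesis by simp
  qed
  show ?thesis
  proof (rule that)
    fix w and F :: "int set" assume F: "finite F"
    have "(\<Sum>k\<in>F. 1 / (1 + (w + c * real_of_int k)\<^sup>2)) \<le> (\<Sum>k\<in>F. window \<Phi> 1 (w + c * real_of_int k))"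
      by (intro sum_mono le)
    also have "\<dots> \<le> (2 * 1 / c + 1) * (LINT x|lborel. \<Phi> x)"
      by (rule window_sum_le) (use i \<Phi>0 F assms in auto)
    finally show "(\<Sum>k\<in>F. 1 / (1 + (w + c * real_of_int k)\<^sup>2)) \<le> (2 * 1 / c + 1) * (LINT x|lborel. \<Phi> x)" .
  qed
qed

lemma abs_mult_le: "\<bar>u\<bar> \<le> U \<Longrightarrow> \<bar>v\<bar> \<le> W \<Longrightarrow> \<bar>u * v\<bar> \<le> U * (W::real)"
  by (simp add: abs_mult mult_mono')

lemma abs_add_le: "\<bar>u\<bar> \<le> U \<Longrightarrow> \<bar>v\<bar> \<le> W \<Longrightarrow> \<bar>u + v\<bar> \<le> U + (W::real)"
  by linarith

text \<open>
  The product of a bump and a shifted bump is \<open>q\<^sup>2\<close> on the intersection of their supports and 0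
  elsewhere, for a quartic polynomial \<open>q\<close> that vanishes at both ends of the intersection.  The second
  derivative of \<open>q\<^sup>2\<close> there is bounded independently of the shift.
\<close>

lemma bump_ambiguity_decay:
  obtains C R where "0 \<le> R" "0 \<le> C" "\<And>x \<omega>. cmod (L2_inner lborel (bump \<alpha> \<beta>) (tf_shift (x, \<omega>) (bump \<alpha>' \<beta>')))
      \<le> (if \<bar>x\<bar> \<le> R then C / (1 + \<omega>\<^sup>2) else 0)"
proof -
  define R where "R = \<bar>\<alpha>\<bar> + \<bar>\<beta>\<bar> + \<bar>\<alpha>'\<bar> + \<bar>\<beta>'\<bar>"
  define D where "D = max 1 (max (\<beta> - \<alpha>) (\<beta>' - \<alpha>'))"
  have D: "1 \<le> D" "\<beta> - \<alpha> \<le> D" "\<beta>' - \<alpha>' \<le> D" by (auto simp: D_def)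
  have D0: "0 \<le> D" using D by simp
  define Q0 where "Q0 = (D * D) * (D * D)"
  define Q1 where "Q1 = (2 * D) * (D * D) + (D * D) * (2 * D)"
  define Q2 where "Q2 = 2 * (D * D) + 2 * ((2 * D) * (2 * D)) + 2 * (D * D)"
  define K where "K = 2 * (Q1 * Q1) + 2 * (Q0 * Q2)"
  have Q: "0 \<le> Q0" "0 \<le> Q1" "0 \<le> Q2" "0 \<le> K"
    using D0 by (auto simp: Q0_def Q1_def Q2_def K_def intro!: add_nonneg_nonneg mult_nonneg_nonneg)
  \<comment> \<open>the first summand bounds the integral itself, the second one its product with \<open>\<omega>\<^sup>2\<close>\<close>
  define C where "C = D * (Q0 * Q0) + K * D"
  have C0: "0 \<le> C" using D0 Q by (simp add: C_def)
  have "cmod (L2_inner lborel (bump \<alpha> \<beta>) (tf_shift (x, \<omega>) (bump \<alpha>' \<beta>')))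
      \<le> (if \<bar>x\<bar> \<le> R then C / (1 + \<omega>\<^sup>2) else 0)" for x \<omega>
  proof -
    define A where "A = max \<alpha> (\<alpha>' + x)"
    define B where "B = min \<beta> (\<beta>' + x)"
    define q where "q t = (t - \<alpha>) * (\<beta> - t) * ((t - x - \<alpha>') * (\<beta>' - (t - x)))" for t
    define q' where "q' t = (\<beta> - t - (t - \<alpha>)) * ((t - x - \<alpha>') * (\<beta>' - (t - x)))
        + (t - \<alpha>) * (\<beta> - t) * (\<beta>' - (t - x) - (t - x - \<alpha>'))" for t
    define q'' where "q'' t = - 2 * ((t - x - \<alpha>') * (\<beta>' - (t - x)))
        + 2 * ((\<beta> - t - (t - \<alpha>)) * (\<beta>' - (t - x) - (t - x - \<alpha>'))) - 2 * ((t - \<alpha>) * (\<beta> - t))" for t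
    have dq: "(q has_real_derivative q' t) (at t)" "(q' has_real_derivative q'' t) (at t)" for t
      unfolding q_def[abs_def] q'_def[abs_def] q''_def
      by (auto intro!: derivative_eq_intros simp: algebra_simps)
    define P where "P t = (q t)\<^sup>2" for t
    define P' where "P' t = 2 * q t * q' t" for t
    define P'' where "P'' t = 2 * (q' t)\<^sup>2 + 2 * q t * q'' t" for t
    have dP: "(P has_real_derivative P' t) (at t)" "(P' has_real_derivative P'' t) (at t)" for t
      unfolding P_def[abs_def] P'_def[abs_def] P''_def
      by (auto intro!: derivative_eq_intros dq simp: algebra_simps power2_eq_square)
    have contP'': "continuous_on UNIV P''"
      unfolding P''_def q_def q'_def q''_def by (intro continuous_intros)
    have eq: "L2_inner lborel (bump \<alpha> \<beta>) (tf_shift (x, \<omega>) (bump \<alpha>' \<beta>'))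
        = (LINT t|lborel. indicator {A..B} t *\<^sub>R (of_real (P t) * cis (- (2 * pi * \<omega>) * t)))"
      unfolding L2_inner_def
    proof (rule Bochner_Integration.integral_cong[OF refl])
      fix t
      show "bump \<alpha> \<beta> t * cnj (tf_shift (x, \<omega>) (bump \<alpha>' \<beta>') t)
          = indicator {A..B} t *\<^sub>R (of_real (P t) * cis (- (2 * pi * \<omega>) * t))"
      proof (cases "t \<in> {A..B}")
        case True
        then have "\<alpha> \<le> t" "t \<le> \<beta>" "\<alpha>' \<le> t - x" "t - x \<le> \<beta>'" by (auto simp: A_def B_def)
        with True show ?thesis
          by (simp add: bump_def tf_shift_eq P_def q_def cis_cnj power_mult_distrib)
      next
        case False
        then show ?thesis by (auto simp: bump_def tf_shift_eq A_def B_def)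
      qed
    qed
    show ?thesis
    proof (cases "A \<le> B")
      case False
      then show ?thesis using C0 by (simp add: eq)
    next
      case AB: True
      have xR: "\<bar>x\<bar> \<le> R" using AB unfolding A_def B_def R_def by linarith
      have BA: "B - A \<le> D" using D unfolding A_def B_def by linarith
      have fac: "\<bar>t - \<alpha>\<bar> \<le> D" "\<bar>\<beta> - t\<bar> \<le> D" "\<bar>t - x - \<alpha>'\<bar> \<le> D" "\<bar>\<beta>' - (t - x)\<bar> \<le> D"
        if "A \<le> t" "t \<le> B" for t
        using that D unfolding A_def B_def by linarith+
      have qb: "\<bar>q t\<bar> \<le> Q0" "\<bar>q' t\<bar> \<le> Q1" "\<bar>q'' t\<bar> \<le> Q2" if t: "A \<le> t" "t \<le> B" for t
      proof -
        note f = fac[OF t]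
        have d1: "\<bar>\<beta> - t - (t - \<alpha>)\<bar> \<le> 2 * D" and d2: "\<bar>\<beta>' - (t - x) - (t - x - \<alpha>')\<bar> \<le> 2 * D"
          using f by linarith+
        show "\<bar>q t\<bar> \<le> Q0"
          unfolding q_def Q0_def by (intro abs_mult_le f)
        show "\<bar>q' t\<bar> \<le> Q1"
          unfolding q'_def Q1_def by (intro abs_add_le abs_mult_le f d1 d2)
        have "\<bar>- 2 * ((t - x - \<alpha>') * (\<beta>' - (t - x)))\<bar> \<le> 2 * (D * D)"
            "\<bar>2 * ((\<beta> - t - (t - \<alpha>)) * (\<beta>' - (t - x) - (t - x - \<alpha>')))\<bar> \<le> 2 * ((2 * D) * (2 * D))"
            "\<bar>2 * ((t - \<alpha>) * (\<beta> - t))\<bar> \<le> 2 * (D * D)"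
          by (intro abs_mult_le f d1 d2; simp)+
        then show "\<bar>q'' t\<bar> \<le> Q2"
          unfolding q''_def Q2_def by linarith
      qed
      have Pb: "\<bar>P t\<bar> \<le> Q0 * Q0" "\<bar>P'' t\<bar> \<le> K" if t: "A \<le> t" "t \<le> B" for t
      proof -
        show "\<bar>P t\<bar> \<le> Q0 * Q0"
          unfolding P_def power2_eq_square by (intro abs_mult_le qb t)
        show "\<bar>P'' t\<bar> \<le> K"
          unfolding P''_def K_def power2_eq_square mult.assoc
          by (intro abs_add_le abs_mult_le qb t; simp)
      qed
      define I where "I = cmod (LINT t|lborel. indicator {A..B} t *\<^sub>R (of_real (P t) * cis (- (2 * pi * \<omega>) * t)))"
      have qA: "q A = 0" "q B = 0" by (auto simp: q_def A_def B_def max_def min_def)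
      have "(- (2 * pi * \<omega>))\<^sup>2 * I \<le> K * (B - A)"
        unfolding I_def
        by (rule integral_by_parts_twice[OF AB dP contP'']) (use qA Pb in \<open>auto simp: P_def P'_def\<close>)
      also have "\<dots> \<le> K * D" using BA Q by (intro mult_left_mono) auto
      finally have "(2 * pi)\<^sup>2 * (\<omega>\<^sup>2 * I) \<le> K * D" by (simp add: power_mult_distrib mult_ac)
      moreover have "1 \<le> (2 * pi)\<^sup>2" by (rule one_le_power) (use pi_ge_two in linarith)
      then have "1 * (\<omega>\<^sup>2 * I) \<le> (2 * pi)\<^sup>2 * (\<omega>\<^sup>2 * I)"
        by (rule mult_right_mono) (simp add: I_def)
      ultimately have 1: "\<omega>\<^sup>2 * I \<le> K * D" by simp
      have "I \<le> (LINT t|lborel. cmod (indicator {A..B} t *\<^sub>R (of_real (P t) * cis (- (2 * pi * \<omega>) * t))))"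
        unfolding I_def by (rule integral_norm_bound)
      also have "\<dots> \<le> (LINT t|lborel. indicator {A..B} t *\<^sub>R (Q0 * Q0))"
      proof (rule integral_mono_AE')
        show "integrable lborel (\<lambda>t. indicator {A..B} t *\<^sub>R (Q0 * Q0))"
          by (intro integrable_scaleR_left integrable_indicator_Icc)
        show "AE t in lborel. cmod (indicator {A..B} t *\<^sub>R (of_real (P t) * cis (- (2 * pi * \<omega>) * t))) \<le> indicator {A..B} t *\<^sub>R (Q0 * Q0)"
          using Pb by (intro AE_I2) (auto simp: indicator_def norm_mult)
      qed (use Q in \<open>auto simp: indicator_def\<close>)
      also have "\<dots> = (B - A) * (Q0 * Q0)" using AB by (subst integral_scaleR_left) (auto intro: integrable_indicator_Icc)
      also have "\<dots> \<le> D * (Q0 * Q0)" using BA Q by (intro mult_right_mono) auto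
      finally have "I \<le> D * (Q0 * Q0)" .
      with 1 have "(1 + \<omega>\<^sup>2) * I \<le> C" by (simp add: C_def algebra_simps)
      then have "I \<le> C / (1 + \<omega>\<^sup>2)" by (simp add: field_simps add_pos_nonneg)
      then show ?thesis using xR by (simp add: eq I_def)
    qed
  qed
  moreover have "0 \<le> R" by (simp add: R_def)
  ultimately show ?thesis using C0 that by blast
qed

text \<open>
  Boundedly many of the translations give overlapping supports; for each of them the decay in the
  frequency is summable over the modulations.
\<close>

lemma lattice_bounded_bump:
  assumes "c1 > 0" "c2 > 0"
  shows "lattice_bounded c1 c2 (bump \<alpha> \<beta>) (bump \<alpha>' \<beta>')"
proof -
  obtain R C where R: "0 \<le> R" and C: "0 \<le> C" and le: "\<And>x \<omega>. cmod (L2_inner lborel (bump \<alpha> \<beta>) (tf_shift (x, \<omega>) (bump \<alpha>' \<beta>')))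
      \<le> (if \<bar>x\<bar> \<le> R then C / (1 + \<omega>\<^sup>2) else 0)"
    by (rule bump_ambiguity_decay[of \<alpha> \<beta> \<alpha>' \<beta>']) (rule that)
  obtain B where B: "\<And>w F. finite F \<Longrightarrow> (\<Sum>k\<in>F. 1 / (1 + (w + c2 * real_of_int k)\<^sup>2)) \<le> B"
    by (rule quadratic_decay_sum[OF assms(2)]) (rule that)
  have B0: "0 \<le> B" using B[of "{}" 0] by simp
  show ?thesis unfolding lattice_bounded_def
  proof (intro exI[of _ "(2 * R / c1 + 1) * (C * B)"] allI impI)
    fix w1 w2 and F :: "(int \<times> int) set" assume F: "finite F"
    define F1 where "F1 = fst ` F"
    define F2 where "F2 = snd ` F"
    have fin: "finite F1" "finite F2" and sub: "F \<subseteq> F1 \<times> F2" using F by (force simp: F1_def F2_def)+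
    define v where "v = (\<lambda>(m, n). (if \<bar>w1 + c1 * real_of_int m\<bar> \<le> R then 1 else 0)
        * (C * (1 / (1 + (w2 + c2 * real_of_int n)\<^sup>2))))"
    have "(\<Sum>(m, n)\<in>F. cmod (L2_inner lborel (bump \<alpha> \<beta>) (tf_shift (w1 + c1 * of_int m, w2 + c2 * of_int n) (bump \<alpha>' \<beta>'))))
        \<le> (\<Sum>z\<in>F. v z)"
      using le by (intro sum_mono) (auto simp: v_def split: if_splits intro: order_trans[OF le])
    also have "\<dots> \<le> (\<Sum>z\<in>F1 \<times> F2. v z)"
      by (rule sum_mono2) (use fin sub C in \<open>auto simp: v_def\<close>)
    also have "\<dots> = (\<Sum>m\<in>F1. if \<bar>w1 + c1 * real_of_int m\<bar> \<le> R then 1 else 0)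
        * (\<Sum>n\<in>F2. C * (1 / (1 + (w2 + c2 * real_of_int n)\<^sup>2)))"
      unfolding v_def sum_product sum.cartesian_product ..
    also have "\<dots> \<le> (2 * R / c1 + 1) * (C * B)"
    proof (rule mult_mono)
      have "real (card {m \<in> F1. \<bar>w1 + c1 * real_of_int m\<bar> \<le> R}) \<le> 2 * R / c1 + 1"
        by (rule card_multiples_le[where w=w1]) (use assms R fin in auto)
      then show "(\<Sum>m\<in>F1. if \<bar>w1 + c1 * real_of_int m\<bar> \<le> R then 1 else 0) \<le> 2 * R / c1 + 1"
        using fin by (simp add: sum.If_cases Int_def)
      show "(\<Sum>n\<in>F2. C * (1 / (1 + (w2 + c2 * real_of_int n)\<^sup>2))) \<le> C * B"
        unfolding sum_distrib_left[symmetric] by (rule mult_left_mono[OF B[OF fin(2)] C])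
    qed (use assms R C in \<open>auto intro!: sum_nonneg\<close>)
    finally show "(\<Sum>(m, n)\<in>F. cmod (L2_inner lborel (bump \<alpha> \<beta>) (tf_shift (w1 + c1 * of_int m, w2 + c2 * of_int n) (bump \<alpha>' \<beta>'))))
        \<le> (2 * R / c1 + 1) * (C * B)" .
  qed
qed

lemma S0_measurable: "f \<in> S0 \<Longrightarrow> f \<in> borel_measurable borel"
  by (auto simp: S0_def L2_def)

lemma S0_wiener: "f \<in> S0 \<Longrightarrow> wiener f"
  by (intro atomic_imp_wiener S0_atomic)

lemma S0_integrable: "f \<in> S0 \<Longrightarrow> integrable lborel f"
  by (intro wiener_integrable S0_wiener S0_measurable)

text \<open>
  First \<open>g\<close> and then, after exchanging the two arguments, \<open>f\<close> is reduced to a bump.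
\<close>

theorem S0_lattice_bounded:
  assumes "f \<in> S0" "g \<in> S0" "c1 > 0" "c2 > 0"
  shows "lattice_bounded c1 c2 f g"
proof -
  have "lattice_bounded c1 c2 g (bump \<alpha> \<beta>)" for \<alpha> \<beta>
    by (rule lattice_bounded_atomic[OF S0_atomic[OF assms(2)] integrable_bump lattice_bounded_bump[OF assms(3,4)]])
  then have "lattice_bounded c1 c2 (bump \<alpha> \<beta>) g" for \<alpha> \<beta>
    by (rule lattice_bounded_sym)
  then show ?thesis
    by (rule lattice_bounded_atomic[OF S0_atomic[OF assms(1)] S0_integrable[OF assms(2)]])
qed

lemma bij_betw_multiples: "c \<noteq> 0 \<Longrightarrow> bij_betw (\<lambda>k::int. c * of_int k) UNIV (multiples c)"
  by (auto simp: bij_betw_def inj_on_def multiples_def)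

lemma S0_summable_ambiguity:
  assumes "f \<in> S0" "g \<in> S0" "c1 > 0" "c2 > 0"
  shows "(\<lambda>z. cmod (L2_inner lborel f (tf_shift z g))) summable_on multiples c1 \<times> multiples c2"
proof -
  obtain B where B: "\<And>F. finite (F :: (int \<times> int) set) \<Longrightarrow>
     (\<Sum>(m, n)\<in>F. cmod (L2_inner lborel f (tf_shift (0 + c1 * of_int m, 0 + c2 * of_int n) g))) \<le> B"
    using S0_lattice_bounded[OF assms] unfolding lattice_bounded_def by blast
  have "(\<lambda>(m, n). cmod (L2_inner lborel f (tf_shift (c1 * of_int m, c2 * of_int n) g))) summable_on (UNIV :: (int \<times> int) set)"
    by (rule nonneg_bounded_partial_sums_imp_summable_on[where C=B])
      (use B in \<open>auto simp: intro!: eventually_finite_subsets_at_top_weakI\<close>)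
  moreover have "bij_betw (\<lambda>(m, n). (c1 * of_int m, c2 * of_int n)) (UNIV :: (int \<times> int) set) (multiples c1 \<times> multiples c2)"
    using bij_betw_map_prod[OF bij_betw_multiples[of c1] bij_betw_multiples[of c2]] assms
    by (simp add: map_prod_def)
  ultimately show ?thesis
    by (subst summable_on_reindex_bij_betw[symmetric]) (auto simp: case_prod_unfold)
qed

section \<open>Poisson summation\<close>

lemma continuous_measurable: "continuous_on UNIV q \<Longrightarrow> (q :: real \<Rightarrow> complex) \<in> borel_measurable borel"
  by (rule borel_measurable_continuous_onI)

lemma integrable_unit_interval:
  fixes q :: "real \<Rightarrow> complex"
  assumes "continuous_on UNIV q"
  shows "integrable lborel (\<lambda>t. indicator {-1/2..<1/2} t *\<^sub>R q t)"
proof -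
  have "integrable lborel (\<lambda>t. indicator {-1/2..1/2} t *\<^sub>R q t)"
    using borel_integrable_atLeastAtMost'[OF continuous_on_subset[OF assms]]
    by (simp add: set_integrable_def)
  then show ?thesis
  proof (rule Bochner_Integration.integrable_bound)
    show "(\<lambda>t. indicator {-1/2..<1/2} t *\<^sub>R q t) \<in> borel_measurable lborel"
      using continuous_measurable[OF assms] by measurable
  qed (auto simp: indicator_def)
qed

text \<open>
  A factor \<open>(1 + cos (2 \<pi> t)) / 2\<close> replaces a Fourier coefficient by a combination of it and
  its two neighbours.
\<close>

lemma fourier_kernel_vanish:
  fixes D :: "real \<Rightarrow> complex"
  assumes "continuous_on UNIV D"
    and "\<And>m::int. (LINT t|lborel. indicator {-1/2..<1/2} t *\<^sub>R (D t * cis (2 * pi * of_int m * t))) = 0"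
  shows "(LINT t|lborel. indicator {-1/2..<1/2} t *\<^sub>R (D t * of_real (((1 + cos (2 * pi * t)) / 2) ^ N) * cis (2 * pi * of_int m * t))) = 0"
  using assms
proof (induction N arbitrary: D m)
  case 0
  then show ?case by simp
next
  case (Suc N)
  define D' where "D' t = D t * of_real ((1 + cos (2 * pi * t)) / 2)" for t
  have c: "continuous_on UNIV D'" unfolding D'_def by (intro continuous_intros Suc.prems) auto
  have i: "integrable lborel (\<lambda>t. indicator {-1/2..<1/2} t *\<^sub>R (D t * cis (2 * pi * of_int m * t)))" for m :: int
    by (intro integrable_unit_interval continuous_intros Suc.prems)
  have "(LINT t|lborel. indicator {-1/2..<1/2} t *\<^sub>R (D' t * cis (2 * pi * of_int m * t))) = 0" for m :: int
  proof -
    have "D' t * cis (2 * pi * of_int m * t) = (1/2) * (D t * cis (2 * pi * of_int m * t))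
        + (1/4) * (D t * cis (2 * pi * of_int (m + 1) * t)) + (1/4) * (D t * cis (2 * pi * of_int (m - 1) * t))" for t
    proof -
      have a: "cis (2 * pi * of_int (m + 1) * t) = cis (2 * pi * of_int m * t) * cis (2 * pi * t)"
        "cis (2 * pi * of_int (m - 1) * t) = cis (2 * pi * of_int m * t) * cis (- (2 * pi * t))"
        by (simp_all add: cis_mult algebra_simps)
      have b: "complex_of_real (cos (2 * pi * t)) = (cis (2 * pi * t) + cis (- (2 * pi * t))) / 2"
        by (simp add: complex_eq_iff)
      show ?thesis
        unfolding D'_def a of_real_divide of_real_add b of_real_1 of_real_numeral
        by (simp add: field_simps)
    qed
    then have "(LINT t|lborel. indicator {-1/2..<1/2} t *\<^sub>R (D' t * cis (2 * pi * of_int m * t)))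
        = (LINT t|lborel. (1/2) * (indicator {-1/2..<1/2} t *\<^sub>R (D t * cis (2 * pi * of_int m * t)))
        + (1/4) * (indicator {-1/2..<1/2} t *\<^sub>R (D t * cis (2 * pi * of_int (m + 1) * t)))
        + (1/4) * (indicator {-1/2..<1/2} t *\<^sub>R (D t * cis (2 * pi * of_int (m - 1) * t))))"
      by (intro Bochner_Integration.integral_cong refl) (simp only: scaleR_right_distrib mult_scaleR_right)
    also have "\<dots> = (1/2) * (LINT t|lborel. indicator {-1/2..<1/2} t *\<^sub>R (D t * cis (2 * pi * of_int m * t)))
        + (1/4) * (LINT t|lborel. indicator {-1/2..<1/2} t *\<^sub>R (D t * cis (2 * pi * of_int (m + 1) * t)))
        + (1/4) * (LINT t|lborel. indicator {-1/2..<1/2} t *\<^sub>R (D t * cis (2 * pi * of_int (m - 1) * t)))"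
      using i[of m] i[of "m + 1"] i[of "m - 1"]
      by (simp only: Bochner_Integration.integral_add Bochner_Integration.integrable_add integrable_mult_right integral_mult_right_zero)
    also have "\<dots> = 0" by (simp only: Suc.prems(2)) simp
    finally show ?thesis .
  qed
  from Suc.IH[OF c this, of m] show ?case by (simp add: D'_def mult_ac)
qed

text \<open>
  The powers of \<open>(1 + cos (2 \<pi> t)) / 2\<close> concentrate at 0 on a unit interval centred there: if
  \<open>D 0 \<noteq> 0\<close>, the contribution of a neighbourhood of 0 to the vanishing integral of
  \<open>fourier_kernel_vanish\<close> would outgrow the rest exponentially.
\<close>

lemma fourier_coefficients_zero:
  fixes D :: "real \<Rightarrow> complex"
  assumes cont: "continuous_on UNIV D"
    and zero: "\<And>m::int. (LINT t|lborel. indicator {-1/2..<1/2} t *\<^sub>R (D t * cis (2 * pi * of_int m * t))) = 0"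
  shows "D 0 = 0"
proof (rule ccontr)
  assume "D 0 \<noteq> 0"
  define d where "d = cmod (D 0)"
  have d: "d > 0" using \<open>D 0 \<noteq> 0\<close> by (simp add: d_def)
  define k where "k t = (1 + cos (2 * pi * t)) / 2" for t :: real
  have k01: "0 \<le> k t" "k t \<le> 1" for t
  proof -
    have "0 \<le> 1 + cos (2 * pi * t)" using cos_ge_minus_one[of "2 * pi * t"] by linarith
    then show "0 \<le> k t" "k t \<le> 1" by (simp_all add: k_def)
  qed
  have "isCont D 0" using cont by (simp add: continuous_on_eq_continuous_at)
  then obtain \<delta>' where \<delta>': "\<delta>' > 0" "\<And>t. \<bar>t\<bar> < \<delta>' \<Longrightarrow> cmod (D t - D 0) < d / 2"
    unfolding continuous_at_eps_delta using d by (metis dist_norm half_gt_zero diff_zero real_norm_def)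
  \<comment> \<open>the bound \<open>1 / 4\<close> keeps \<open>[-\<delta>, \<delta>]\<close> inside the unit interval, where \<open>k\<close> decreases away from 0\<close>
  define \<delta> where "\<delta> = min (\<delta>' / 2) (1 / 4)"
  have \<delta>: "0 < \<delta>" "\<delta> \<le> 1 / 4" "\<delta> < \<delta>'" using \<delta>' by (auto simp: \<delta>_def)
  have "bounded (D ` {-1/2..1/2})"
    by (intro compact_imp_bounded compact_continuous_image continuous_on_subset[OF cont]) auto
  then obtain B where B: "\<And>s. s \<in> {-1/2..1/2} \<Longrightarrow> cmod (D s) \<le> B" unfolding bounded_iff by blast
  have kmono: "k s \<le> k t" if "\<bar>t\<bar> \<le> \<bar>s\<bar>" "\<bar>s\<bar> \<le> 1/2" for s t
  proof -
    have "cos (2 * pi * \<bar>s\<bar>) \<le> cos (2 * pi * \<bar>t\<bar>)"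
      by (rule cos_monotone_0_pi_le) (use that in \<open>auto simp: field_simps\<close>)
    moreover have "cos (2 * pi * \<bar>u\<bar>) = cos (2 * pi * u)" for u by (cases "u \<ge> 0") auto
    ultimately show ?thesis by (simp add: k_def)
  qed
  define \<kappa> where "\<kappa> = k \<delta>"
  define \<kappa>' where "\<kappa>' = k (\<delta> / 2)"
  have "cos (2 * pi * \<delta>) < cos (2 * pi * (\<delta> / 2))"
    by (rule cos_monotone_0_pi) (use \<delta> in \<open>auto simp: field_simps\<close>)
  then have \<kappa>: "0 \<le> \<kappa>" "\<kappa> < \<kappa>'" unfolding \<kappa>_def \<kappa>'_def using k01 by (auto simp: k_def)
  have main: "d * \<delta> / 2 \<le> (B + d) * (\<kappa> / \<kappa>') ^ N" for N
  proof -
    define I where "I = (LINT t|lborel. indicator {-1/2..<1/2} t *\<^sub>R (k t) ^ N)"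
    have ck: "continuous_on UNIV (\<lambda>t. complex_of_real (k t ^ N))" unfolding k_def by (intro continuous_intros) auto
    have ik: "integrable lborel (\<lambda>t. indicator {-1/2..<1/2} t *\<^sub>R complex_of_real (k t ^ N))"
      by (rule integrable_unit_interval[OF ck])
    have eq: "indicator X t *\<^sub>R complex_of_real y = complex_of_real (indicator X t *\<^sub>R y)" for t y and X :: "real set"
      by (simp add: scaleR_conv_of_real)
    from ik have ikr: "integrable lborel (\<lambda>t. indicator {-1/2..<1/2} t *\<^sub>R k t ^ N)"
      unfolding eq complex_of_real_integrable_eq .
    have iD: "integrable lborel (\<lambda>t. indicator {-1/2..<1/2} t *\<^sub>R (D t * complex_of_real (k t ^ N)))"
      by (intro integrable_unit_interval continuous_intros cont ck)
    have iDd: "integrable lborel (\<lambda>t. indicator {-1/2..<1/2} t *\<^sub>R ((D t - D 0) * complex_of_real (k t ^ N)))"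
      by (intro integrable_unit_interval continuous_intros cont ck)
    have ic: "integrable lborel (\<lambda>t. indicator {-1/2..<1/2::real} t *\<^sub>R c)" for c :: real
      by (intro integrable_scaleR_left integrable_real_indicator) auto
    have "0 = (LINT t|lborel. indicator {-1/2..<1/2} t *\<^sub>R (D t * complex_of_real (k t ^ N)))"
      using fourier_kernel_vanish[OF cont zero, of N 0] by (simp add: k_def)
    also have "\<dots> = (LINT t|lborel. indicator {-1/2..<1/2} t *\<^sub>R ((D t - D 0) * complex_of_real (k t ^ N))
        + D 0 * (indicator {-1/2..<1/2} t *\<^sub>R complex_of_real (k t ^ N)))"
      by (intro Bochner_Integration.integral_cong refl) (simp add: indicator_def algebra_simps)
    also have "\<dots> = (LINT t|lborel. indicator {-1/2..<1/2} t *\<^sub>R ((D t - D 0) * complex_of_real (k t ^ N)))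
        + D 0 * (LINT t|lborel. indicator {-1/2..<1/2} t *\<^sub>R complex_of_real (k t ^ N))"
      using iDd ik by (simp only: Bochner_Integration.integral_add integrable_mult_right integral_mult_right_zero)
    also have "(LINT t|lborel. indicator {-1/2..<1/2} t *\<^sub>R complex_of_real (k t ^ N)) = complex_of_real I"
      unfolding I_def eq by (rule integral_complex_of_real)
    finally have sum0: "0 = (LINT t|lborel. indicator {-1/2..<1/2} t *\<^sub>R ((D t - D 0) * complex_of_real (k t ^ N)))
        + D 0 * complex_of_real I" .
    have neg: "0 = x + y \<Longrightarrow> cmod y = cmod x" for x y :: complex
      by (metis add_eq_0_iff norm_minus_cancel)
    have "cmod (D 0 * complex_of_real I)
        = cmod (LINT t|lborel. indicator {-1/2..<1/2} t *\<^sub>R ((D t - D 0) * complex_of_real (k t ^ N)))"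
      using sum0 by (rule neg)
    also have "\<dots> \<le> (LINT t|lborel. cmod (indicator {-1/2..<1/2} t *\<^sub>R ((D t - D 0) * complex_of_real (k t ^ N))))"
      by (rule integral_norm_bound)
    also have "\<dots> \<le> (LINT t|lborel. (d / 2) * (indicator {-1/2..<1/2} t *\<^sub>R k t ^ N)
        + indicator {-1/2..<1/2::real} t *\<^sub>R ((B + d) * \<kappa> ^ N))"
    proof (rule integral_mono)
      show "integrable lborel (\<lambda>t. cmod (indicator {-1/2..<1/2} t *\<^sub>R ((D t - D 0) * complex_of_real (k t ^ N))))"
        by (rule integrable_norm[OF iDd])
      show "integrable lborel (\<lambda>t. (d / 2) * (indicator {-1/2..<1/2} t *\<^sub>R k t ^ N)
        + indicator {-1/2..<1/2::real} t *\<^sub>R ((B + d) * \<kappa> ^ N))"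
        by (intro Bochner_Integration.integrable_add integrable_mult_right ikr ic)
      fix t
      show "cmod (indicator {-1/2..<1/2} t *\<^sub>R ((D t - D 0) * complex_of_real (k t ^ N)))
          \<le> (d / 2) * (indicator {-1/2..<1/2} t *\<^sub>R k t ^ N) + indicator {-1/2..<1/2::real} t *\<^sub>R ((B + d) * \<kappa> ^ N)"
      proof (cases "t \<in> {-1/2..<1/2}")
        case True
        have Bt: "cmod (D t) \<le> B" using True by (intro B) auto
        then have B0: "0 \<le> B" using norm_ge_zero order_trans by blast
        have n: "cmod ((D t - D 0) * complex_of_real (k t ^ N)) = cmod (D t - D 0) * k t ^ N"
          using k01[of t] by (simp add: norm_mult norm_power)
        have "cmod (D t - D 0) * k t ^ N \<le> (d / 2) * k t ^ N + (B + d) * \<kappa> ^ N"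
        proof (cases "\<bar>t\<bar> < \<delta>")
          case True
          then have "cmod (D t - D 0) \<le> d / 2" using \<delta>'(2)[of t] \<delta> by simp
          then have "cmod (D t - D 0) * k t ^ N \<le> (d / 2) * k t ^ N"
            using k01[of t] by (intro mult_right_mono) auto
          moreover have "0 \<le> (B + d) * \<kappa> ^ N" using B0 d \<kappa> by simp
          ultimately show ?thesis by linarith
        next
          case False
          have "k t ^ N \<le> \<kappa> ^ N"
            unfolding \<kappa>_def using False True \<delta> k01[of t] by (intro power_mono kmono) auto
          moreover have "cmod (D t - D 0) \<le> B + d"
            using norm_triangle_ineq4[of "D t" "D 0"] Bt by (simp add: d_def)
          ultimately have "cmod (D t - D 0) * k t ^ N \<le> (B + d) * \<kappa> ^ N"
            using k01[of t] B0 d by (intro mult_mono) auto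
          moreover have "0 \<le> (d / 2) * k t ^ N" using d k01[of t] by simp
          ultimately show ?thesis by linarith
        qed
        then show ?thesis using True n by simp
      qed simp
    qed
    also have "\<dots> = (d / 2) * I + (B + d) * \<kappa> ^ N"
      using ikr ic[of "(B + d) * \<kappa> ^ N"] unfolding I_def
      by (subst Bochner_Integration.integral_add) auto
    also have "cmod (D 0 * complex_of_real I) = d * I"
    proof -
      have "0 \<le> I" unfolding I_def using k01 by (intro integral_nonneg_AE AE_I2) auto
      then show ?thesis by (simp add: norm_mult d_def)
    qed
    finally have le: "d * I \<le> (d / 2) * I + (B + d) * \<kappa> ^ N" .
    have "(LINT t|lborel. indicator {- (\<delta> / 2)..\<delta> / 2} t *\<^sub>R \<kappa>' ^ N) \<le> I"
      unfolding I_def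
    proof (rule integral_mono)
      show "integrable lborel (\<lambda>t. indicator {- (\<delta> / 2)..\<delta> / 2} t *\<^sub>R \<kappa>' ^ N)"
        by (intro integrable_scaleR_left integrable_indicator_Icc)
      show "indicator {- (\<delta> / 2)..\<delta> / 2} t *\<^sub>R \<kappa>' ^ N \<le> indicator {-1/2..<1/2} t *\<^sub>R k t ^ N" for t
      proof (cases "t \<in> {- (\<delta> / 2)..\<delta> / 2}")
        case True
        then have "\<kappa>' \<le> k t" unfolding \<kappa>'_def using \<delta> by (intro kmono) auto
        then have "\<kappa>' ^ N \<le> k t ^ N" using \<kappa> by (intro power_mono) auto
        moreover have "t \<in> {-1/2..<1/2}" using True \<delta> by auto
        ultimately show ?thesis using True by simp
      qed (use k01[of t] in simp)
    qed (rule ikr)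
    then have "\<delta> * \<kappa>' ^ N \<le> I"
      using \<delta> by (subst (asm) integral_scaleR_left) (auto intro: integrable_indicator_Icc)
    then have "d / 2 * (\<delta> * \<kappa>' ^ N) \<le> (d / 2) * I" using d by (intro mult_left_mono) auto
    with le have "d / 2 * (\<delta> * \<kappa>' ^ N) \<le> (B + d) * \<kappa> ^ N" by linarith
    then show ?thesis using \<kappa> by (simp add: power_divide field_simps)
  qed
  have "(\<lambda>N. (B + d) * (\<kappa> / \<kappa>') ^ N) \<longlonglongrightarrow> (B + d) * 0"
    using \<kappa> by (intro tendsto_mult tendsto_const LIMSEQ_realpow_zero) auto
  then have "d * \<delta> / 2 \<le> (B + d) * 0"
    by (rule LIMSEQ_le_const) (use main in blast)
  then show False using mult_pos_pos[OF d \<delta>(1)] by simp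
qed

lemma integral_infsum_swap:
  fixes f :: "'z \<Rightarrow> 'a \<Rightarrow> complex"
  assumes A: "countable A" and M: "sigma_finite_measure M"
    and int: "\<And>z. z \<in> A \<Longrightarrow> integrable M (f z)"
    and summ: "(\<lambda>z. LINT t|M. cmod (f z t)) summable_on A"
  shows "integrable M (\<lambda>t. \<Sum>\<^sub>\<infinity>z\<in>A. f z t)" "(\<lambda>z. LINT t|M. f z t) summable_on A"
    "(LINT t|M. (\<Sum>\<^sub>\<infinity>z\<in>A. f z t)) = (\<Sum>\<^sub>\<infinity>z\<in>A. (LINT t|M. f z t))"
proof -
  interpret P: pair_sigma_finite "count_space A" M
    by (intro pair_sigma_finite.intro M sigma_finite_measure_count_space_countable A)
  have "(\<lambda>x. f (fst x) (snd x)) \<in> borel_measurable (count_space A \<Otimes>\<^sub>M M)"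
    by (rule measurable_pair_measure_countable1[OF A]) (use int in auto)
  then have I: "integrable (count_space A \<Otimes>\<^sub>M M) (\<lambda>(z, t). f z t)"
    using summ int by (intro P.Fubini_integrable)
      (auto simp: case_prod_unfold summable_on_iff_integrable_real AE_count_space)
  show "integrable M (\<lambda>t. \<Sum>\<^sub>\<infinity>z\<in>A. f z t)" "(\<lambda>z. LINT t|M. f z t) summable_on A"
    using P.integrable_snd[OF I] P.integrable_fst[OF I]
    by (simp_all add: infsum_eq_integral summable_on_iff_integrable)
  show "(LINT t|M. (\<Sum>\<^sub>\<infinity>z\<in>A. f z t)) = (\<Sum>\<^sub>\<infinity>z\<in>A. (LINT t|M. f z t))"
    using P.Fubini_integral[OF I] by (simp add: infsum_eq_integral)
qed

lemma unit_interval_unique: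
  fixes t a :: real
  shows "\<exists>!k::int. t - a - of_int k \<in> {-1/2..<1/2}"
proof (rule ex1I[of _ "\<lfloor>t - a + 1/2\<rfloor>"])
  show "t - a - of_int \<lfloor>t - a + 1/2\<rfloor> \<in> {-1/2..<1/2}" by auto linarith+
  show "k = \<lfloor>t - a + 1/2\<rfloor>" if "t - a - of_int k \<in> {-1/2..<1/2}" for k
    using that by (intro floor_unique[symmetric]) auto
qed

text \<open>
  The translates of a unit interval tile the line; both interchanges of sum and integral are
  controlled by \<open>\<integral> \<bar>q\<bar>\<close>.
\<close>

lemma integral_unfold:
  fixes q :: "real \<Rightarrow> complex"
  assumes q: "integrable lborel q"
  shows "(LINT t|lborel. indicator {-1/2..<1/2} t *\<^sub>R (\<Sum>\<^sub>\<infinity>k::int. q (a + t + of_int k))) = (LINT t|lborel. q t)"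
proof -
  define J where "J k = (\<lambda>t. indicator {-1/2..<1/2} (t - a - of_int k) :: real)" for k :: int
  have [measurable]: "q \<in> borel_measurable borel" using q by auto
  have [measurable]: "J k \<in> borel_measurable borel" for k unfolding J_def by measurable
  have JI: "integrable lborel (\<lambda>t. J k t *\<^sub>R q t)" for k
    by (rule Bochner_Integration.integrable_bound[OF q]) (auto simp: J_def indicator_def)
  have one: "\<exists>k0. J k0 t = 1 \<and> (\<forall>k. k \<noteq> k0 \<longrightarrow> J k t = 0)" for t
  proof -
    obtain k0 :: int where "t - a - of_int k0 \<in> {-1/2..<1/2}" "\<And>k. t - a - of_int k \<in> {-1/2..<1/2} \<Longrightarrow> k = k0"
      using unit_interval_unique[of t a] by blast
    then show ?thesis by (intro exI[of _ k0]) (auto simp: J_def indicator_def)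
  qed
  have summ: "(\<lambda>k. LINT t|lborel. cmod (J k t *\<^sub>R q t)) summable_on UNIV"
  proof (rule nonneg_bounded_partial_sums_imp_summable_on[where C="LINT t|lborel. cmod (q t)"])
    show "\<forall>\<^sub>F F in finite_subsets_at_top UNIV. (\<Sum>k\<in>F. LINT t|lborel. cmod (J k t *\<^sub>R q t)) \<le> (LINT t|lborel. cmod (q t))"
    proof (rule eventually_finite_subsets_at_top_weakI)
      fix F :: "int set" assume F: "finite F"
      have "(\<Sum>k\<in>F. LINT t|lborel. cmod (J k t *\<^sub>R q t)) = (LINT t|lborel. (\<Sum>k\<in>F. cmod (J k t *\<^sub>R q t)))"
        by (rule Bochner_Integration.integral_sum[symmetric]) (intro integrable_norm JI)
      also have "\<dots> \<le> (LINT t|lborel. cmod (q t))"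
      proof (rule integral_mono)
        fix t
        obtain k0 where k0: "J k0 t = 1" "\<And>k. k \<noteq> k0 \<Longrightarrow> J k t = 0" using one[of t] by blast
        have "(\<Sum>k\<in>F. cmod (J k t *\<^sub>R q t)) = (\<Sum>k\<in>F. if k = k0 then cmod (q t) else 0)"
          by (intro sum.cong refl) (use k0 in auto)
        also have "\<dots> \<le> cmod (q t)" using F by simp
        finally show "(\<Sum>k\<in>F. cmod (J k t *\<^sub>R q t)) \<le> cmod (q t)" .
      qed (intro Bochner_Integration.integrable_sum integrable_norm JI q)+
      finally show "(\<Sum>k\<in>F. LINT t|lborel. cmod (J k t *\<^sub>R q t)) \<le> (LINT t|lborel. cmod (q t))" .
    qed
  qed auto
  have tr: "(LINT t|lborel. G (J k t *\<^sub>R q t)) = (LINT t|lborel. G (indicator {-1/2..<1/2} t *\<^sub>R q (a + t + of_int k)))"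
    for G :: "complex \<Rightarrow> 'b::{banach, second_countable_topology}" and k
    by (subst lborel_integral_real_affine[of 1 _ "a + of_int k"]) (auto simp: J_def algebra_simps)
  have "(LINT t|lborel. indicator {-1/2..<1/2} t *\<^sub>R (\<Sum>\<^sub>\<infinity>k::int. q (a + t + of_int k)))
      = (LINT t|lborel. (\<Sum>\<^sub>\<infinity>k::int. indicator {-1/2..<1/2} t *\<^sub>R q (a + t + of_int k)))"
    by (intro Bochner_Integration.integral_cong refl) (auto simp: indicator_def)
  also have "\<dots> = (\<Sum>\<^sub>\<infinity>k::int. (LINT t|lborel. indicator {-1/2..<1/2} t *\<^sub>R q (a + t + of_int k)))"
  proof (rule integral_infsum_swap(3))
    show "integrable lborel (\<lambda>t. indicator {-1/2..<1/2} t *\<^sub>R q (a + t + of_int k))" for k :: int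
      using lborel_integrable_real_affine[OF JI[of k], of 1 "a + of_int k"] by (simp add: J_def algebra_simps)
    show "(\<lambda>k::int. LINT t|lborel. cmod (indicator {-1/2..<1/2} t *\<^sub>R q (a + t + of_int k))) summable_on UNIV"
      using summ unfolding tr[of cmod] .
  qed (auto intro: sigma_finite_lborel)
  also have "\<dots> = (\<Sum>\<^sub>\<infinity>k. (LINT t|lborel. J k t *\<^sub>R q t))"
    using tr[of "\<lambda>x. x"] by simp
  also have "\<dots> = (LINT t|lborel. (\<Sum>\<^sub>\<infinity>k. J k t *\<^sub>R q t))"
    by (rule integral_infsum_swap(3)[symmetric]) (use JI summ in \<open>auto intro: sigma_finite_lborel\<close>)
  also have "\<dots> = (LINT t|lborel. q t)"
  proof (intro Bochner_Integration.integral_cong refl)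
    fix t
    obtain k0 where k0: "J k0 t = 1" "\<And>k. k \<noteq> k0 \<Longrightarrow> J k t = 0" using one[of t] by blast
    have "(\<Sum>\<^sub>\<infinity>k. J k t *\<^sub>R q t) = (\<Sum>\<^sub>\<infinity>k\<in>{k0}. J k t *\<^sub>R q t)"
      by (rule infsum_cong_neutral) (use k0 in auto)
    then show "(\<Sum>\<^sub>\<infinity>k. J k t *\<^sub>R q t) = q t" using k0 by simp
  qed
  finally show ?thesis .
qed

lemma cis_orthogonal:
  "(LINT t|lborel. indicator {-1/2..<1/2::real} t *\<^sub>R cis (2 * pi * of_int j * t)) = (if j = 0 then 1 else 0)"
proof (cases "j = 0")
  case True
  then show ?thesis by (simp add: scaleR_conv_of_real integral_complex_of_real)
next
  case False
  define G where "G t = cis (2 * pi * of_int j * t) / (2 * pi * \<i> * of_int j)" for t :: real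
  have G: "(G has_vector_derivative cis (2 * pi * of_int j * t)) (at t within S)" for t S
  proof -
    have "((\<lambda>t. exp ((2 * pi * \<i> * of_int j) * complex_of_real t) / (2 * pi * \<i> * of_int j))
        has_vector_derivative exp ((2 * pi * \<i> * of_int j) * of_real t)) (at t within S)"
      by (rule has_vector_derivative_real_field) (use False in \<open>auto intro!: derivative_eq_intros\<close>)
    then show ?thesis by (simp add: G_def[abs_def] cis_conv_exp mult_ac)
  qed
  have "(LINT t|lborel. indicator {-1/2..<1/2::real} t *\<^sub>R cis (2 * pi * of_int j * t))
      = (LINT t|lborel. indicator {-1/2..1/2::real} t *\<^sub>R cis (2 * pi * of_int j * t))"
    by (rule integral_cong_AE) (auto simp: indicator_def intro: eventually_mono[OF AE_lborel_singleton[of "1/2"]])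
  also have "\<dots> = G (1/2) - G (-1/2)"
    by (rule integral_FTC_Icc) (use G in \<open>auto intro!: continuous_intros\<close>)
  also have "\<dots> = 0"
  proof -
    have "cis (pi * of_int j) = cis (- (pi * of_int j))"
      by (simp add: complex_eq_iff sin_times_pi_eq_0 mult.commute)
    then show ?thesis by (simp add: G_def)
  qed
  finally show ?thesis using False by simp
qed

lemma continuous_on_infsum:
  fixes F :: "'z \<Rightarrow> real \<Rightarrow> complex"
  assumes cont: "\<And>z. z \<in> A \<Longrightarrow> continuous_on UNIV (F z)"
    and dom: "\<And>R. \<exists>v. v summable_on A \<and> (\<forall>t z. \<bar>t\<bar> \<le> R \<longrightarrow> z \<in> A \<longrightarrow> cmod (F z t) \<le> v z)"
  shows "continuous_on UNIV (\<lambda>t. \<Sum>\<^sub>\<infinity>z\<in>A. F z t)"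
proof -
  have c: "continuous_on {-R..R} (\<lambda>t. \<Sum>\<^sub>\<infinity>z\<in>A. F z t)" for R
  proof -
    obtain v where v: "v summable_on A" "\<And>t z. \<bar>t\<bar> \<le> R \<Longrightarrow> z \<in> A \<Longrightarrow> cmod (F z t) \<le> v z"
      using dom[of R] by blast
    show ?thesis
    proof (rule uniform_limit_theorem[OF _ Weierstrass_m_test_general[OF _ v(1)]])
      show "\<forall>\<^sub>F X in finite_subsets_at_top A. continuous_on {-R..R} (\<lambda>t. \<Sum>z\<in>X. F z t)"
        by (rule eventually_finite_subsets_at_top_weakI)
          (intro continuous_on_sum continuous_on_subset[OF cont], auto)
    qed (use v(2) in auto)
  qed
  show ?thesis
    unfolding continuous_on_eq_continuous_at[OF open_UNIV]
  proof
    fix t :: real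
    have "t \<in> interior {- (\<bar>t\<bar> + 1)..\<bar>t\<bar> + 1}" by auto
    then show "isCont (\<lambda>t. \<Sum>\<^sub>\<infinity>z\<in>A. F z t) t"
      using c continuous_on_interior by blast
  qed
qed

text \<open>
  Both sides are continuous in \<open>t0\<close> and have the same Fourier coefficients on the unit interval
  around \<open>t0\<close>.
\<close>

lemma Poisson_summation_unit:
  fixes \<phi> :: "real \<Rightarrow> complex"
  assumes cont: "continuous_on UNIV \<phi>" and int: "integrable lborel \<phi>"
    and dom: "\<And>R. \<exists>v. v summable_on UNIV \<and> (\<forall>t (k::int). \<bar>t\<bar> \<le> R \<longrightarrow> cmod (\<phi> (t + of_int k)) \<le> v k)"
    and summ: "(\<lambda>m::int. fourier \<phi> (of_int m)) summable_on UNIV"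
  shows "(\<Sum>\<^sub>\<infinity>k::int. \<phi> (t0 + of_int k)) = (\<Sum>\<^sub>\<infinity>m::int. fourier \<phi> (of_int m) * cis (2 * pi * of_int m * t0))"
proof -
  define c where "c m = fourier \<phi> (of_int m)" for m :: int
  have c_abs: "(\<lambda>m. cmod (c m)) summable_on UNIV"
    using summ unfolding c_def by (rule summable_on_iff_abs_summable_on_complex[THEN iffD1])
  define S where "S t = (\<Sum>\<^sub>\<infinity>k::int. \<phi> (t0 + t + of_int k))" for t
  define E where "E t = (\<Sum>\<^sub>\<infinity>m. c m * cis (2 * pi * of_int m * (t0 + t)))" for t
  have cS: "continuous_on UNIV S" unfolding S_def
  proof (rule continuous_on_infsum)
    fix R
    obtain v where v: "v summable_on UNIV" "\<And>t (k::int). \<bar>t\<bar> \<le> R + \<bar>t0\<bar> \<Longrightarrow> cmod (\<phi> (t + of_int k)) \<le> v k"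
      using dom[of "R + \<bar>t0\<bar>"] by blast
    show "\<exists>v. v summable_on UNIV \<and> (\<forall>t (k::int). \<bar>t\<bar> \<le> R \<longrightarrow> k \<in> UNIV \<longrightarrow> cmod (\<phi> (t0 + t + of_int k)) \<le> v k)"
    proof (intro exI[of _ v] conjI v(1) allI impI)
      fix t and k :: int assume "\<bar>t\<bar> \<le> R"
      then show "cmod (\<phi> (t0 + t + of_int k)) \<le> v k" by (intro v(2)) linarith
    qed
  qed (intro continuous_on_compose2[OF cont] continuous_intros; auto)
  have cE: "continuous_on UNIV E" unfolding E_def
  proof (rule continuous_on_infsum)
    show "\<exists>v. v summable_on UNIV \<and> (\<forall>t m. \<bar>t\<bar> \<le> R \<longrightarrow> m \<in> UNIV \<longrightarrow> cmod (c m * cis (2 * pi * of_int m * (t0 + t))) \<le> v m)" for R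
      by (intro exI[of _ "\<lambda>m. cmod (c m)"]) (auto simp: norm_mult c_abs)
  qed (intro continuous_intros)
  have "S 0 - E 0 = 0"
  proof (rule fourier_coefficients_zero)
    show "continuous_on UNIV (\<lambda>t. S t - E t)" by (intro continuous_intros cS cE)
    fix m :: int
    have iS: "integrable lborel (\<lambda>t. indicator {-1/2..<1/2} t *\<^sub>R (S t * cis (2 * pi * of_int m * t)))"
      by (intro integrable_unit_interval continuous_intros cS)
    have iE: "integrable lborel (\<lambda>t. indicator {-1/2..<1/2} t *\<^sub>R (E t * cis (2 * pi * of_int m * t)))"
      by (intro integrable_unit_interval continuous_intros cE)
    define q where "q t = \<phi> t * cis (2 * pi * of_int m * (t - t0))" for t
    have [measurable]: "\<phi> \<in> borel_measurable borel" using int by auto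
    have q: "integrable lborel q"
      by (rule Bochner_Integration.integrable_bound[OF int]) (auto simp: q_def[abs_def] norm_mult)
    have per: "cis (2 * pi * of_int m * (t + of_int k)) = cis (2 * pi * of_int m * t)" for t and k :: int
    proof -
      have "cis (2 * pi * of_int m * (t + of_int k)) = cis (2 * pi * of_int m * t) * cis (2 * pi * of_int (m * k))"
        by (simp add: cis_mult algebra_simps)
      then show ?thesis by (simp add: cis_multiple_2pi[unfolded Ints_def] del: of_int_mult)
    qed
    have "S t * cis (2 * pi * of_int m * t) = (\<Sum>\<^sub>\<infinity>k::int. q (t0 + t + of_int k))" for t
      unfolding S_def q_def infsum_cmult_left'[symmetric]
      by (intro infsum_cong) (use per[of t] in \<open>simp add: algebra_simps\<close>)
    then have "(LINT t|lborel. indicator {-1/2..<1/2} t *\<^sub>R (S t * cis (2 * pi * of_int m * t))) = (LINT t|lborel. q t)"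
      using integral_unfold[OF q, of t0] by simp
    also have "\<dots> = (LINT t|lborel. (\<phi> t * cis (- (2 * pi * of_int (- m) * t))) * cis (- (2 * pi * of_int m * t0)))"
      by (intro Bochner_Integration.integral_cong refl) (simp add: q_def cis_mult algebra_simps)
    also have "\<dots> = c (- m) * cis (- (2 * pi * of_int m * t0))"
      unfolding integral_mult_left_zero c_def fourier_def ..
    finally have S: "(LINT t|lborel. indicator {-1/2..<1/2} t *\<^sub>R (S t * cis (2 * pi * of_int m * t)))
        = c (- m) * cis (- (2 * pi * of_int m * t0))" .
    define e where "e l t = indicator {-1/2..<1/2::real} t *\<^sub>R cis (2 * pi * of_int (l + m) * t)" for l t
    have ie: "integrable lborel (e l)" for l
      unfolding e_def by (intro integrable_unit_interval continuous_intros)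
    have ne: "(LINT t|lborel. cmod (e l t)) = 1" for l
    proof -
      have "(LINT t|lborel. cmod (e l t)) = (LINT t|lborel. indicator {-1/2..<1/2::real} t)"
        by (intro Bochner_Integration.integral_cong refl) (simp add: e_def)
      then show ?thesis by simp
    qed
    have "(LINT t|lborel. indicator {-1/2..<1/2} t *\<^sub>R (E t * cis (2 * pi * of_int m * t)))
        = (LINT t|lborel. (\<Sum>\<^sub>\<infinity>l. (c l * cis (2 * pi * of_int l * t0)) * e l t))"
    proof (intro Bochner_Integration.integral_cong refl)
      fix t
      have "indicator {-1/2..<1/2} t *\<^sub>R (E t * cis (2 * pi * of_int m * t))
          = (\<Sum>\<^sub>\<infinity>l. c l * cis (2 * pi * of_int l * (t0 + t))) * (indicator {-1/2..<1/2::real} t *\<^sub>R cis (2 * pi * of_int m * t))"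
        by (simp add: E_def)
      also have "\<dots> = (\<Sum>\<^sub>\<infinity>l. (c l * cis (2 * pi * of_int l * t0)) * e l t)"
        unfolding infsum_cmult_left'[symmetric]
        by (intro infsum_cong) (simp add: e_def cis_mult algebra_simps indicator_def)
      finally show "indicator {-1/2..<1/2} t *\<^sub>R (E t * cis (2 * pi * of_int m * t))
          = (\<Sum>\<^sub>\<infinity>l. (c l * cis (2 * pi * of_int l * t0)) * e l t)" .
    qed
    also have "\<dots> = (\<Sum>\<^sub>\<infinity>l. (LINT t|lborel. (c l * cis (2 * pi * of_int l * t0)) * e l t))"
      by (rule integral_infsum_swap(3)) (use ie ne c_abs in \<open>auto simp: norm_mult intro: sigma_finite_lborel\<close>)
    also have "\<dots> = (\<Sum>\<^sub>\<infinity>l. (c l * cis (2 * pi * of_int l * t0)) * (if l + m = 0 then 1 else 0))"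
      unfolding integral_mult_right_zero e_def cis_orthogonal ..
    also have "\<dots> = (\<Sum>\<^sub>\<infinity>l\<in>{- m}. c l * cis (2 * pi * of_int l * t0))"
      by (rule infsum_cong_neutral) auto
    finally have E: "(LINT t|lborel. indicator {-1/2..<1/2} t *\<^sub>R (E t * cis (2 * pi * of_int m * t)))
        = c (- m) * cis (- (2 * pi * of_int m * t0))" by simp
    show "(LINT t|lborel. indicator {-1/2..<1/2} t *\<^sub>R ((S t - E t) * cis (2 * pi * of_int m * t))) = 0"
      using Bochner_Integration.integral_diff[OF iS iE] unfolding S E
      by (simp add: left_diff_distrib scaleR_diff_right)
  qed
  then show ?thesis by (simp add: S_def E_def c_def)
qed

theorem Poisson_summation:
  fixes \<phi> :: "real \<Rightarrow> complex"
  assumes p: "p > 0" and cont: "continuous_on UNIV \<phi>" and int: "integrable lborel \<phi>"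
    and dom: "\<And>R. \<exists>v. v summable_on UNIV \<and> (\<forall>t (k::int). \<bar>t\<bar> \<le> R \<longrightarrow> cmod (\<phi> (t + p * of_int k)) \<le> v k)"
    and summ: "(\<lambda>m::int. fourier \<phi> (of_int m / p)) summable_on UNIV"
  shows "(\<Sum>\<^sub>\<infinity>k::int. \<phi> (t + p * of_int k))
    = of_real (1 / p) * (\<Sum>\<^sub>\<infinity>m::int. fourier \<phi> (of_int m / p) * cis (2 * pi * (of_int m / p) * t))"
proof -
  define \<psi> where "\<psi> t = \<phi> (p * t)" for t
  have ft: "fourier \<psi> \<omega> = of_real (1 / p) * fourier \<phi> (\<omega> / p)" for \<omega>
  proof -
    have "fourier \<phi> (\<omega> / p) = p *\<^sub>R (LINT s|lborel. \<phi> (0 + p * s) * cis (- (2 * pi * (\<omega> / p) * (0 + p * s))))"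
      unfolding fourier_def using p by (subst lborel_integral_real_affine[of p _ 0]) auto
    also have "\<dots> = p *\<^sub>R fourier \<psi> \<omega>" using p by (simp add: fourier_def \<psi>_def mult.assoc)
    finally show ?thesis using p by (simp add: scaleR_conv_of_real)
  qed
  have "(\<Sum>\<^sub>\<infinity>k::int. \<psi> (t / p + of_int k)) = (\<Sum>\<^sub>\<infinity>m::int. fourier \<psi> (of_int m) * cis (2 * pi * of_int m * (t / p)))"
  proof (rule Poisson_summation_unit)
    show "continuous_on UNIV \<psi>" unfolding \<psi>_def by (intro continuous_on_compose2[OF cont] continuous_intros) auto
    show "integrable lborel \<psi>" unfolding \<psi>_def using lborel_integrable_real_affine[OF int, of p 0] p by simp
    show "(\<lambda>m::int. fourier \<psi> (of_int m)) summable_on UNIV"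
      unfolding ft by (intro summable_on_cmult_right summ)
    fix R
    obtain v where v: "v summable_on UNIV" "\<And>t (k::int). \<bar>t\<bar> \<le> p * R \<Longrightarrow> cmod (\<phi> (t + p * of_int k)) \<le> v k"
      using dom[of "p * R"] by blast
    show "\<exists>v. v summable_on UNIV \<and> (\<forall>t (k::int). \<bar>t\<bar> \<le> R \<longrightarrow> cmod (\<psi> (t + of_int k)) \<le> v k)"
    proof (intro exI[of _ v] conjI v(1) allI impI)
      fix t and k :: int assume "\<bar>t\<bar> \<le> R"
      then show "cmod (\<psi> (t + of_int k)) \<le> v k"
        using v(2)[of "p * t" k] p by (simp add: \<psi>_def abs_mult distrib_left)
    qed
  qed
  then show ?thesis
    using p unfolding ft mult.assoc infsum_cmult_right' by (simp add: \<psi>_def distrib_left)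
qed

section \<open>Matrices with bounded row and column sums\<close>

lemma infsum_complex_of_real: "(\<Sum>\<^sub>\<infinity>k\<in>A. complex_of_real (f k)) = of_real (\<Sum>\<^sub>\<infinity>k\<in>A. f k)"
  unfolding infsum_eq_integral infsum_eq_integral_real by (rule integral_complex_of_real)

definition ell_one :: "('a \<Rightarrow> complex) \<Rightarrow> bool" where
  "ell_one x \<longleftrightarrow> (\<lambda>k. cmod (x k)) summable_on UNIV"

lemma ell_one_summable: "ell_one x \<Longrightarrow> x summable_on UNIV"
  unfolding ell_one_def by (rule abs_summable_summable)

lemma ell_one_mult_bounded:
  assumes "ell_one x" "\<And>k. cmod (y k) \<le> Y"
  shows "ell_one (\<lambda>k. y k * x k)"
  unfolding ell_one_def
proof (rule summable_on_comparison_test)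
  show "(\<lambda>k. Y * cmod (x k)) summable_on UNIV"
    using assms(1) unfolding ell_one_def by (rule summable_on_cmult_right)
qed (auto simp: norm_mult intro: mult_right_mono assms(2))

lemma ell_one_diff: "ell_one x \<Longrightarrow> ell_one y \<Longrightarrow> ell_one (\<lambda>k. x k - y k)"
  unfolding ell_one_def
  by (rule summable_on_comparison_test[where f="\<lambda>k. cmod (x k) + cmod (y k)"])
    (auto intro: norm_triangle_ineq4 summable_on_add)

lemma ell_one_cmult: "ell_one x \<Longrightarrow> ell_one (\<lambda>k. c * x k)"
  unfolding ell_one_def norm_mult by (rule summable_on_cmult_right)

lemma ell_one_bounded: assumes "ell_one x" shows "cmod (x k) \<le> (\<Sum>\<^sub>\<infinity>k. cmod (x k))"
  using finite_sum_le_infsum[of "\<lambda>k. cmod (x k)" UNIV "{k}"] assms by (simp add: ell_one_def)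

definition sum_bounded :: "real \<Rightarrow> ('a \<Rightarrow> complex) \<Rightarrow> bool" where
  "sum_bounded B x \<longleftrightarrow> (\<forall>F. finite F \<longrightarrow> (\<Sum>k\<in>F. cmod (x k)) \<le> B)"

lemma sum_bounded_ell_one: assumes "sum_bounded B x" shows "ell_one x"
  unfolding ell_one_def
  by (rule nonneg_bounded_partial_sums_imp_summable_on[where C=B])
    (use assms in \<open>auto simp: sum_bounded_def intro: eventually_finite_subsets_at_top_weakI\<close>)

lemma sum_bounded_infsum: assumes "sum_bounded B x" shows "(\<Sum>\<^sub>\<infinity>k. cmod (x k)) \<le> B"
  by (rule infsum_le_finite_sums)
    (use sum_bounded_ell_one[OF assms] assms in \<open>auto simp: sum_bounded_def ell_one_def\<close>)

lemma sum_bounded_le: assumes "sum_bounded B x" shows "cmod (x k) \<le> B"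
  using assms[unfolded sum_bounded_def, rule_format, of "{k}"] by simp

text \<open>
  With column sums at most \<open>B\<close>, the double series of \<open>y p (a p k x k)\<close> is dominated by
  \<open>Y B \<Sum>\<bar>x k\<bar>\<close>.  All later exchanges of summation are instances of this.
\<close>

lemma Schur_swap:
  fixes a :: "'p \<Rightarrow> 'k \<Rightarrow> complex"
  assumes cols: "\<And>k. sum_bounded B (\<lambda>p. a p k)" and x: "ell_one x" and y: "\<And>p. cmod (y p) \<le> Y"
  shows Schur_product: "(\<lambda>(k, p). y p * (a p k * x k)) summable_on UNIV"
    and Schur_row: "\<And>p. (\<lambda>k. a p k * x k) summable_on UNIV"
    and Schur_ell_one: "ell_one (\<lambda>p. \<Sum>\<^sub>\<infinity>k. a p k * x k)"
    and Schur_duality: "(\<Sum>\<^sub>\<infinity>p. y p * (\<Sum>\<^sub>\<infinity>k. a p k * x k)) = (\<Sum>\<^sub>\<infinity>k. (\<Sum>\<^sub>\<infinity>p. y p * a p k) * x k)"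
proof -
  have prod: "(\<lambda>(k, p). cmod (y p * (a p k * x k))) summable_on (UNIV \<times> UNIV)"
    if y: "\<And>p. cmod (y p) \<le> Y" for y Y
  proof -
    have Y0: "Y \<ge> 0" using y[of undefined] norm_ge_zero order_trans by blast
    have s: "(\<lambda>p. cmod (y p * (a p k * x k))) summable_on UNIV" for k
    proof -
      have "cmod (x k * y p) \<le> cmod (x k) * Y" for p
        unfolding norm_mult by (rule mult_left_mono[OF y]) simp
      from ell_one_mult_bounded[where y="\<lambda>p. x k * y p", OF sum_bounded_ell_one[OF cols[of k]] this]
      show ?thesis by (simp add: ell_one_def norm_mult mult_ac)
    qed
    have "(\<lambda>z. norm (case z of (k, p) \<Rightarrow> y p * (a p k * x k))) summable_on (SIGMA k:UNIV. UNIV)"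
    proof (rule Infinite_Sum.abs_summable_on_Sigma_iff[THEN iffD2], intro conjI ballI)
      show "(\<lambda>p. norm (case (k, p) of (k, p) \<Rightarrow> y p * (a p k * x k))) summable_on UNIV" for k
        using s by simp
      have le: "(\<Sum>\<^sub>\<infinity>p. cmod (y p * (a p k * x k))) \<le> (Y * B) * cmod (x k)" for k
      proof -
        have "(\<Sum>\<^sub>\<infinity>p. cmod (y p * (a p k * x k))) \<le> (\<Sum>\<^sub>\<infinity>p. (Y * cmod (x k)) * cmod (a p k))"
        proof (rule infsum_mono[OF s])
          show "(\<lambda>p. (Y * cmod (x k)) * cmod (a p k)) summable_on UNIV"
            using sum_bounded_ell_one[OF cols] unfolding ell_one_def by (rule summable_on_cmult_right)
          show "cmod (y p * (a p k * x k)) \<le> (Y * cmod (x k)) * cmod (a p k)" for p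
            using mult_right_mono[OF y[of p], of "cmod (a p k) * cmod (x k)"] by (simp add: norm_mult mult_ac)
        qed
        also have "\<dots> = (Y * cmod (x k)) * (\<Sum>\<^sub>\<infinity>p. cmod (a p k))" by (rule infsum_cmult_right')
        also have "\<dots> \<le> (Y * cmod (x k)) * B"
          by (intro mult_left_mono sum_bounded_infsum cols) (use Y0 in auto)
        finally show ?thesis by (simp add: mult_ac)
      qed
      show "(\<lambda>k. norm (\<Sum>\<^sub>\<infinity>p. norm (case (k, p) of (k, p) \<Rightarrow> y p * (a p k * x k)))) summable_on UNIV"
      proof (rule summable_on_comparison_test)
        show "(\<lambda>k. (Y * B) * cmod (x k)) summable_on UNIV"
          using x unfolding ell_one_def by (rule summable_on_cmult_right)
      qed (use le in \<open>auto simp: infsum_nonneg\<close>)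
    qed
    then show ?thesis by (simp add: case_prod_unfold)
  qed
  have prod': "(\<lambda>(k, p). y p * (a p k * x k)) summable_on (UNIV \<times> UNIV)"
    by (rule abs_summable_summable, insert prod[of y Y, OF y]) (simp only: case_prod_unfold)
  then show "(\<lambda>(k, p). y p * (a p k * x k)) summable_on UNIV" by simp
  have cb: "cmod (a p k) \<le> B" for p k using sum_bounded_le[OF cols] .
  have row: "(\<lambda>k. a p k * x k) summable_on UNIV" for p
    by (rule ell_one_summable, rule ell_one_mult_bounded[OF x], rule cb)
  then show "\<And>p. (\<lambda>k. a p k * x k) summable_on UNIV" .
  have "(\<lambda>(p, k). cmod (a p k * x k)) summable_on (UNIV \<times> UNIV)"
    using prod[of "\<lambda>_. 1" 1] summable_on_swap[of "\<lambda>(k, p). cmod (a p k * x k)" UNIV UNIV]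
    by (simp only: case_prod_unfold mult_1_left norm_one order_refl fst_conv snd_conv)
  then have "(\<lambda>z. norm (case z of (p, k) \<Rightarrow> a p k * x k)) summable_on (SIGMA p:UNIV. UNIV)"
    by (simp only: case_prod_unfold)
  from Infinite_Sum.abs_summable_on_Sigma_iff[THEN iffD1, OF this]
  have n: "(\<lambda>p. \<Sum>\<^sub>\<infinity>k. cmod (a p k * x k)) summable_on UNIV"
    and nr: "\<And>p. (\<lambda>k. cmod (a p k * x k)) summable_on UNIV"
    by (auto simp: infsum_nonneg)
  show "ell_one (\<lambda>p. \<Sum>\<^sub>\<infinity>k. a p k * x k)"
    unfolding ell_one_def
    by (rule summable_on_comparison_test[OF n]) (auto intro: norm_infsum_bound[of "\<lambda>k. a _ k * x k", simplified] nr)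
  have "(\<Sum>\<^sub>\<infinity>p. y p * (\<Sum>\<^sub>\<infinity>k. a p k * x k)) = (\<Sum>\<^sub>\<infinity>p. \<Sum>\<^sub>\<infinity>k. y p * (a p k * x k))"
    by (simp add: infsum_cmult_right')
  also have "\<dots> = (\<Sum>\<^sub>\<infinity>k. \<Sum>\<^sub>\<infinity>p. y p * (a p k * x k))"
    by (rule infsum_swap_banach[symmetric]) (use prod' in \<open>simp add: case_prod_unfold\<close>)
  also have "\<dots> = (\<Sum>\<^sub>\<infinity>k. (\<Sum>\<^sub>\<infinity>p. y p * a p k) * x k)"
    by (simp add: infsum_cmult_left'[symmetric] mult.assoc)
  finally show "(\<Sum>\<^sub>\<infinity>p. y p * (\<Sum>\<^sub>\<infinity>k. a p k * x k)) = (\<Sum>\<^sub>\<infinity>k. (\<Sum>\<^sub>\<infinity>p. y p * a p k) * x k)" .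
qed

text \<open>
  For such a matrix \<open>A\<close>, \<open>synthesis\<close> is \<open>A\<close>, \<open>analysis\<close> is \<open>A\<^sup>*\<close> and
  \<open>gram c\<close> is \<open>c A A\<^sup>*\<close>.  All sums stay in \<open>\<ell>\<^sup>1\<close>, where the exchange of summations
  is unconditional.
\<close>

locale Schur_matrix =
  fixes a :: "'p \<Rightarrow> 'k \<Rightarrow> complex" and B :: real
  assumes cols: "\<And>k. sum_bounded B (\<lambda>p. a p k)" and rows: "\<And>p. sum_bounded B (a p)"
begin

definition analysis :: "('p \<Rightarrow> complex) \<Rightarrow> 'k \<Rightarrow> complex" where
  "analysis h k = (\<Sum>\<^sub>\<infinity>p. cnj (a p k) * h p)"

definition synthesis :: "('k \<Rightarrow> complex) \<Rightarrow> 'p \<Rightarrow> complex" where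
  "synthesis x p = (\<Sum>\<^sub>\<infinity>k. a p k * x k)"

lemma cnj_rows: "sum_bounded B (\<lambda>k. cnj (a p k))"
  using rows[of p] by (simp add: sum_bounded_def)

lemma cnj_cols: "sum_bounded B (\<lambda>p. cnj (a p k))"
  using cols[of k] by (simp add: sum_bounded_def)

lemma ell_one_synthesis: "ell_one x \<Longrightarrow> ell_one (synthesis x)"
  unfolding synthesis_def by (rule Schur_ell_one[where Y=0 and y="\<lambda>_. 0", OF cols]) simp_all

lemma ell_one_analysis: "ell_one h \<Longrightarrow> ell_one (analysis h)"
  unfolding analysis_def by (rule Schur_ell_one[where Y=0 and y="\<lambda>_. 0", OF cnj_rows]) simp_all

lemma analysis_summable: "ell_one h \<Longrightarrow> (\<lambda>p. cnj (a p k) * h p) summable_on UNIV"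
  by (rule Schur_row[where Y=0 and y="\<lambda>_. 0", OF cnj_rows]) simp_all

lemma synthesis_duality:
  assumes x: "ell_one x" and h: "ell_one h"
  shows "(\<Sum>\<^sub>\<infinity>p. cnj (h p) * synthesis x p) = (\<Sum>\<^sub>\<infinity>k. cnj (analysis h k) * x k)"
proof -
  have "(\<Sum>\<^sub>\<infinity>p. cnj (h p) * synthesis x p) = (\<Sum>\<^sub>\<infinity>k. (\<Sum>\<^sub>\<infinity>p. cnj (h p) * a p k) * x k)"
    unfolding synthesis_def
    by (rule Schur_duality[where Y="\<Sum>\<^sub>\<infinity>p. cmod (h p)", OF cols x]) (use ell_one_bounded[OF h] in simp)
  also have "(\<lambda>k. \<Sum>\<^sub>\<infinity>p. cnj (h p) * a p k) = (\<lambda>k. cnj (analysis h k))"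
    by (simp add: analysis_def infsum_cnj[symmetric] mult.commute del: infsum_cnj)
  finally show ?thesis .
qed

lemma analysis_diff:
  assumes "ell_one h" "ell_one h'"
  shows "analysis (\<lambda>p. h p - h' p) k = analysis h k - analysis h' k"
proof -
  have "(\<Sum>\<^sub>\<infinity>p. cnj (a p k) * h p + cnj (a p k) * (- h' p)) = analysis h k + (\<Sum>\<^sub>\<infinity>p. cnj (a p k) * (- h' p))"
    unfolding analysis_def
    by (rule infsum_add) (use analysis_summable assms in \<open>auto simp: summable_on_uminus\<close>)
  then show ?thesis by (simp add: analysis_def infsum_uminus right_diff_distrib)
qed

lemma synthesis_diff:
  assumes "ell_one x" "ell_one x'"
  shows "synthesis (\<lambda>k. x k - x' k) p = synthesis x p - synthesis x' p"
proof -
  have s: "(\<lambda>k. a p k * x k) summable_on UNIV" if "ell_one x" for x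
    by (rule Schur_row[where Y=0 and y="\<lambda>_. 0", OF cols that]) simp
  have "(\<Sum>\<^sub>\<infinity>k. a p k * x k + a p k * (- x' k)) = synthesis x p + (\<Sum>\<^sub>\<infinity>k. a p k * (- x' k))"
    unfolding synthesis_def
    by (rule infsum_add) (use s assms in \<open>auto simp: summable_on_uminus\<close>)
  then show ?thesis by (simp add: synthesis_def infsum_uminus right_diff_distrib)
qed

lemma infsum_norm_square_zero:
  fixes x :: "'b \<Rightarrow> complex"
  assumes "ell_one x" and "(\<Sum>\<^sub>\<infinity>k. cnj (x k) * x k) = 0"
  shows "x k = 0"
proof -
  have eq: "cnj (x k) * x k = of_real ((cmod (x k))\<^sup>2)" for k
    unfolding complex_norm_square by (rule mult.commute)
  have "ell_one (\<lambda>k. cnj (x k) * x k)"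
    by (rule ell_one_mult_bounded[OF assms(1)]) (use ell_one_bounded[OF assms(1)] in simp)
  then have s: "(\<lambda>k. (cmod (x k))\<^sup>2) summable_on UNIV"
    unfolding ell_one_def eq norm_of_real by simp
  have "(\<Sum>\<^sub>\<infinity>k. (cmod (x k))\<^sup>2) = 0"
    using assms(2) infsum_complex_of_real[of "\<lambda>k. (cmod (x k))\<^sup>2" UNIV] unfolding eq by simp
  then have "(cmod (x k))\<^sup>2 = 0"
    using nonneg_infsum_le_0D[OF _ s, of k] by simp
  then show ?thesis by simp
qed

text \<open>
  Let \<open>S = c A A\<^sup>*\<close>, let \<open>b\<close> be a column of \<open>A\<close> and \<open>u = S b - b\<close>.  From \<open>S u = 0\<close> one gets
  \<open>0 = \<langle>A A\<^sup>* u, u\<rangle> = \<langle>A\<^sup>* u, A\<^sup>* u\<rangle>\<close>, so \<open>A\<^sup>* u = 0\<close>.  Then \<open>u\<close> is orthogonal to the range of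
  \<open>A\<close>, which contains \<open>S b\<close> and \<open>b\<close>, hence to itself.
\<close>

lemma idempotent_fixes_columns:
  assumes c: "c \<noteq> 0"
    and idem: "\<And>p. synthesis (analysis (\<lambda>q. c * synthesis (analysis (\<lambda>p. a p k0)) q)) p
      = synthesis (analysis (\<lambda>p. a p k0)) p"
  shows "c * synthesis (analysis (\<lambda>p. a p k0)) p = a p k0"
proof -
  define b where "b p = a p k0" for p
  define Sb where "Sb p = c * synthesis (analysis b) p" for p
  \<comment> \<open>the defect of \<open>b\<close>, to be shown orthogonal to itself\<close>
  define u where "u p = Sb p - b p" for p
  have b: "ell_one b" unfolding b_def by (rule sum_bounded_ell_one[OF cols])
  have Sb: "ell_one Sb" unfolding Sb_def by (intro ell_one_cmult ell_one_synthesis ell_one_analysis b)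
  have u: "ell_one u" unfolding u_def by (rule ell_one_diff[OF Sb b])
  have "synthesis (analysis u) p = 0" for p
    unfolding u_def analysis_diff[OF Sb b] synthesis_diff[OF ell_one_analysis[OF Sb] ell_one_analysis[OF b]]
    using idem[of p] unfolding Sb_def[abs_def] b_def[abs_def] by simp
  then have "(\<Sum>\<^sub>\<infinity>k. cnj (analysis u k) * analysis u k) = 0"
    unfolding synthesis_duality[OF ell_one_analysis[OF u] u, symmetric] by simp
  then have Uu: "analysis u k = 0" for k
    by (rule infsum_norm_square_zero[OF ell_one_analysis[OF u]])
  have "(\<Sum>\<^sub>\<infinity>p. cnj (u p) * u p) = (\<Sum>\<^sub>\<infinity>p. c * (cnj (u p) * synthesis (analysis b) p) + - (cnj (u p) * b p))"
    by (intro infsum_cong) (simp add: u_def Sb_def algebra_simps)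
  also have "\<dots> = (\<Sum>\<^sub>\<infinity>p. c * (cnj (u p) * synthesis (analysis b) p)) + (\<Sum>\<^sub>\<infinity>p. - (cnj (u p) * b p))"
  proof (rule infsum_add)
    have ub: "cmod (cnj (u p)) \<le> (\<Sum>\<^sub>\<infinity>p. cmod (u p))" for p using ell_one_bounded[OF u] by simp
    show "(\<lambda>p. c * (cnj (u p) * synthesis (analysis b) p)) summable_on UNIV"
      by (intro summable_on_cmult_right ell_one_summable ell_one_mult_bounded[OF _ ub] ell_one_synthesis ell_one_analysis b)
    show "(\<lambda>p. - (cnj (u p) * b p)) summable_on UNIV"
      unfolding summable_on_uminus by (intro ell_one_summable ell_one_mult_bounded[OF _ ub] b)
  qed
  also have "(\<Sum>\<^sub>\<infinity>p. c * (cnj (u p) * synthesis (analysis b) p)) = 0"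
    unfolding infsum_cmult_right' synthesis_duality[OF ell_one_analysis[OF b] u] Uu by simp
  also have "(\<Sum>\<^sub>\<infinity>p. - (cnj (u p) * b p)) = - cnj (analysis u k0)"
    by (simp add: analysis_def infsum_uminus b_def infsum_cnj[symmetric] mult.commute del: infsum_cnj)
  finally have "(\<Sum>\<^sub>\<infinity>p. cnj (u p) * u p) = 0" using Uu by simp
  then have "u p = 0" by (rule infsum_norm_square_zero[OF u])
  then show ?thesis by (simp add: u_def Sb_def b_def[abs_def])
qed

definition gram :: "complex \<Rightarrow> 'p \<Rightarrow> 'p \<Rightarrow> complex" where
  "gram c p q = c * (\<Sum>\<^sub>\<infinity>k. a p k * cnj (a q k))"

lemma gram_apply:
  assumes h: "\<And>q. cmod (h q) \<le> H"
  shows "(\<Sum>\<^sub>\<infinity>q. gram c p q * h q) = c * synthesis (analysis h) p"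
proof -
  have "(\<Sum>\<^sub>\<infinity>q. gram c p q * h q) = (\<Sum>\<^sub>\<infinity>q. c * (h q * (\<Sum>\<^sub>\<infinity>k. cnj (a q k) * a p k)))"
    by (intro infsum_cong) (simp add: gram_def mult_ac)
  also have "\<dots> = c * (\<Sum>\<^sub>\<infinity>q. h q * (\<Sum>\<^sub>\<infinity>k. cnj (a q k) * a p k))" by (rule infsum_cmult_right')
  also have "(\<Sum>\<^sub>\<infinity>q. h q * (\<Sum>\<^sub>\<infinity>k. cnj (a q k) * a p k)) = (\<Sum>\<^sub>\<infinity>k. (\<Sum>\<^sub>\<infinity>q. h q * cnj (a q k)) * a p k)"
    by (rule Schur_duality[OF cnj_cols sum_bounded_ell_one[OF rows] h])
  also have "\<dots> = synthesis (analysis h) p"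
    unfolding synthesis_def analysis_def by (simp add: mult.commute)
  finally show ?thesis .
qed

lemma ell_one_gram: "ell_one (gram c p)"
proof -
  have "ell_one (\<lambda>q. \<Sum>\<^sub>\<infinity>k. cnj (a q k) * a p k)"
    by (rule Schur_ell_one[where Y=0 and y="\<lambda>_. 0", OF cnj_cols sum_bounded_ell_one[OF rows]]) simp
  from ell_one_cmult[OF this, of c] show ?thesis unfolding gram_def[abs_def]
    by (simp only: mult.commute[of "cnj _"])
qed

lemma gram_bound: "(\<Sum>\<^sub>\<infinity>q. cmod (gram c p q)) \<le> cmod c * (B * B)"
proof -
  have B0: "0 \<le> B" using sum_bounded_le[OF rows[of p]] norm_ge_zero order_trans by blast
  have rp: "ell_one (a p)" by (rule sum_bounded_ell_one[OF rows])
  have n: "cmod (gram c p q) \<le> cmod c * (\<Sum>\<^sub>\<infinity>k. cmod (a q k) * cmod (a p k))" for q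
  proof -
    have "cmod (\<Sum>\<^sub>\<infinity>k. a p k * cnj (a q k)) \<le> (\<Sum>\<^sub>\<infinity>k. cmod (a p k * cnj (a q k)))"
    proof (rule norm_infsum_bound)
      show "(\<lambda>k. cmod (a p k * cnj (a q k))) summable_on UNIV"
        using ell_one_mult_bounded[OF rp, of "\<lambda>k. cnj (a q k)" B] sum_bounded_le[OF cnj_rows]
        by (simp add: ell_one_def mult.commute)
    qed
    then show ?thesis by (simp add: gram_def norm_mult mult_left_mono mult.commute)
  qed
  have sb: "sum_bounded B (\<lambda>q. complex_of_real (cmod (a q k)))" for k
    using cols[of k] by (simp add: sum_bounded_def)
  have rp': "ell_one (\<lambda>k. complex_of_real (cmod (a p k)))" using rp by (simp add: ell_one_def)
  define w where "w q = (\<Sum>\<^sub>\<infinity>k. cmod (a q k) * cmod (a p k))" for q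
  have wc: "complex_of_real (w q) = (\<Sum>\<^sub>\<infinity>k. complex_of_real (cmod (a q k)) * complex_of_real (cmod (a p k)))" for q
    unfolding w_def of_real_mult[symmetric] by (rule infsum_complex_of_real[symmetric])
  have ew: "ell_one (\<lambda>q. complex_of_real (w q))"
    unfolding wc using Schur_ell_one[of B "\<lambda>q k. complex_of_real (cmod (a q k))" _ "\<lambda>_. 0" 0] sb rp' by simp
  have w0: "0 \<le> w q" for q unfolding w_def by (auto intro!: infsum_nonneg)
  have ws: "w summable_on UNIV" using ew w0 by (simp add: ell_one_def)
  have "(\<Sum>\<^sub>\<infinity>q. cmod (gram c p q)) \<le> (\<Sum>\<^sub>\<infinity>q. cmod c * w q)"
    by (rule infsum_mono) (use ell_one_gram n in \<open>auto simp: ell_one_def w_def intro: summable_on_cmult_right ws[unfolded w_def]\<close>)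
  also have "\<dots> = cmod c * (\<Sum>\<^sub>\<infinity>q. w q)" by (rule infsum_cmult_right')
  also have "(\<Sum>\<^sub>\<infinity>q. w q) \<le> B * B"
  proof -
    have "complex_of_real (\<Sum>\<^sub>\<infinity>q. w q) = (\<Sum>\<^sub>\<infinity>q. 1 * complex_of_real (w q))"
      by (simp add: infsum_complex_of_real)
    also have "\<dots> = (\<Sum>\<^sub>\<infinity>k. (\<Sum>\<^sub>\<infinity>q. 1 * complex_of_real (cmod (a q k))) * complex_of_real (cmod (a p k)))"
      unfolding wc by (rule Schur_duality[where Y=1, OF sb rp']) simp
    also have "\<dots> = complex_of_real (\<Sum>\<^sub>\<infinity>k. (\<Sum>\<^sub>\<infinity>q. cmod (a q k)) * cmod (a p k))"
      by (simp add: infsum_complex_of_real flip: of_real_mult)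
    finally have "(\<Sum>\<^sub>\<infinity>q. w q) = (\<Sum>\<^sub>\<infinity>k. (\<Sum>\<^sub>\<infinity>q. cmod (a q k)) * cmod (a p k))"
      by (simp only: of_real_eq_iff)
    also have "\<dots> \<le> (\<Sum>\<^sub>\<infinity>k. B * cmod (a p k))"
    proof (rule infsum_mono)
      have le: "(\<Sum>\<^sub>\<infinity>q. cmod (a q k)) * cmod (a p k) \<le> B * cmod (a p k)" for k
        by (intro mult_right_mono sum_bounded_infsum cols) auto
      then show "\<And>k. (\<Sum>\<^sub>\<infinity>q. cmod (a q k)) * cmod (a p k) \<le> B * cmod (a p k)" .
      show s: "(\<lambda>k. B * cmod (a p k)) summable_on UNIV"
        using rp unfolding ell_one_def by (rule summable_on_cmult_right)
      show "(\<lambda>k. (\<Sum>\<^sub>\<infinity>q. cmod (a q k)) * cmod (a p k)) summable_on UNIV"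
        by (rule summable_on_comparison_test[OF s]) (use le in \<open>auto intro!: mult_nonneg_nonneg infsum_nonneg\<close>)
    qed
    also have "\<dots> = B * (\<Sum>\<^sub>\<infinity>k. cmod (a p k))" by (rule infsum_cmult_right')
    also have "\<dots> \<le> B * B" by (intro mult_left_mono sum_bounded_infsum rows B0)
    finally show ?thesis .
  qed
  finally show ?thesis by (simp add: mult_left_mono)
qed

lemma gram_le: "cmod (gram c p q) \<le> cmod c * (B * B)"
  using ell_one_bounded[OF ell_one_gram] gram_bound order_trans by blast

text \<open>
  \<open>c A A\<^sup>* A = A\<close> implies \<open>(c A A\<^sup>*) (c A A\<^sup>*) = c A A\<^sup>*\<close>.
\<close>

lemma gram_idempotent:
  assumes cols_fixed: "\<And>p k0. c * synthesis (analysis (\<lambda>p. a p k0)) p = a p k0"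
  shows "(\<Sum>\<^sub>\<infinity>q. gram c p q * gram c q r) = gram c p r"
proof -
  have rr: "ell_one (\<lambda>k. cnj (a r k))" by (rule sum_bounded_ell_one[OF cnj_rows])
  have "(\<Sum>\<^sub>\<infinity>q. gram c p q * gram c q r) = (\<Sum>\<^sub>\<infinity>q. c * (gram c p q * (\<Sum>\<^sub>\<infinity>k. a q k * cnj (a r k))))"
    by (intro infsum_cong) (simp add: gram_def[of c _ r])
  also have "\<dots> = c * (\<Sum>\<^sub>\<infinity>q. gram c p q * (\<Sum>\<^sub>\<infinity>k. a q k * cnj (a r k)))" by (rule infsum_cmult_right')
  also have "(\<Sum>\<^sub>\<infinity>q. gram c p q * (\<Sum>\<^sub>\<infinity>k. a q k * cnj (a r k))) = (\<Sum>\<^sub>\<infinity>k. (\<Sum>\<^sub>\<infinity>q. gram c p q * a q k) * cnj (a r k))"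
    by (rule Schur_duality[OF cols rr gram_le])
  also have "\<dots> = (\<Sum>\<^sub>\<infinity>k. a p k * cnj (a r k))"
    using gram_apply[of "\<lambda>q. a q _" B c p] sum_bounded_le[OF cols] cols_fixed by simp
  finally show ?thesis by (simp add: gram_def)
qed

end

section \<open>The kernel of the operators on the real line\<close>

lemma wiener_dominated:
  assumes "wiener f" "c > 0"
  shows "\<exists>v. v summable_on UNIV \<and> (\<forall>t (k::int). \<bar>t\<bar> \<le> R \<longrightarrow> cmod (f (t + c * of_int k)) \<le> v k)"
proof -
  obtain \<Phi> r where \<Phi>: "integrable lborel \<Phi>" "\<And>x. 0 \<le> \<Phi> x" "0 < r" "\<And>t. cmod (f t) \<le> window \<Phi> r t"
    using assms unfolding wiener_def by blast
  define v where "v k = window \<Phi> (r + \<bar>R\<bar>) (0 + c * of_int k)" for k :: int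
  have "v summable_on UNIV"
  proof (rule nonneg_bounded_partial_sums_imp_summable_on)
    show "\<forall>\<^sub>F F in finite_subsets_at_top UNIV. sum v F \<le> (2 * (r + \<bar>R\<bar>) / c + 1) * (LINT x|lborel. \<Phi> x)"
      unfolding v_def
      by (intro eventually_finite_subsets_at_top_weakI window_sum_le) (use \<Phi> assms in auto)
    show "0 \<le> v k" for k unfolding v_def by (rule window_nonneg) (rule \<Phi>)
  qed
  moreover have "cmod (f (t + c * of_int k)) \<le> v k" if "\<bar>t\<bar> \<le> R" for t and k :: int
    unfolding v_def
    by (rule order_trans[OF \<Phi>(4)], rule window_mono) (use \<Phi> that in auto)
  ultimately show ?thesis by blast
qed

lemma S0_cont: "f \<in> S0 \<Longrightarrow> continuous_on UNIV f"
  by (simp add: S0_def)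

lemma S0_row_summable:
  assumes "f \<in> S0" "h \<in> S0" "c2 > 0"
  shows "(\<lambda>m::int. cmod (L2_inner lborel f (tf_shift (x, c2 * of_int m) h))) summable_on UNIV"
proof -
  obtain B where B: "\<And>w1 w2 F. finite (F :: (int \<times> int) set) \<Longrightarrow>
     (\<Sum>(m, n)\<in>F. cmod (L2_inner lborel f (tf_shift (w1 + 1 * of_int m, w2 + c2 * of_int n) h))) \<le> B"
    using S0_lattice_bounded[OF assms(1,2) zero_less_one assms(3)] unfolding lattice_bounded_def by blast
  show ?thesis
  proof (rule nonneg_bounded_partial_sums_imp_summable_on)
    show "\<forall>\<^sub>F F in finite_subsets_at_top UNIV. (\<Sum>m\<in>F. cmod (L2_inner lborel f (tf_shift (x, c2 * of_int m) h))) \<le> B"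
    proof (rule eventually_finite_subsets_at_top_weakI)
      fix F :: "int set" assume "finite F"
      then show "(\<Sum>m\<in>F. cmod (L2_inner lborel f (tf_shift (x, c2 * of_int m) h))) \<le> B"
        using B[of "{0} \<times> F" x 0] by (simp add: sum.cartesian_product[symmetric])
    qed
  qed auto
qed

text \<open>
  Poisson summation for \<open>s \<mapsto> f s cnj (h (s - x))\<close>, whose Fourier transform at \<open>\<omega>\<close> is
  \<open>\<langle>f, \<pi>(x, \<omega>) h\<rangle>\<close>.
\<close>

lemma Fourier_series_of_overlap:
  assumes f: "f \<in> S0" and h: "h \<in> S0" and c2: "c2 > 0"
  shows "(\<Sum>\<^sub>\<infinity>m::int. L2_inner lborel f (tf_shift (x, c2 * of_int m) h) * cis (2 * pi * (c2 * of_int m) * t))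
    = of_real (1 / c2) * (\<Sum>\<^sub>\<infinity>k::int. f (t + (1 / c2) * of_int k) * cnj (h (t + (1 / c2) * of_int k - x)))"
proof -
  define p where "p = 1 / c2"
  have p: "p > 0" using c2 by (simp add: p_def)
  define \<phi> where "\<phi> s = f s * cnj (h (s - x))" for s
  have ft: "fourier \<phi> (of_int m / p) = L2_inner lborel f (tf_shift (x, c2 * of_int m) h)" for m :: int
    by (simp add: L2_inner_tf_shift_eq_fourier \<phi>_def[abs_def] p_def mult.commute)
  obtain Bh where Bh: "\<And>t. cmod (h t) \<le> Bh" using wiener_bounded[OF S0_wiener[OF h]] by blast
  have "(\<Sum>\<^sub>\<infinity>k::int. \<phi> (t + p * of_int k))
    = of_real (1 / p) * (\<Sum>\<^sub>\<infinity>m::int. fourier \<phi> (of_int m / p) * cis (2 * pi * (of_int m / p) * t))"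
  proof (rule Poisson_summation[OF p])
    show "continuous_on UNIV \<phi>"
      unfolding \<phi>_def by (intro continuous_intros continuous_on_compose2[OF S0_cont[OF h]] S0_cont f) auto
    show "integrable lborel \<phi>"
      unfolding \<phi>_def using f h by (intro L2_mult_integrable L2_translate) (auto simp: S0_def)
    show "(\<lambda>m::int. fourier \<phi> (of_int m / p)) summable_on UNIV"
      unfolding ft by (rule abs_summable_summable[OF S0_row_summable[OF f h c2]])
    fix R
    obtain v where v: "v summable_on UNIV" "\<And>t (k::int). \<bar>t\<bar> \<le> R \<Longrightarrow> cmod (f (t + p * of_int k)) \<le> v k"
      using wiener_dominated[OF S0_wiener[OF f] p, of R] by blast
    show "\<exists>v. v summable_on UNIV \<and> (\<forall>t (k::int). \<bar>t\<bar> \<le> R \<longrightarrow> cmod (\<phi> (t + p * of_int k)) \<le> v k)"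
    proof (intro exI[of _ "\<lambda>k. v k * Bh"] conjI allI impI)
      show "(\<lambda>k. v k * Bh) summable_on UNIV" by (rule summable_on_cmult_left[OF v(1)])
      fix t :: real and k :: int assume "\<bar>t\<bar> \<le> R"
      from v(2)[OF this, of k] show "cmod (\<phi> (t + p * of_int k)) \<le> v k * Bh"
        unfolding \<phi>_def norm_mult complex_mod_cnj
        by (intro mult_mono Bh) (auto intro: order_trans[OF norm_ge_zero])
    qed
  qed
  then show ?thesis unfolding ft
    using p c2 by (simp add: p_def \<phi>_def field_simps)
qed

lemma countable_multiples: "countable (multiples c)"
  by (simp add: multiples_def)

lemma L2_tf_shift: assumes "h \<in> L2 lborel" shows "tf_shift z h \<in> L2 lborel"
proof -
  have [measurable]: "h \<in> borel_measurable borel" using assms by (simp add: L2_def)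
  have "tf_shift z h \<in> borel_measurable lborel" by simp
  then show ?thesis using L2_translate[OF assms, of "fst z"]
    by (simp add: L2_def tf_shift_eq' norm_mult)
qed

lemma L2_norm_tf_shift: "L2_norm lborel (tf_shift z h) = L2_norm lborel h"
  using lborel_integral_real_affine[of 1 "\<lambda>t. (cmod (h t))\<^sup>2" "- fst z"]
  by (simp add: L2_norm_def tf_shift_eq' norm_mult)

lemma contractions_lborel: "contractions lborel tf_shift (lattice_R \<theta>)"
  by standard (auto simp: lattice_R_def countable_multiples L2_tf_shift L2_norm_tf_shift)

lemma AE_lborel_shift:
  fixes Q :: "real \<Rightarrow> bool"
  assumes "AE t in lborel. Q t"
  shows "AE t in lborel. \<forall>l::int. Q (t - of_int l)"
proof -
  obtain N where N: "{t \<in> space lborel. \<not> Q t} \<subseteq> N" "emeasure lborel N = 0" "N \<in> sets lborel"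
    using assms by (rule AE_E)
  have [measurable]: "N \<in> sets borel" using N by simp
  have "AE t in lborel. t \<notin> N" using N by (intro AE_not_in) (auto simp: null_sets_def)
  then have "AE t in lborel. - of_int l + 1 * t \<notin> N" for l :: int
    using AE_borel_affine[of 1 "\<lambda>t. t \<notin> N" "- of_int l"] by simp
  then have "AE t in lborel. \<forall>l::int. - of_int l + 1 * t \<notin> N" by (subst AE_all_countable) auto
  then show ?thesis
  proof eventually_elim
    case (elim t)
    show ?case
    proof
      fix l :: int
      have "t - of_int l \<notin> N" using elim[rule_format, of l] by simp
      then show "Q (t - of_int l)" using N(1) by auto
    qed
  qed
qed

lemma continuous_AE_eq:
  fixes f h :: "real \<Rightarrow> complex"
  assumes "continuous_on UNIV f" "continuous_on UNIV h" "AE t in lborel. f t = h t"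
  shows "f t = h t"
proof (rule ccontr)
  assume "f t \<noteq> h t"
  have "open {t. f t \<noteq> h t}" by (rule open_Collect_neq[OF assms(1,2)])
  moreover have "t \<in> {t. f t \<noteq> h t}" using \<open>f t \<noteq> h t\<close> by simp
  ultimately obtain e where e: "e > 0" "\<And>s. dist s t < e \<Longrightarrow> f s \<noteq> h s"
    unfolding open_dist by blast
  have "AE s in lborel. s \<notin> {t - e<..<t + e}"
    using assms(3) by (rule eventually_mono) (use e in \<open>auto simp: dist_real_def\<close>)
  then have "emeasure lborel {t - e<..<t + e} = 0"
    by (subst (asm) AE_iff_measurable[of "{t - e<..<t + e}"]) auto
  then show False using e by simp
qed

lemma has_sum_finite_sum:
  fixes f :: "'i \<Rightarrow> 'a \<Rightarrow> real"
  assumes "\<And>i. i \<in> I \<Longrightarrow> (f i has_sum S i) A"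
  shows "((\<lambda>x. \<Sum>i\<in>I. f i x) has_sum (\<Sum>i\<in>I. S i)) A"
  using assms by (induction I rule: infinite_finite_induct) (auto intro: has_sum_add)

locale S0_tuple =
  fixes g :: "'n::finite \<Rightarrow> real \<Rightarrow> complex" and \<theta> :: real
  assumes \<theta>_pos: "\<theta> > 0" and g_S0: "\<And>j. g j \<in> S0"
begin

definition step :: real where "step = 1 / \<theta>"

lemma step_pos: "step > 0" using \<theta>_pos by (simp add: step_def)

text \<open>
  The kernel \<open>\<kappa>\<close> of the introduction.
\<close>

definition kern :: "'n \<Rightarrow> 'n \<Rightarrow> real \<Rightarrow> real \<Rightarrow> complex" where
  "kern j i t s = of_real step * (\<Sum>\<^sub>\<infinity>k::int. g j (t + step * of_int k) * cnj (g i (s + step * of_int k)))"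

text \<open>
  The matrix of the coset \<open>t + \<int>\<close>: the row \<open>(i, n)\<close> stands for the component \<open>i\<close> at the
  point \<open>t - n\<close>, and \<open>kern\<close> is its Gram matrix.
\<close>

definition entry :: "real \<Rightarrow> 'n \<times> int \<Rightarrow> int \<Rightarrow> complex" where
  "entry t p k = g (fst p) (t - of_int (snd p) + step * of_int k)"

lemma ex_bound: "\<exists>B. \<forall>t. Schur_matrix (entry t) B"
proof -
  have "\<forall>i. \<exists>B. \<forall>t F. finite F \<longrightarrow> (\<Sum>k\<in>F. cmod (g i (t + step * of_int k))) \<le> B"
    using wiener_lattice_sum[OF S0_wiener[OF g_S0] step_pos] by metis
  then obtain B1 where B1: "\<And>i t F. finite F \<Longrightarrow> (\<Sum>k\<in>F. cmod (g i (t + step * of_int k))) \<le> B1 i" by metis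
  have "\<forall>i. \<exists>B. \<forall>t F. finite F \<longrightarrow> (\<Sum>k\<in>F. cmod (g i (t + 1 * of_int k))) \<le> B"
    using wiener_lattice_sum[OF S0_wiener[OF g_S0] zero_less_one] by metis
  then obtain B2 where B2: "\<And>i t F. finite F \<Longrightarrow> (\<Sum>k\<in>F. cmod (g i (t + 1 * of_int k))) \<le> B2 i" by metis
  have nn: "0 \<le> B1 i" "0 \<le> B2 i" for i using B1[of "{}" i] B2[of "{}" i] by simp_all
  have "Schur_matrix (entry t) (sum B1 UNIV + sum B2 UNIV)" for t
  proof
    fix k
    show "sum_bounded (sum B1 UNIV + sum B2 UNIV) (\<lambda>p. entry t p k)"
      unfolding sum_bounded_def
    proof (intro allI impI)
      fix F :: "('n \<times> int) set" assume F: "finite F"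
      define F2 where "F2 = snd ` F"
      have F2: "finite F2" "F \<subseteq> UNIV \<times> F2" using F by (force simp: F2_def)+
      have "(\<Sum>p\<in>F. cmod (entry t p k)) \<le> (\<Sum>p\<in>UNIV \<times> F2. cmod (entry t p k))"
        using F2 by (intro sum_mono2) auto
      also have "\<dots> = (\<Sum>i\<in>UNIV. \<Sum>n\<in>F2. cmod (g i (t - of_int n + step * of_int k)))"
        by (simp add: sum.cartesian_product case_prod_unfold entry_def)
      also have "\<dots> \<le> sum B2 UNIV"
      proof (rule sum_mono)
        fix i
        have "(\<Sum>n\<in>F2. cmod (g i (t - of_int n + step * of_int k)))
            = (\<Sum>n\<in>uminus ` F2. cmod (g i ((t + step * of_int k) + 1 * of_int n)))"
          by (subst sum.reindex) (auto simp: inj_on_def algebra_simps)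
        also have "\<dots> \<le> B2 i" by (rule B2) (use F2 in auto)
        finally show "(\<Sum>n\<in>F2. cmod (g i (t - of_int n + step * of_int k))) \<le> B2 i" .
      qed
      also have "\<dots> \<le> sum B1 UNIV + sum B2 UNIV" using nn by (simp add: sum_nonneg)
      finally show "(\<Sum>p\<in>F. cmod (entry t p k)) \<le> sum B1 UNIV + sum B2 UNIV" .
    qed
  next
    fix p
    show "sum_bounded (sum B1 UNIV + sum B2 UNIV) (entry t p)"
      unfolding sum_bounded_def entry_def
    proof (intro allI impI)
      fix F :: "int set" assume F: "finite F"
      have "(\<Sum>k\<in>F. cmod (g (fst p) (t - of_int (snd p) + step * of_int k))) \<le> B1 (fst p)" by (rule B1[OF F])
      also have "\<dots> \<le> sum B1 UNIV" by (rule member_le_sum) (use nn in auto)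
      also have "\<dots> \<le> sum B1 UNIV + sum B2 UNIV" using nn by (simp add: sum_nonneg)
      finally show "(\<Sum>k\<in>F. cmod (g (fst p) (t - of_int (snd p) + step * of_int k))) \<le> sum B1 UNIV + sum B2 UNIV" .
    qed
  qed
  then show ?thesis by blast
qed

text \<open>
  A bound for the row and column sums that is uniform in \<open>t\<close>.
\<close>

definition bound :: real where "bound = (SOME B. \<forall>t. Schur_matrix (entry t) B)"

lemma Schur_entry: "Schur_matrix (entry t) bound"
  using someI_ex[OF ex_bound] unfolding bound_def by blast

sublocale fiber: Schur_matrix "entry t" bound for t
  by (rule Schur_entry)

lemma gram_eq_kern: "fiber.gram t (of_real step) (j, l) (i, n) = kern j i (t - of_int l) (t - of_int n)"
  by (simp add: fiber.gram_def kern_def entry_def)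

lemma gram_action:
  assumes h: "\<And>q. cmod (h q) \<le> H"
  shows "(\<Sum>i\<in>UNIV. \<Sum>\<^sub>\<infinity>n::int. kern j i (t - of_int l) (t - of_int n) * h (i, n))
    = of_real step * fiber.synthesis t (fiber.analysis t h) (j, l)"
proof -
  have s: "(\<lambda>q. fiber.gram t (of_real step) (j, l) q * h q) summable_on UNIV"
  proof -
    have "ell_one (\<lambda>q. h q * fiber.gram t (of_real step) (j, l) q)"
      by (rule ell_one_mult_bounded[OF fiber.ell_one_gram h])
    then show ?thesis by (simp add: ell_one_summable mult.commute)
  qed
  have "(\<Sum>\<^sub>\<infinity>q. fiber.gram t (of_real step) (j, l) q * h q)
      = (\<Sum>\<^sub>\<infinity>i. \<Sum>\<^sub>\<infinity>n. fiber.gram t (of_real step) (j, l) (i, n) * h (i, n))"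
    using infsum_Sigma_banach[of "\<lambda>q. fiber.gram t (of_real step) (j, l) q * h q" UNIV "\<lambda>_. UNIV"] s by simp
  then show ?thesis by (simp add: gram_eq_kern fiber.gram_apply[OF h])
qed

text \<open>
  For fixed \<open>n\<close>, the sum over the modulations \<open>\<theta> m\<close> is the Fourier series of the
  \<open>1 / \<theta>\<close>-periodic function \<open>t \<mapsto> kern j i t (t - n)\<close>.
\<close>

lemma alg_inner_kernel:
  assumes h: "h \<in> L2 lborel"
  shows "AE t in lborel. alg_inner lborel tf_shift (lattice_R \<theta>) (g j) (g i) h t
    = (\<Sum>\<^sub>\<infinity>n::int. kern j i t (t - of_int n) * h (t - of_int n))"
proof -
  interpret contractions lborel tf_shift "lattice_R \<theta>" by (rule contractions_lborel)
  define C where "C z = L2_inner lborel (g j) (tf_shift z (g i))" for z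
  have c: "(\<lambda>z. cmod (C z)) summable_on lattice_R \<theta>"
    unfolding C_def lattice_R_def by (rule S0_summable_ambiguity) (use g_S0 \<theta>_pos in auto)
  have bij: "bij_betw (\<lambda>(n, m). (1 * of_int n, \<theta> * of_int m)) (UNIV :: (int \<times> int) set) (lattice_R \<theta>)"
    unfolding lattice_R_def
    using bij_betw_map_prod[OF bij_betw_multiples[of 1] bij_betw_multiples[of \<theta>]] \<theta>_pos
    by (simp add: map_prod_def)
  have k: "(\<Sum>\<^sub>\<infinity>m::int. C (1 * of_int n, \<theta> * of_int m) * tf_shift (1 * of_int n, \<theta> * of_int m) h t)
      = kern j i t (t - of_int n) * h (t - of_int n)" for n :: int and t
  proof -
    have "(\<Sum>\<^sub>\<infinity>m::int. C (1 * of_int n, \<theta> * of_int m) * tf_shift (1 * of_int n, \<theta> * of_int m) h t)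
        = (\<Sum>\<^sub>\<infinity>m::int. (L2_inner lborel (g j) (tf_shift (of_int n, \<theta> * of_int m) (g i)) * cis (2 * pi * (\<theta> * of_int m) * t)) * h (t - of_int n))"
      by (intro infsum_cong) (simp add: C_def tf_shift_eq)
    also have "\<dots> = (\<Sum>\<^sub>\<infinity>m::int. L2_inner lborel (g j) (tf_shift (of_int n, \<theta> * of_int m) (g i)) * cis (2 * pi * (\<theta> * of_int m) * t)) * h (t - of_int n)"
      by (rule infsum_cmult_left')
    also have "(\<Sum>\<^sub>\<infinity>m::int. L2_inner lborel (g j) (tf_shift (of_int n, \<theta> * of_int m) (g i)) * cis (2 * pi * (\<theta> * of_int m) * t))
        = kern j i t (t - of_int n)"
      unfolding Fourier_series_of_overlap[OF g_S0 g_S0 \<theta>_pos] kern_def step_def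
      by (simp add: algebra_simps)
    finally show ?thesis .
  qed
  have "AE t in lborel. (\<lambda>z. C z * tf_shift z h t) summable_on lattice_R \<theta>"
    by (rule AE_summable_op_series[OF c h subset_refl])
  moreover have "AE t in lborel. alg_inner lborel tf_shift (lattice_R \<theta>) (g j) (g i) h t
      = (\<Sum>\<^sub>\<infinity>z\<in>lattice_R \<theta>. C z * tf_shift z h t)"
    using alg_inner_op_series(2)[OF _ h] c unfolding C_def by blast
  ultimately show ?thesis
  proof eventually_elim
    case (elim t)
    define G where "G = (\<lambda>(n, m). C (1 * of_int n, \<theta> * of_int m) * tf_shift (1 * of_int n, \<theta> * of_int m) h t)"
    have s: "G summable_on (UNIV :: (int \<times> int) set)"
      using summable_on_reindex_bij_betw[OF bij, of "\<lambda>z. C z * tf_shift z h t"] elim(1)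
      by (simp add: G_def case_prod_unfold)
    have "(\<Sum>\<^sub>\<infinity>z\<in>lattice_R \<theta>. C z * tf_shift z h t) = (\<Sum>\<^sub>\<infinity>z. G z)"
      using infsum_reindex_bij_betw[OF bij, of "\<lambda>z. C z * tf_shift z h t"]
      by (simp add: G_def case_prod_unfold)
    also have "\<dots> = (\<Sum>\<^sub>\<infinity>n. \<Sum>\<^sub>\<infinity>m. G (n, m))"
      using infsum_Sigma_banach[of G UNIV "\<lambda>_. UNIV"] s by simp
    also have "\<dots> = (\<Sum>\<^sub>\<infinity>n::int. kern j i t (t - of_int n) * h (t - of_int n))"
      unfolding G_def prod.case k ..
    finally show ?case using elim(2) by simp
  qed
qed

lemma mat_apply_kernel:
  assumes h: "h \<in> L2_tuples lborel"
  shows "AE t in lborel. \<forall>j. mat_apply (alg_gram lborel tf_shift (lattice_R \<theta>) g g) h j t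
    = (\<Sum>i\<in>UNIV. \<Sum>\<^sub>\<infinity>n::int. kern j i t (t - of_int n) * h i (t - of_int n))"
proof -
  have "AE t in lborel. \<forall>j\<in>UNIV. \<forall>i\<in>UNIV. alg_inner lborel tf_shift (lattice_R \<theta>) (g j) (g i) (h i) t
    = (\<Sum>\<^sub>\<infinity>n::int. kern j i t (t - of_int n) * h i (t - of_int n))"
    using h by (intro AE_finite_allI finite alg_inner_kernel) (simp add: L2_tuples_def)
  then show ?thesis by eventually_elim (simp add: mat_apply_def alg_gram_def)
qed

text \<open>
  The tuple \<open>g\<close> itself is square integrable, and its values on the coset \<open>t + \<int>\<close> form the
  column 0 of the matrix \<open>entry t\<close>.  So \<open>P (P g) = P g\<close> is the hypothesis of
  \<open>idempotent_fixes_columns\<close> for almost every coset.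
\<close>

lemma AE_column_fixed:
  assumes P: "is_projection_in lborel (tf_algebra lborel tf_shift (lattice_R \<theta>))
           (alg_gram lborel tf_shift (lattice_R \<theta>) g g)"
  shows "AE t in lborel. \<forall>j. of_real step * fiber.synthesis t (fiber.analysis t (\<lambda>p. entry t p 0)) (j, 0) = g j t"
proof -
  define P where "P = alg_gram lborel tf_shift (lattice_R \<theta>) g g"
  define Q1 where "Q1 = mat_apply P g"
  have g: "g \<in> L2_tuples lborel" using g_S0 by (auto simp: L2_tuples_def S0_def)
  have Q1: "Q1 \<in> L2_tuples lborel"
    unfolding Q1_def by (rule mat_apply_L2[OF _ g]) (use P in \<open>auto simp: is_projection_in_def P_def\<close>)
  have "AE t in lborel. \<forall>j\<in>UNIV. mat_apply P Q1 j t = Q1 j t"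
    using P g unfolding is_projection_in_def P_def Q1_def by (intro AE_finite_allI finite) blast
  with mat_apply_kernel[OF g] mat_apply_kernel[OF Q1]
  have "AE t in lborel. (\<forall>j. Q1 j t = (\<Sum>i\<in>UNIV. \<Sum>\<^sub>\<infinity>n::int. kern j i t (t - of_int n) * g i (t - of_int n))) \<and>
      (\<forall>j. Q1 j t = (\<Sum>i\<in>UNIV. \<Sum>\<^sub>\<infinity>n::int. kern j i t (t - of_int n) * Q1 i (t - of_int n)))"
    by eventually_elim (auto simp: Q1_def P_def)
  from AE_lborel_shift[OF this] show ?thesis
  proof eventually_elim
    case (elim t)
    define b where "b p = entry t p 0" for p
    have shift: "(\<Sum>\<^sub>\<infinity>n::int. kern j i (t - of_int l) (t - of_int l - of_int n) * h (t - of_int l - of_int n))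
        = (\<Sum>\<^sub>\<infinity>n::int. kern j i (t - of_int l) (t - of_int n) * h (t - of_int n))" for h :: "real \<Rightarrow> complex" and j i l
    proof -
      have "bij_betw (\<lambda>n::int. l + n) UNIV UNIV"
        by (rule bij_betw_byWitness[where f'="\<lambda>n. n - l"]) auto
      from infsum_reindex_bij_betw[OF this, of "\<lambda>n. kern j i (t - of_int l) (t - of_int n) * h (t - of_int n)"]
      show ?thesis by (simp add: diff_diff_eq)
    qed
    have b: "cmod (b p) \<le> bound" for p unfolding b_def by (rule sum_bounded_le[OF fiber.cols])
    have Q1b: "Q1 j (t - of_int l) = of_real step * fiber.synthesis t (fiber.analysis t b) (j, l)" for j and l :: int
      using elim gram_action[of b bound j t l, OF b] unfolding shift by (simp add: b_def entry_def)
    define Sb where "Sb p = of_real step * fiber.synthesis t (fiber.analysis t b) p" for p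
    have Sb: "ell_one Sb" unfolding Sb_def b_def
      by (intro ell_one_cmult fiber.ell_one_synthesis fiber.ell_one_analysis sum_bounded_ell_one[OF fiber.cols])
    have Q1Sb: "Q1 i (t - of_int n) = Sb (i, n)" for i and n :: int by (simp add: Q1b Sb_def)
    have "Q1 j (t - of_int l) = of_real step * fiber.synthesis t (fiber.analysis t Sb) (j, l)" for j and l :: int
    proof -
      have "Q1 j (t - of_int l)
          = (\<Sum>i\<in>UNIV. \<Sum>\<^sub>\<infinity>n::int. kern j i (t - of_int l) (t - of_int n) * Q1 i (t - of_int n))"
        using elim unfolding shift by blast
      also have "\<dots> = of_real step * fiber.synthesis t (fiber.analysis t Sb) (j, l)"
        unfolding Q1Sb by (rule gram_action[OF ell_one_bounded[OF Sb]])
      finally show ?thesis .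
    qed
    then have "fiber.synthesis t (fiber.analysis t Sb) p = fiber.synthesis t (fiber.analysis t b) p" for p
      using Q1b step_pos by (cases p) simp
    then have "of_real step * fiber.synthesis t (fiber.analysis t b) p = b p" for p
      using fiber.idempotent_fixes_columns[of "of_real step" t 0 p] step_pos unfolding Sb_def b_def by simp
    then show ?case by (simp add: b_def[abs_def] entry_def)
  qed
qed

text \<open>
  Both sides are continuous in \<open>t\<close>: the double series on the left is dominated, locally uniformly,
  by a product of two summable families.
\<close>

lemma column_fixed_at_zero:
  assumes P: "is_projection_in lborel (tf_algebra lborel tf_shift (lattice_R \<theta>))
           (alg_gram lborel tf_shift (lattice_R \<theta>) g g)"
  shows "of_real step * fiber.synthesis t (fiber.analysis t (\<lambda>p. entry t p 0)) (j, 0) = g j t"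
proof (rule continuous_AE_eq)
  show "continuous_on UNIV (g j)" by (rule S0_cont[OF g_S0])
  show "AE t in lborel. of_real step * fiber.synthesis t (fiber.analysis t (\<lambda>p. entry t p 0)) (j, 0) = g j t"
    using AE_column_fixed[OF P] by eventually_elim simp
  define T where "T = (\<lambda>(k, q) t. entry t (j, 0) k * (cnj (entry t q k) * entry t q 0))"
  have dom: "\<exists>v. v summable_on UNIV \<and> (\<forall>t z. \<bar>t\<bar> \<le> R \<longrightarrow> z \<in> UNIV \<longrightarrow> cmod (T z t) \<le> v z)" for R
  proof -
    obtain v where v: "v summable_on UNIV" "\<And>t (k::int). \<bar>t\<bar> \<le> R \<Longrightarrow> cmod (g j (t + step * of_int k)) \<le> v k"
      using wiener_dominated[OF S0_wiener[OF g_S0] step_pos, of R j] by blast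
    have "\<forall>i. \<exists>w. w summable_on UNIV \<and> (\<forall>t (k::int). \<bar>t\<bar> \<le> R \<longrightarrow> cmod (g i (t + 1 * of_int k)) \<le> w k)"
      using wiener_dominated[OF S0_wiener[OF g_S0] zero_less_one, of R] by blast
    then obtain w where w: "\<And>i. w i summable_on UNIV"
        "\<And>i t (k::int). \<bar>t\<bar> \<le> R \<Longrightarrow> cmod (g i (t + 1 * of_int k)) \<le> w i k" by metis
    \<comment> \<open>positive parts, so that the majorants can be multiplied; \<open>w\<close> is reflected because the row
      \<open>(i, n)\<close> sits at \<open>t - n\<close>\<close>
    define V where "V k = max 0 (v k)" for k
    define W where "W q = max 0 (w (fst q) (- snd q))" for q :: "'n \<times> int"
    have V: "(\<lambda>k. norm (V k)) summable_on UNIV"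
    proof -
      have "(\<lambda>k. norm (v k)) summable_on UNIV"
        using v(1) by (rule summable_on_iff_abs_summable_on_real[THEN iffD1])
      then show ?thesis by (rule summable_on_comparison_test) (auto simp: V_def)
    qed
    have wm: "(\<lambda>n. max 0 (w i (- n))) summable_on UNIV" for i
    proof -
      have "(\<lambda>k. norm (w i k)) summable_on UNIV"
        using w(1) by (rule summable_on_iff_abs_summable_on_real[THEN iffD1])
      then have "(\<lambda>k. norm (w i (- k))) summable_on UNIV"
        by (subst summable_on_reindex_bij_betw[of uminus UNIV UNIV "\<lambda>k. norm (w i k)"])
          (auto intro: bij_betw_byWitness[where f'=uminus])
      then show ?thesis by (rule summable_on_comparison_test) auto
    qed
    have W: "(\<lambda>q. norm (W q)) summable_on UNIV"
    proof -
      have "(\<lambda>q. norm (W q)) summable_on (SIGMA i:UNIV. UNIV)"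
      proof (rule Infinite_Sum.abs_summable_on_Sigma_iff[THEN iffD2], intro conjI ballI)
        show "(\<lambda>n. norm (W (i, n))) summable_on UNIV" for i
          using wm[of i] by (simp add: W_def)
      qed simp
      then show ?thesis by simp
    qed
    have "(\<lambda>z. norm (case z of (k, q) \<Rightarrow> V k * (bound * W q))) summable_on (SIGMA k:UNIV. UNIV)"
    proof (rule Infinite_Sum.abs_summable_on_Sigma_iff[THEN iffD2], intro conjI ballI)
      show "(\<lambda>q. norm (case (k, q) of (k, q) \<Rightarrow> V k * (bound * W q))) summable_on UNIV" for k
        unfolding prod.case norm_mult by (intro summable_on_cmult_right W)
      show "(\<lambda>k. norm (\<Sum>\<^sub>\<infinity>q. norm (case (k, q) of (k, q) \<Rightarrow> V k * (bound * W q)))) summable_on UNIV"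
        using summable_on_cmult_left[OF V, of "\<bar>bound\<bar> * (\<Sum>\<^sub>\<infinity>q. \<bar>W q\<bar>)"]
        by (simp add: abs_mult infsum_cmult_right' infsum_nonneg)
    qed
    from abs_summable_summable[OF this]
    have VW: "(\<lambda>(k, q). V k * (bound * W q)) summable_on UNIV" by simp
    show ?thesis
    proof (intro exI[of _ "\<lambda>(k, q). V k * (bound * W q)"] conjI VW allI impI)
      fix t and z :: "int \<times> ('n \<times> int)" assume t: "\<bar>t\<bar> \<le> R"
      obtain k i n where z: "z = (k, i, n)" by (metis prod.exhaust)
      have b: "cmod (entry t (i, n) k) \<le> bound" by (rule sum_bounded_le[OF fiber.cols])
      have b0: "0 \<le> bound" using b norm_ge_zero order_trans by blast
      have 1: "cmod (entry t (j, 0) k) \<le> V k" using v(2)[OF t, of k] by (simp add: entry_def V_def)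
      have 2: "cmod (entry t (i, n) 0) \<le> W (i, n)" using w(2)[OF t, of i "- n"] by (simp add: entry_def W_def)
      have "cmod (T z t) = cmod (entry t (j, 0) k) * (cmod (entry t (i, n) k) * cmod (entry t (i, n) 0))"
        by (simp add: T_def z norm_mult)
      also have "\<dots> \<le> V k * (bound * W (i, n))"
        by (intro mult_mono 1 2 b) (auto simp: V_def b0 intro!: mult_nonneg_nonneg)
      finally show "cmod (T z t) \<le> (case z of (k, q) \<Rightarrow> V k * (bound * W q))" by (simp add: z)
    qed
  qed
  have "continuous_on UNIV (\<lambda>t. of_real step * (\<Sum>\<^sub>\<infinity>z. T z t))"
  proof (intro continuous_on_mult_left continuous_on_infsum dom)
    show "continuous_on UNIV (T z)" for z
      unfolding T_def entry_def case_prod_unfold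
      by (intro continuous_intros continuous_on_compose2[OF S0_cont[OF g_S0]]) auto
  qed
  moreover have "(\<Sum>\<^sub>\<infinity>z. T z t) = fiber.synthesis t (fiber.analysis t (\<lambda>p. entry t p 0)) (j, 0)" for t
  proof -
    obtain v where v: "v summable_on UNIV" "\<And>s z. \<bar>s\<bar> \<le> \<bar>t\<bar> \<Longrightarrow> cmod (T z s) \<le> v z"
      using dom[of "\<bar>t\<bar>"] by blast
    have "(\<lambda>z. cmod (T z t)) summable_on UNIV"
      by (rule summable_on_comparison_test[OF v(1)]) (use v(2) in auto)
    then have s: "(\<lambda>z. T z t) summable_on UNIV" by (rule abs_summable_summable)
    have "(\<Sum>\<^sub>\<infinity>z. T z t) = (\<Sum>\<^sub>\<infinity>k. \<Sum>\<^sub>\<infinity>q. T (k, q) t)"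
      using infsum_Sigma_banach[of "\<lambda>z. T z t" UNIV "\<lambda>_. UNIV"] s by simp
    then show ?thesis
      by (simp add: T_def fiber.synthesis_def fiber.analysis_def infsum_cmult_right')
  qed
  ultimately show "continuous_on UNIV (\<lambda>t. of_real step * fiber.synthesis t (fiber.analysis t (\<lambda>p. entry t p 0)) (j, 0))"
    by simp
qed

text \<open>
  A column \<open>k0\<close> and a row \<open>(j, l)\<close> at \<open>t\<close> are the column 0 and the row \<open>(j, 0)\<close> at
  \<open>t - l + step k0\<close>, up to a relabelling of rows and columns.
\<close>

lemma column_fixed:
  assumes P: "is_projection_in lborel (tf_algebra lborel tf_shift (lattice_R \<theta>))
           (alg_gram lborel tf_shift (lattice_R \<theta>) g g)"
  shows "of_real step * fiber.synthesis t (fiber.analysis t (\<lambda>p. entry t p k0)) p = entry t p k0"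
proof -
  obtain j l where p: "p = (j, l)" by force
  define t' where "t' = t - of_int l + step * of_int k0"
  have e: "entry t (i, n + l) (k + k0) = entry t' (i, n) k" for i n k
    by (simp add: entry_def t'_def algebra_simps)
  have e0: "entry t (i, n + l) k0 = entry t' (i, n) 0" for i n
    using e[of i n 0] by simp
  have b1: "bij_betw (\<lambda>(i :: 'n, n::int). (i, n + l)) UNIV UNIV"
    by (rule bij_betw_byWitness[where f'="\<lambda>(i, n). (i, n - l)"]) auto
  have b2: "bij_betw (\<lambda>k::int. k + k0) UNIV UNIV"
    by (rule bij_betw_byWitness[where f'="\<lambda>k. k - k0"]) auto
  have an: "fiber.analysis t (\<lambda>p. entry t p k0) (k + k0) = fiber.analysis t' (\<lambda>p. entry t' p 0) k" for k
    unfolding fiber.analysis_def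
    by (subst infsum_reindex_bij_betw[OF b1, symmetric]) (simp add: case_prod_unfold e e0)
  have "fiber.synthesis t (fiber.analysis t (\<lambda>p. entry t p k0)) (j, 0 + l)
      = fiber.synthesis t' (fiber.analysis t' (\<lambda>p. entry t' p 0)) (j, 0)"
    unfolding fiber.synthesis_def
    by (subst infsum_reindex_bij_betw[OF b2, symmetric]) (simp only: e an)
  then have "of_real step * fiber.synthesis t (fiber.analysis t (\<lambda>p. entry t p k0)) p = g j t'"
    using column_fixed_at_zero[OF P, of t' j] by (simp add: p)
  then show ?thesis by (simp add: p entry_def t'_def)
qed

text \<open>
  In \<open>g\<^sub>j(t) = step (\<Sum>k. g\<^sub>j(t + step k) G\<^sub>k(t))\<close> the function \<open>G\<^sub>k\<close> is the sum of its
  Fourier series with the coefficients \<open>\<Sum>i. \<langle>g\<^sub>i, \<pi>(- step k, m) g\<^sub>i\<rangle>\<close>; the bounds \<open>D k\<close> for \<open>\<bar>G\<^sub>k\<bar>\<close>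
  add up to \<open>adjoint_const \<theta> g / step\<close>.  Compare suprema.
\<close>

lemma one_le_adjoint_const:
  assumes P: "is_projection_in lborel (tf_algebra lborel tf_shift (lattice_R \<theta>))
           (alg_gram lborel tf_shift (lattice_R \<theta>) g g)"
    and nz: "g j0 t0 \<noteq> 0"
  shows "1 \<le> adjoint_const \<theta> g"
proof -
  define A where "A i x m = cmod (L2_inner lborel (g i) (tf_shift (x, 1 * of_int m) (g i)))" for i x and m :: int
  define D where "D k = (\<Sum>i\<in>UNIV. \<Sum>\<^sub>\<infinity>m. A i (- (step * of_int k)) m)" for k :: int
  have As: "A i x summable_on UNIV" for i x
    unfolding A_def by (rule S0_row_summable[OF g_S0 g_S0 zero_less_one])
  have bij: "bij_betw (\<lambda>(k, m). (- (step * of_int k), 1 * of_int m)) (UNIV :: (int \<times> int) set) (multiples step \<times> multiples 1)"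
  proof -
    have "bij_betw (\<lambda>k::int. - (step * of_int k)) UNIV (multiples step)"
    proof -
      have "bij_betw ((\<lambda>k::int. step * of_int k) \<circ> uminus) UNIV (multiples step)"
        by (rule bij_betw_trans[OF _ bij_betw_multiples]) (use step_pos in \<open>auto intro: bij_betw_byWitness[where f'=uminus]\<close>)
      then show ?thesis by (simp add: o_def)
    qed
    from bij_betw_map_prod[OF this bij_betw_multiples[of 1]] show ?thesis by (simp add: map_prod_def)
  qed
  have S: "(\<lambda>z. cmod (L2_inner lborel (g i) (tf_shift z (g i)))) summable_on multiples step \<times> multiples 1" for i
    by (rule S0_summable_ambiguity[OF g_S0 g_S0 step_pos zero_less_one])
  have AS: "(\<lambda>(k, m). A i (- (step * of_int k)) m) summable_on UNIV" for i
    using summable_on_reindex_bij_betw[OF bij, of "\<lambda>z. cmod (L2_inner lborel (g i) (tf_shift z (g i)))"] S[of i]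
    by (simp add: A_def case_prod_unfold)
  have sumA: "(\<lambda>k. \<Sum>\<^sub>\<infinity>m. A i (- (step * of_int k)) m) summable_on UNIV"
    "(\<Sum>\<^sub>\<infinity>k. \<Sum>\<^sub>\<infinity>m. A i (- (step * of_int k)) m)
      = (\<Sum>\<^sub>\<infinity>z\<in>multiples step \<times> multiples 1. cmod (L2_inner lborel (g i) (tf_shift z (g i))))" for i
  proof -
    show "(\<lambda>k. \<Sum>\<^sub>\<infinity>m. A i (- (step * of_int k)) m) summable_on UNIV"
      using summable_on_Sigma_banach[of "\<lambda>k m. A i (- (step * of_int k)) m" UNIV "\<lambda>_. UNIV"] AS[of i] by simp
    have "(\<Sum>\<^sub>\<infinity>z\<in>multiples step \<times> multiples 1. cmod (L2_inner lborel (g i) (tf_shift z (g i))))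
        = (\<Sum>\<^sub>\<infinity>(k, m). A i (- (step * of_int k)) m)"
      using infsum_reindex_bij_betw[OF bij, of "\<lambda>z. cmod (L2_inner lborel (g i) (tf_shift z (g i)))"]
      by (simp add: A_def case_prod_unfold)
    then show "(\<Sum>\<^sub>\<infinity>k. \<Sum>\<^sub>\<infinity>m. A i (- (step * of_int k)) m)
      = (\<Sum>\<^sub>\<infinity>z\<in>multiples step \<times> multiples 1. cmod (L2_inner lborel (g i) (tf_shift z (g i))))"
      using infsum_Sigma'_banach[of "\<lambda>k m. A i (- (step * of_int k)) m" UNIV "\<lambda>_. UNIV"] AS[of i] by simp
  qed
  have Ds: "D summable_on UNIV"
    unfolding D_def[abs_def] by (rule has_sum_imp_summable[OF has_sum_finite_sum]) (rule has_sum_infsum[OF sumA(1)])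
  have Dsum: "step * (\<Sum>\<^sub>\<infinity>k. D k) = adjoint_const \<theta> g"
  proof -
    have "(D has_sum (\<Sum>i\<in>UNIV. \<Sum>\<^sub>\<infinity>k. \<Sum>\<^sub>\<infinity>m. A i (- (step * of_int k)) m)) UNIV"
      unfolding D_def[abs_def] by (rule has_sum_finite_sum) (rule has_sum_infsum[OF sumA(1)])
    from infsumI[OF this] show ?thesis
      unfolding adjoint_const_def step_def[symmetric] sumA(2) by simp
  qed
  have G: "cmod (fiber.analysis t (\<lambda>p. entry t p 0) k) \<le> D k" for t k
  proof -
    have "ell_one (\<lambda>p. cnj (entry t p k) * entry t p 0)"
      by (rule ell_one_mult_bounded[OF sum_bounded_ell_one[OF fiber.cols] sum_bounded_le[OF fiber.cnj_cols]])
    then have s: "(\<lambda>p. cnj (entry t p k) * entry t p 0) summable_on UNIV" by (rule ell_one_summable)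
    have "fiber.analysis t (\<lambda>p. entry t p 0) k = (\<Sum>i\<in>UNIV. \<Sum>\<^sub>\<infinity>n. cnj (entry t (i, n) k) * entry t (i, n) 0)"
      unfolding fiber.analysis_def
      using infsum_Sigma_banach[of "\<lambda>p. cnj (entry t p k) * entry t p 0" UNIV "\<lambda>_. UNIV"] s by simp
    also have "\<dots> = (\<Sum>i\<in>UNIV. \<Sum>\<^sub>\<infinity>m::int. L2_inner lborel (g i) (tf_shift (- (step * of_int k), 1 * of_int m) (g i)) * cis (2 * pi * (1 * of_int m) * t))"
    proof (intro sum.cong refl)
      fix i
      have bu: "bij_betw (uminus :: int \<Rightarrow> int) UNIV UNIV" by (rule bij_betw_byWitness[where f'=uminus]) auto
      have "(\<Sum>\<^sub>\<infinity>n. cnj (entry t (i, n) k) * entry t (i, n) 0)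
          = (\<Sum>\<^sub>\<infinity>n. cnj (entry t (i, - n) k) * entry t (i, - n) 0)"
        by (rule infsum_reindex_bij_betw[OF bu, symmetric])
      also have "\<dots> = (\<Sum>\<^sub>\<infinity>m::int. L2_inner lborel (g i) (tf_shift (- (step * of_int k), 1 * of_int m) (g i)) * cis (2 * pi * (1 * of_int m) * t))"
        unfolding Fourier_series_of_overlap[OF g_S0 g_S0 zero_less_one] by (simp add: entry_def mult.commute)
      finally show "(\<Sum>\<^sub>\<infinity>n. cnj (entry t (i, n) k) * entry t (i, n) 0)
          = (\<Sum>\<^sub>\<infinity>m::int. L2_inner lborel (g i) (tf_shift (- (step * of_int k), 1 * of_int m) (g i)) * cis (2 * pi * (1 * of_int m) * t))" .
    qed
    also have "cmod \<dots> \<le> D k"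
      unfolding D_def
    proof (rule sum_norm_le)
      fix i
      have "cmod (\<Sum>\<^sub>\<infinity>m::int. L2_inner lborel (g i) (tf_shift (- (step * of_int k), 1 * of_int m) (g i)) * cis (2 * pi * (1 * of_int m) * t))
          \<le> (\<Sum>\<^sub>\<infinity>m::int. cmod (L2_inner lborel (g i) (tf_shift (- (step * of_int k), 1 * of_int m) (g i)) * cis (2 * pi * (1 * of_int m) * t)))"
        by (rule norm_infsum_bound, simp only: norm_mult norm_cis mult_1_right)
          (rule S0_row_summable[OF g_S0 g_S0 zero_less_one])
      then show "cmod (\<Sum>\<^sub>\<infinity>m::int. L2_inner lborel (g i) (tf_shift (- (step * of_int k), 1 * of_int m) (g i)) * cis (2 * pi * (1 * of_int m) * t))
          \<le> (\<Sum>\<^sub>\<infinity>m. A i (- (step * of_int k)) m)"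
        by (simp add: A_def norm_mult)
    qed
    finally show ?thesis .
  qed
  define S where "S = (SUP z. cmod (g (fst z) (snd z)))"
  have gb: "cmod (g j t) \<le> bound" for j t
    using sum_bounded_le[OF fiber.cols, of t "(j, 0)" 0] by (simp add: entry_def)
  have bdd: "bdd_above (range (\<lambda>z. cmod (g (fst z) (snd z))))"
    by (rule bdd_aboveI[of _ bound]) (use gb in auto)
  have gS: "cmod (g j t) \<le> S" for j t
    unfolding S_def using cSUP_upper[OF _ bdd, of "(j, t)"] by simp
  have S0: "0 < S" using gS[of j0 t0] nz by (meson less_le_trans zero_less_norm_iff)
  have "cmod (g j t) \<le> S * adjoint_const \<theta> g" for j t
  proof -
    have le: "cmod (entry t (j, 0) k * fiber.analysis t (\<lambda>p. entry t p 0) k) \<le> S * D k" for k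
      unfolding norm_mult by (intro mult_mono G) (use gS S0 in \<open>auto simp: entry_def\<close>)
    have sD: "(\<lambda>k. S * D k) summable_on UNIV" by (rule summable_on_cmult_right[OF Ds])
    have ab: "(\<lambda>k. cmod (entry t (j, 0) k * fiber.analysis t (\<lambda>p. entry t p 0) k)) summable_on UNIV"
      by (rule summable_on_comparison_test[OF sD]) (use le in auto)
    have "cmod (g j t) = step * cmod (fiber.synthesis t (fiber.analysis t (\<lambda>p. entry t p 0)) (j, 0))"
      using column_fixed_at_zero[OF P, of t j] step_pos by (metis abs_of_pos norm_mult norm_of_real)
    also have "\<dots> \<le> step * (\<Sum>\<^sub>\<infinity>k. cmod (entry t (j, 0) k * fiber.analysis t (\<lambda>p. entry t p 0) k))"
      unfolding fiber.synthesis_def using step_pos by (intro mult_left_mono norm_infsum_bound ab) auto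
    also have "\<dots> \<le> step * (\<Sum>\<^sub>\<infinity>k. S * D k)"
      using step_pos by (intro mult_left_mono infsum_mono ab sD le) auto
    also have "\<dots> = S * adjoint_const \<theta> g"
      unfolding Dsum[symmetric] infsum_cmult_right' by simp
    finally show ?thesis .
  qed
  then have "S \<le> S * adjoint_const \<theta> g"
    by (subst S_def) (intro cSUP_least, auto)
  then show ?thesis using S0 by simp
qed

end

section \<open>Projections on sequence spaces\<close>

lemma infsum_prod_finite:
  fixes F :: "'n::finite \<times> 'x \<Rightarrow> complex"
  assumes "F summable_on UNIV"
  shows "(\<Sum>\<^sub>\<infinity>q. F q) = (\<Sum>i\<in>UNIV. \<Sum>\<^sub>\<infinity>y. F (i, y))"
  using infsum_Sigma_banach[of F UNIV "\<lambda>_. UNIV"] assms by simp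

lemma infsum_extend: "(\<Sum>\<^sub>\<infinity>y\<in>X. f y) = (\<Sum>\<^sub>\<infinity>y. if y \<in> X then f y else 0)"
  by (rule infsum_cong_neutral) auto

text \<open>
  Extended by zero, the kernel becomes a matrix indexed by pairs of a component and a point.
  Self-adjointness needs \<open>\<Sum>p q. \<bar>K p q\<bar> \<bar>h q\<bar> \<bar>k p\<bar> < \<infinity>\<close> for square summable \<open>h, k\<close>, which
  follows from \<open>\<bar>h q\<bar> \<bar>k p\<bar> \<le> \<bar>h q\<bar>\<^sup>2 + \<bar>k p\<bar>\<^sup>2\<close> and the bounded row and column sums.
\<close>

lemma kernel_projection:
  fixes K :: "'n::finite \<Rightarrow> 'n \<Rightarrow> 'x \<Rightarrow> 'x \<Rightarrow> complex"
  assumes herm: "\<And>i j x y. x \<in> X \<Longrightarrow> y \<in> X \<Longrightarrow> K j i x y = cnj (K i j y x)"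
    and bound: "\<And>j x F. x \<in> X \<Longrightarrow> finite F \<Longrightarrow> F \<subseteq> UNIV \<times> X \<Longrightarrow> (\<Sum>(i, y)\<in>F. cmod (K j i x y)) \<le> B"
    and idem: "\<And>j l x z. x \<in> X \<Longrightarrow> z \<in> X \<Longrightarrow> (\<Sum>i\<in>UNIV. \<Sum>\<^sub>\<infinity>y\<in>X. K j i x y * K i l y z) = K j l x z"
    and P: "\<And>j i h x. h \<in> L2 (count_space X) \<Longrightarrow> x \<in> X \<Longrightarrow> P j i h x = (\<Sum>\<^sub>\<infinity>y\<in>X. K j i x y * h y)"
    and PA: "\<And>j i. P j i \<in> tf_algebra (count_space X) \<pi> L"
  shows "is_projection_in (count_space X) (tf_algebra (count_space X) \<pi> L) P"
proof -
  \<comment> \<open>kernel and tuples extended by zero to all pairs of a component and a point\<close>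
  define K' where "K' p q = (if snd p \<in> X \<and> snd q \<in> X then K (fst p) (fst q) (snd p) (snd q) else 0)" for p q
  define ext where "ext h q = (if snd q \<in> X then h (fst q) (snd q) else 0)" for h :: "'n \<Rightarrow> 'x \<Rightarrow> complex" and q
  have herm': "K' p q = cnj (K' q p)" for p q
  proof (cases "snd p \<in> X \<and> snd q \<in> X")
    case True
    then have "K (fst p) (fst q) (snd p) (snd q) = cnj (K (fst q) (fst p) (snd q) (snd p))"
      by (intro herm) auto
    with True show ?thesis by (simp add: K'_def)
  qed (auto simp: K'_def)
  have rows: "sum_bounded (max 0 B) (K' p)" for p
    unfolding sum_bounded_def
  proof (intro allI impI)
    fix F :: "('n \<times> 'x) set" assume F: "finite F"
    show "(\<Sum>q\<in>F. cmod (K' p q)) \<le> max 0 B"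
    proof (cases "snd p \<in> X")
      case True
      have "(\<Sum>q\<in>F. cmod (K' p q)) = (\<Sum>q\<in>F \<inter> (UNIV \<times> X). cmod (K (fst p) (fst q) (snd p) (snd q)))"
        by (rule sum.mono_neutral_cong_right) (use F True in \<open>auto simp: K'_def\<close>)
      also have "\<dots> \<le> B" using bound[OF True, of "F \<inter> (UNIV \<times> X)" "fst p"] F by (simp add: case_prod_unfold)
      finally show ?thesis by simp
    qed (simp add: K'_def)
  qed
  have cols: "sum_bounded (max 0 B) (\<lambda>p. K' p q)" for q
  proof -
    have "cmod (K' p q) = cmod (K' q p)" for p by (subst herm') simp
    then show ?thesis using rows[of q] by (simp add: sum_bounded_def)
  qed
  have sq: "ell_one (\<lambda>q. complex_of_real ((cmod (ext h q))\<^sup>2))" if h: "h \<in> L2_tuples (count_space X)" for h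
  proof -
    have "(\<lambda>y. (cmod (h i y))\<^sup>2) summable_on X" for i
      using h by (simp add: L2_tuples_def L2_def summable_on_iff_integrable_real)
    then have s: "(\<lambda>y. (cmod (ext h (i, y)))\<^sup>2) summable_on UNIV" for i
      by (rule summable_on_cong_neutral[THEN iffD1, rotated 3]) (auto simp: ext_def)
    have "(\<lambda>q. norm ((cmod (ext h q))\<^sup>2)) summable_on (SIGMA i:UNIV. UNIV)"
      by (rule Infinite_Sum.abs_summable_on_Sigma_iff[THEN iffD2]) (use s in auto)
    then show ?thesis unfolding ell_one_def norm_of_real by simp
  qed
  have bdd: "\<exists>H. \<forall>q. cmod (ext h q) \<le> H" if h: "h \<in> L2_tuples (count_space X)" for h
  proof -
    define S where "S = (\<Sum>\<^sub>\<infinity>q. (cmod (ext h q))\<^sup>2)"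
    have S: "(cmod (ext h q))\<^sup>2 \<le> S" for q
      using ell_one_bounded[OF sq[OF h], of q] unfolding norm_of_real S_def by simp
    have "cmod (ext h q) \<le> 1 + S" for q
    proof -
      have "2 * cmod (ext h q) \<le> 1 + (cmod (ext h q))\<^sup>2"
        using sum_squares_bound[of 1 "cmod (ext h q)"] by simp
      then show ?thesis using S[of q] zero_le_power2[of "cmod (ext h q)"] by linarith
    qed
    then show ?thesis by blast
  qed
  have Ksum: "(\<lambda>q. K' p q * ext h q) summable_on UNIV" if h: "h \<in> L2_tuples (count_space X)" for h p
  proof -
    obtain H where H: "\<And>q. cmod (ext h q) \<le> H" using bdd[OF h] by blast
    have "ell_one (\<lambda>q. ext h q * K' p q)" by (rule ell_one_mult_bounded[OF sum_bounded_ell_one[OF rows] H])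
    then show ?thesis by (simp add: mult.commute ell_one_summable)
  qed
  have mat: "ext (mat_apply P h) p = (\<Sum>\<^sub>\<infinity>q. K' p q * ext h q)" if h: "h \<in> L2_tuples (count_space X)" for h p
  proof (cases "snd p \<in> X")
    case True
    have "ext (mat_apply P h) p = (\<Sum>i\<in>UNIV. \<Sum>\<^sub>\<infinity>y\<in>X. K (fst p) i (snd p) y * h i y)"
      using h True P by (simp add: ext_def mat_apply_def L2_tuples_def)
    also have "\<dots> = (\<Sum>i\<in>UNIV. \<Sum>\<^sub>\<infinity>y. K' p (i, y) * ext h (i, y))"
      unfolding infsum_extend[of _ X] by (intro sum.cong infsum_cong refl) (simp add: K'_def ext_def True)
    also have "\<dots> = (\<Sum>\<^sub>\<infinity>q. K' p q * ext h q)" by (rule infsum_prod_finite[OF Ksum[OF h], symmetric])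
    finally show ?thesis .
  qed (simp add: ext_def K'_def)
  have ti: "tuple_inner (count_space X) h k = (\<Sum>\<^sub>\<infinity>q. ext h q * cnj (ext k q))"
    if h: "h \<in> L2_tuples (count_space X)" and k: "k \<in> L2_tuples (count_space X)" for h k
  proof -
    have s: "(\<lambda>q. ext h q * cnj (ext k q)) summable_on UNIV"
    proof -
      have "(\<lambda>q. cmod (complex_of_real ((cmod (ext h q))\<^sup>2)) + cmod (complex_of_real ((cmod (ext k q))\<^sup>2))) summable_on UNIV"
        using sq[OF h] sq[OF k] unfolding ell_one_def by (rule summable_on_add)
      then have "(\<lambda>q. cmod (ext h q * cnj (ext k q))) summable_on UNIV"
      proof (rule summable_on_comparison_test)
        fix q
        show "cmod (ext h q * cnj (ext k q)) \<le> cmod (complex_of_real ((cmod (ext h q))\<^sup>2)) + cmod (complex_of_real ((cmod (ext k q))\<^sup>2))"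
          using sum_squares_bound[of "cmod (ext h q)" "cmod (ext k q)"] mult_nonneg_nonneg[of "cmod (ext h q)" "cmod (ext k q)"]
          by (simp add: norm_mult norm_power del: mult_nonneg_nonneg)
      qed simp
      then show ?thesis by (rule abs_summable_summable)
    qed
    have "tuple_inner (count_space X) h k = (\<Sum>i\<in>UNIV. \<Sum>\<^sub>\<infinity>y\<in>X. h i y * cnj (k i y))"
      by (simp add: tuple_inner_def L2_inner_def infsum_eq_integral)
    also have "\<dots> = (\<Sum>i\<in>UNIV. \<Sum>\<^sub>\<infinity>y. ext h (i, y) * cnj (ext k (i, y)))"
      unfolding infsum_extend[of _ X] by (intro sum.cong infsum_cong refl) (simp add: ext_def)
    also have "\<dots> = (\<Sum>\<^sub>\<infinity>q. ext h q * cnj (ext k q))" by (rule infsum_prod_finite[OF s, symmetric])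
    finally show ?thesis .
  qed
  have idem': "(\<Sum>\<^sub>\<infinity>q. K' p q * K' q r) = K' p r" for p r
  proof (cases "snd p \<in> X \<and> snd r \<in> X")
    case True
    have "ell_one (\<lambda>q. K' p q * K' q r)"
      by (rule ell_one_mult_bounded[OF sum_bounded_ell_one[OF cols] sum_bounded_le[OF rows]])
    then have s: "(\<lambda>q. K' p q * K' q r) summable_on UNIV" by (rule ell_one_summable)
    have "(\<Sum>\<^sub>\<infinity>q. K' p q * K' q r) = (\<Sum>i\<in>UNIV. \<Sum>\<^sub>\<infinity>y. K' p (i, y) * K' (i, y) r)"
      by (rule infsum_prod_finite[OF s])
    also have "\<dots> = (\<Sum>i\<in>UNIV. \<Sum>\<^sub>\<infinity>y\<in>X. K (fst p) i (snd p) y * K i (fst r) y (snd r))"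
      unfolding infsum_extend[of _ X] by (intro sum.cong infsum_cong refl) (simp add: K'_def True)
    also have "\<dots> = K' p r" using True by (simp add: idem K'_def)
    finally show ?thesis .
  qed (auto simp: K'_def)
  have uL2: "mat_apply P h \<in> L2_tuples (count_space X)" if "h \<in> L2_tuples (count_space X)" for h
    by (rule mat_apply_L2[OF PA that])
  show ?thesis unfolding is_projection_in_def
  proof (intro conjI allI ballI PA)
    fix h k :: "'n \<Rightarrow> 'x \<Rightarrow> complex"
    assume h: "h \<in> L2_tuples (count_space X)" and k: "k \<in> L2_tuples (count_space X)"
    define G where "G = (\<lambda>(p, q). K' p q * ext h q * cnj (ext k p))"
    have G: "G summable_on UNIV"
    proof -
      define A where "A p q = complex_of_real (cmod (K' p q))" for p q
      have Ac: "sum_bounded (max 0 B) (\<lambda>p. A p q)" "sum_bounded (max 0 B) (\<lambda>q. A p q)" for p q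
        using cols[of q] rows[of p] by (simp_all add: A_def sum_bounded_def)
      have 1: "(\<lambda>(q, p). 1 * (A p q * complex_of_real ((cmod (ext h q))\<^sup>2))) summable_on UNIV"
        by (rule Schur_product[OF Ac(1) sq[OF h], where Y=1]) simp
      have 2: "(\<lambda>(p, q). 1 * (A p q * complex_of_real ((cmod (ext k p))\<^sup>2))) summable_on UNIV"
        by (rule Schur_product[where a="\<lambda>q p. A p q" and Y=1, OF Ac(2) sq[OF k]]) simp
      have A1: "(\<lambda>(p, q). A p q * complex_of_real ((cmod (ext h q))\<^sup>2)) summable_on UNIV \<times> UNIV"
        by (subst summable_on_swap) (use 1 in simp)
      have "(\<lambda>z. (case z of (p, q) \<Rightarrow> A p q * complex_of_real ((cmod (ext h q))\<^sup>2))
          + (case z of (p, q) \<Rightarrow> A p q * complex_of_real ((cmod (ext k p))\<^sup>2))) summable_on UNIV"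
        by (rule summable_on_add) (use A1 2 in simp_all)
      then have "(\<lambda>z. cmod ((case z of (p, q) \<Rightarrow> A p q * complex_of_real ((cmod (ext h q))\<^sup>2))
          + (case z of (p, q) \<Rightarrow> A p q * complex_of_real ((cmod (ext k p))\<^sup>2)))) summable_on UNIV"
        by (rule summable_on_iff_abs_summable_on_complex[THEN iffD1])
      then have "(\<lambda>z. cmod (G z)) summable_on UNIV"
      proof (rule summable_on_comparison_test)
        fix z :: "('n \<times> 'x) \<times> ('n \<times> 'x)"
        obtain p q where z: "z = (p, q)" by (cases z)
        have "cmod (ext h q) * cmod (ext k p) \<le> (cmod (ext h q))\<^sup>2 + (cmod (ext k p))\<^sup>2"
          using sum_squares_bound[of "cmod (ext h q)" "cmod (ext k p)"] mult_nonneg_nonneg[of "cmod (ext h q)" "cmod (ext k p)"]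
          by (simp del: mult_nonneg_nonneg)
        then have "cmod (G z) \<le> cmod (K' p q) * ((cmod (ext h q))\<^sup>2 + (cmod (ext k p))\<^sup>2)"
          by (simp add: G_def z norm_mult mult.assoc mult_left_mono)
        also have "\<dots> = cmod (A p q * complex_of_real ((cmod (ext h q))\<^sup>2) + A p q * complex_of_real ((cmod (ext k p))\<^sup>2))"
          unfolding A_def of_real_mult[symmetric] of_real_add[symmetric] norm_of_real
          by (simp add: distrib_left)
        finally show "cmod (G z) \<le> cmod ((case z of (p, q) \<Rightarrow> A p q * complex_of_real ((cmod (ext h q))\<^sup>2))
          + (case z of (p, q) \<Rightarrow> A p q * complex_of_real ((cmod (ext k p))\<^sup>2)))" by (simp add: z)
      qed simp
      then show ?thesis by (rule abs_summable_summable)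
    qed
    have "tuple_inner (count_space X) (mat_apply P h) k = (\<Sum>\<^sub>\<infinity>p. (\<Sum>\<^sub>\<infinity>q. K' p q * ext h q) * cnj (ext k p))"
      unfolding ti[OF uL2[OF h] k] mat[OF h] ..
    also have "\<dots> = (\<Sum>\<^sub>\<infinity>p. \<Sum>\<^sub>\<infinity>q. G (p, q))"
      by (simp add: G_def infsum_cmult_left')
    also have "\<dots> = (\<Sum>\<^sub>\<infinity>q. \<Sum>\<^sub>\<infinity>p. G (p, q))"
      using infsum_swap_banach[of "\<lambda>p q. G (p, q)" UNIV UNIV] G by simp
    also have "\<dots> = (\<Sum>\<^sub>\<infinity>q. ext h q * cnj (\<Sum>\<^sub>\<infinity>p. K' q p * ext k p))"
    proof (intro infsum_cong)
      fix q
      have "(\<Sum>\<^sub>\<infinity>p. G (p, q)) = (\<Sum>\<^sub>\<infinity>p. ext h q * cnj (K' q p * ext k p))"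
        using herm'[symmetric] by (intro infsum_cong) (simp add: G_def)
      then show "(\<Sum>\<^sub>\<infinity>p. G (p, q)) = ext h q * cnj (\<Sum>\<^sub>\<infinity>p. K' q p * ext k p)"
        unfolding infsum_cmult_right' infsum_cnj .
    qed
    also have "\<dots> = tuple_inner (count_space X) h (mat_apply P k)"
      unfolding ti[OF h uL2[OF k]] mat[OF k] ..
    finally show "tuple_inner (count_space X) (mat_apply P h) k = tuple_inner (count_space X) h (mat_apply P k)" .
  next
    fix h :: "'n \<Rightarrow> 'x \<Rightarrow> complex" and j
    assume h: "h \<in> L2_tuples (count_space X)"
    have "mat_apply P (mat_apply P h) j x = mat_apply P h j x" if x: "x \<in> X" for x
    proof -
      obtain H where H: "\<And>q. cmod (ext h q) \<le> H" using bdd[OF h] by blast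
      have "mat_apply P (mat_apply P h) j x = ext (mat_apply P (mat_apply P h)) (j, x)"
        using x by (simp add: ext_def)
      also have "\<dots> = (\<Sum>\<^sub>\<infinity>q. (\<Sum>\<^sub>\<infinity>r. ext h r * K' q r) * K' (j, x) q)"
        unfolding mat[OF uL2[OF h]] mat[OF h] by (intro infsum_cong) (simp add: mult.commute)
      also have "\<dots> = (\<Sum>\<^sub>\<infinity>r. ext h r * (\<Sum>\<^sub>\<infinity>q. K' q r * K' (j, x) q))"
        by (rule Schur_duality[where a="\<lambda>r q. K' q r", OF rows sum_bounded_ell_one[OF rows] H, symmetric])
      also have "\<dots> = (\<Sum>\<^sub>\<infinity>r. K' (j, x) r * ext h r)"
      proof (intro infsum_cong)
        fix r
        have "(\<Sum>\<^sub>\<infinity>q. K' q r * K' (j, x) q) = K' (j, x) r"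
          by (subst mult.commute) (rule idem')
        then show "ext h r * (\<Sum>\<^sub>\<infinity>q. K' q r * K' (j, x) q) = K' (j, x) r * ext h r"
          by (simp add: mult.commute)
      qed
      also have "\<dots> = mat_apply P h j x" unfolding mat[OF h, symmetric] using x by (simp add: ext_def)
      finally show ?thesis .
    qed
    then show "AE t in count_space X. mat_apply P (mat_apply P h) j t = mat_apply P h j t"
      by (simp add: AE_count_space)
  qed
qed

lemma sum_roots_of_unity:
  assumes "M > 0"
  shows "(\<Sum>m<M. cis (2 * pi * real m * of_int l / real M)) = (if int M dvd l then of_nat M else 0)"
proof -
  define w where "w = cis (2 * pi * of_int l / real M)"
  have pw: "cis (2 * pi * real m * of_int l / real M) = w ^ m" for m
    unfolding w_def Complex.DeMoivre by (rule arg_cong[where f=cis]) simp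
  show ?thesis
  proof (cases "int M dvd l")
    case True
    then obtain k where "l = int M * k" by blast
    then have "2 * pi * of_int l / real M = 2 * pi * of_int k" using assms by simp
    then have "w = 1" unfolding w_def using cis_multiple_2pi[of "of_int k"] by (simp only: Ints_of_int)
    then show ?thesis using True by (simp add: pw)
  next
    case False
    have "w \<noteq> 1"
    proof
      assume "w = 1"
      then have "cos (2 * pi * of_int l / real M) = 1" unfolding w_def by (metis cis.sel(1) one_complex.sel(1))
      then obtain k :: int where "2 * pi * of_int l / real M = of_int k * 2 * pi"
        using cos_one_2pi_int by blast
      then have "real_of_int l = of_int k * real M" using assms by (simp add: field_simps)
      then have "l = k * int M" by (metis of_int_eq_iff of_int_mult of_int_of_nat_eq)
      then show False using False by simp
    qed
    moreover have "w ^ M = 1"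
      using assms unfolding w_def Complex.DeMoivre by (simp add: cis_multiple_2pi)
    ultimately show ?thesis using False by (simp add: pw sum_gp_strict)
  qed
qed

lemma has_sum_finite_sum_complex:
  fixes f :: "'i \<Rightarrow> 'a \<Rightarrow> complex"
  assumes "\<And>i. i \<in> I \<Longrightarrow> (f i has_sum S i) A"
  shows "((\<lambda>x. \<Sum>i\<in>I. f i x) has_sum (\<Sum>i\<in>I. S i)) A"
  using assms by (induction I rule: infinite_finite_induct) (auto intro: has_sum_add)

lemma L2_count_space: "h \<in> L2 (count_space X) \<longleftrightarrow> (\<lambda>t. (cmod (h t))\<^sup>2) summable_on X"
  by (simp add: L2_def summable_on_iff_integrable_real)

lemma L2_norm_count_space: "L2_norm (count_space X) h = sqrt (\<Sum>\<^sub>\<infinity>t\<in>X. (cmod (h t))\<^sup>2)"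
  by (simp add: L2_norm_def infsum_eq_integral_real)

lemma L2_inner_count_space: "L2_inner (count_space X) f h = (\<Sum>\<^sub>\<infinity>t\<in>X. f t * cnj (h t))"
  by (simp add: L2_inner_def infsum_eq_integral)

text \<open>
  The residues modulo \<open>u v\<close> that are congruent to \<open>x\<close> modulo \<open>u\<close> are reached from \<open>x\<close> by \<open>v\<close>
  steps of length \<open>u\<close>, in either direction.
\<close>

lemma bij_betw_residues:
  fixes u v x e :: int
  assumes u: "u > 0" and v: "v > 0" and e: "e = 1 \<or> e = -1"
  shows "bij_betw (\<lambda>r. (x + e * (u * r)) mod (u * v)) {0..<v} {s \<in> {0..<u * v}. u dvd x - s}"
  unfolding bij_betw_def
proof
  have uv: "u * v > 0" using u v by simp
  show "inj_on (\<lambda>r. (x + e * (u * r)) mod (u * v)) {0..<v}"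
  proof (rule inj_onI)
    fix r r' assume r: "r \<in> {0..<v}" "r' \<in> {0..<v}"
      and eq: "(x + e * (u * r)) mod (u * v) = (x + e * (u * r')) mod (u * v)"
    then have "u * v dvd (x + e * (u * r)) - (x + e * (u * r'))" by (simp add: mod_eq_dvd_iff)
    also have "(x + e * (u * r)) - (x + e * (u * r')) = u * (e * (r - r'))" by (simp add: algebra_simps)
    finally have "v dvd e * (r - r')" using u by simp
    then have "v dvd r - r'" using e by (auto dest: dvd_diff_commute[THEN iffD1])
    then have "r mod v = r' mod v" by (simp add: mod_eq_dvd_iff)
    then show "r = r'" using r by simp
  qed
  show "(\<lambda>r. (x + e * (u * r)) mod (u * v)) ` {0..<v} = {s \<in> {0..<u * v}. u dvd x - s}"
  proof (intro equalityI subsetI)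
    fix s assume "s \<in> (\<lambda>r. (x + e * (u * r)) mod (u * v)) ` {0..<v}"
    then obtain r where s: "s = (x + e * (u * r)) mod (u * v)" by blast
    have "u * v dvd (x + e * (u * r)) - s" by (simp add: s dvd_minus_mod)
    then have "u dvd (x + e * (u * r)) - s" by (rule dvd_mult_left)
    moreover have "u dvd e * (u * r)" by simp
    ultimately have "u dvd ((x + e * (u * r)) - s) - e * (u * r)" by (rule dvd_diff)
    then have "u dvd x - s" by simp
    then show "s \<in> {s \<in> {0..<u * v}. u dvd x - s}" using uv by (simp add: s)
  next
    fix s assume "s \<in> {s \<in> {0..<u * v}. u dvd x - s}"
    then have s: "0 \<le> s" "s < u * v" "u dvd x - s" by auto
    then obtain k where k: "x - s = u * k" by blast
    \<comment> \<open>solves \<open>e r = - k\<close> modulo \<open>v\<close>, because \<open>e\<^sup>2 = 1\<close>\<close>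
    define r where "r = (- e * k) mod v"
    have "v dvd (- e * k) - r" by (simp add: r_def dvd_minus_mod)
    then obtain q where q: "- e * k - r = v * q" by blast
    have ee: "e * e = 1" using e by auto
    have "e * r = - k - e * (v * q)"
    proof -
      have "e * r = e * (- e * k) - e * (v * q)" unfolding q[symmetric] by (simp add: algebra_simps)
      then show ?thesis using ee by (simp add: mult.assoc[symmetric])
    qed
    then have "u * (e * r) = u * (- k - e * (v * q))" by (simp only:)
    then have "u * (e * r) = - (u * k) - u * (e * (v * q))" by (simp only: right_diff_distrib mult_minus_right)
    then have "x + e * (u * r) = s + (u * v) * (- (e * q))" using k by (simp add: algebra_simps)
    then have "(x + e * (u * r)) mod (u * v) = s mod (u * v)" by (simp only: mod_mult_self2)
    also have "\<dots> = s" using s by simp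
    finally show "s \<in> (\<lambda>r. (x + e * (u * r)) mod (u * v)) ` {0..<v}"
      using v by (intro image_eqI[of _ _ r]) (auto simp: r_def)
  qed
qed

lemma infsum_residues:
  fixes f :: "int \<Rightarrow> complex"
  assumes "f summable_on UNIV" "b > 0"
  shows "(\<Sum>\<^sub>\<infinity>k. f k) = (\<Sum>r\<in>{0..<b}. \<Sum>\<^sub>\<infinity>l. f (r + b * l))"
proof -
  have bij: "bij_betw (\<lambda>(r, l). r + b * l) ({0..<b} \<times> UNIV) UNIV"
    by (rule bij_betw_byWitness[where f'="\<lambda>k. (k mod b, k div b)"]) (use assms in auto)
  have s: "(\<lambda>(r, l). f (r + b * l)) summable_on ({0..<b} \<times> UNIV)"
    using summable_on_reindex_bij_betw[OF bij, of f] assms by (simp add: case_prod_unfold)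
  have "(\<Sum>\<^sub>\<infinity>k. f k) = (\<Sum>\<^sub>\<infinity>(r, l)\<in>{0..<b} \<times> UNIV. f (r + b * l))"
    using infsum_reindex_bij_betw[OF bij, of f] by (simp add: case_prod_unfold)
  also have "\<dots> = (\<Sum>\<^sub>\<infinity>r\<in>{0..<b}. \<Sum>\<^sub>\<infinity>l. f (r + b * l))"
    using infsum_Sigma'_banach[of "\<lambda>r l. f (r + b * l)" "{0..<b}" "\<lambda>_. UNIV"] s by simp
  finally show ?thesis by simp
qed

context S0_tuple
begin

lemma kern_herm: "kern j i t s = cnj (kern i j s t)"
proof -
  have "cnj (\<Sum>\<^sub>\<infinity>k::int. g i (s + step * of_int k) * cnj (g j (t + step * of_int k)))
      = (\<Sum>\<^sub>\<infinity>k::int. g j (t + step * of_int k) * cnj (g i (s + step * of_int k)))"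
    unfolding infsum_cnj[symmetric] by (intro infsum_cong) (simp add: mult.commute)
  then show ?thesis unfolding kern_def complex_cnj_mult complex_cnj_complex_of_real by (simp only:)
qed

lemma kern_finite_sum: "finite F \<Longrightarrow> (\<Sum>(i, n)\<in>F. cmod (kern j i t (t - of_int n))) \<le> step * (bound * bound)"
proof -
  assume F: "finite F"
  have eq: "kern j i t (t - of_int n) = fiber.gram t (of_real step) (j, 0) (i, n)" for i and n :: int
    by (simp add: gram_eq_kern)
  have "(\<Sum>(i, n)\<in>F. cmod (kern j i t (t - of_int n))) = (\<Sum>q\<in>F. cmod (fiber.gram t (of_real step) (j, 0) q))"
    by (intro sum.cong refl) (auto simp: eq)
  also have "\<dots> \<le> (\<Sum>\<^sub>\<infinity>q. cmod (fiber.gram t (of_real step) (j, 0) q))"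
    by (rule finite_sum_le_infsum) (use fiber.ell_one_gram F in \<open>auto simp: ell_one_def\<close>)
  also have "\<dots> \<le> step * (bound * bound)" using fiber.gram_bound[of t "of_real step" "(j, 0)"] step_pos by simp
  finally show ?thesis .
qed

end

section \<open>Sampling\<close>

lemma multiplesI: "c * of_int k \<in> multiples c"
  unfolding multiples_def by (rule rangeI)

locale sampled_tuple = S0_tuple g \<theta> for g :: "'n::finite \<Rightarrow> real \<Rightarrow> complex" and \<theta> +
  fixes a M :: nat
  assumes a_pos: "a > 0" and M_pos: "M > 0" and \<theta>_eq: "\<theta> = real a / real M"
    and P: "is_projection_in lborel (tf_algebra lborel tf_shift (lattice_R \<theta>))
           (alg_gram lborel tf_shift (lattice_R \<theta>) g g)"
begin

abbreviation X :: "real set" where "X \<equiv> multiples (1 / real a)"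

lemma step_eq: "step = real M / real a"
  unfolding step_def by (simp add: \<theta>_eq)

lemma sample_bij: "bij_betw (\<lambda>l::int. (1 / real a) * of_int l) UNIV X"
  by (rule bij_betw_multiples) (use a_pos in auto)

lemma X_shift: "x \<in> X \<Longrightarrow> x - of_int n \<in> X"
proof -
  assume "x \<in> X"
  then obtain l :: int where "x = (1 / real a) * of_int l" by (auto simp: multiples_def)
  then have "x - of_int n = (1 / real a) * of_int (l - int a * n)" using a_pos by (simp add: field_simps)
  then show ?thesis by (simp only: multiplesI)
qed

lemma X_shift_bij: "bij_betw (\<lambda>t. t - of_int n) X X"
proof (rule bij_betw_byWitness[where f'="\<lambda>t. t - of_int (- n)"])
  show "(\<lambda>t. t - of_int n) ` X \<subseteq> X" "(\<lambda>t. t - of_int (- n)) ` X \<subseteq> X"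
    using X_shift by blast+
qed simp_all

definition g1 :: "'n \<Rightarrow> real \<Rightarrow> complex" where
  "g1 j t = of_real (real a powr (- 1 / 2)) * restr (1 / real a) (g j) t"

lemma powr_square: "complex_of_real (real a powr (- 1 / 2)) * complex_of_real (real a powr (- 1 / 2)) = of_real (1 / real a)"
proof -
  have "real a powr (- 1 / 2) * real a powr (- 1 / 2) = 1 / real a"
    using a_pos by (simp add: powr_add[symmetric] powr_minus_divide)
  then show ?thesis by (simp only: of_real_mult[symmetric])
qed

lemma sample_ell_one: "ell_one (\<lambda>l::int. g j ((1 / real a) * of_int l))"
proof -
  obtain B where B: "\<And>t F. finite F \<Longrightarrow> (\<Sum>k\<in>F. cmod (g j (t + (1 / real a) * real_of_int k))) \<le> B"
    by (rule wiener_lattice_sum[OF S0_wiener[OF g_S0], of "1 / real a" j]) (use a_pos in auto)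
  have "sum_bounded B (\<lambda>l::int. g j ((1 / real a) * of_int l))"
    unfolding sum_bounded_def using B[of _ 0] by simp
  then show ?thesis by (rule sum_bounded_ell_one)
qed

lemma g1_ell1: "g1 j \<in> ell1 X"
proof -
  have "(\<lambda>l::int. cmod (g1 j ((1 / real a) * of_int l))) summable_on UNIV"
    using sample_ell_one[of j] unfolding g1_def restr_def if_P[OF multiplesI] norm_mult ell_one_def
    by (rule summable_on_cmult_right)
  then show ?thesis unfolding ell1_def using summable_on_reindex_bij_betw[OF sample_bij, of "\<lambda>t. cmod (g1 j t)"] by simp
qed

lemma contractions_aZ: "contractions (measure_aZ a) tf_shift (lattice_aZ \<theta> M)"
proof
  show "countable (lattice_aZ \<theta> M)" by (simp add: lattice_aZ_def countable_multiples)
  fix z h assume "z \<in> lattice_aZ \<theta> M" and h: "h \<in> L2 (measure_aZ a)"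
  then obtain n :: int where n: "fst z = of_int n" by (auto simp: lattice_aZ_def multiples_def)
  have c: "cmod (tf_shift z h t) = cmod (h (t - of_int n))" for t
    by (simp add: tf_shift_eq' n norm_mult)
  show "tf_shift z h \<in> L2 (measure_aZ a)"
    using h summable_on_reindex_bij_betw[OF X_shift_bij, of "\<lambda>t. (cmod (h t))\<^sup>2" n]
    unfolding L2_count_space c by simp
  show "L2_norm (measure_aZ a) (tf_shift z h) \<le> L2_norm (measure_aZ a) h"
    unfolding L2_norm_count_space c
    using infsum_reindex_bij_betw[OF X_shift_bij, of "\<lambda>t. (cmod (h t))\<^sup>2" n] by simp
qed

definition coef :: "'n \<Rightarrow> 'n \<Rightarrow> int \<Rightarrow> nat \<Rightarrow> complex" where
  "coef j i n m = L2_inner (measure_aZ a) (g1 j) (tf_shift (1 * of_int n, \<theta> * real m) (g1 i))"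

lemma coef_eq:
  "coef j i n m = of_real (1 / real a) * (\<Sum>\<^sub>\<infinity>l::int.
     (cis (- (2 * pi * (real m * of_int l / real M))) * cnj (g i ((1 / real a) * of_int l - of_int n))) * g j ((1 / real a) * of_int l))"
proof -
  have "coef j i n m = (\<Sum>\<^sub>\<infinity>l::int. g1 j ((1 / real a) * of_int l) * cnj (tf_shift (1 * of_int n, \<theta> * real m) (g1 i) ((1 / real a) * of_int l)))"
    unfolding coef_def L2_inner_count_space by (rule infsum_reindex_bij_betw[OF sample_bij, symmetric])
  also have "\<dots> = (\<Sum>\<^sub>\<infinity>l::int. (of_real (real a powr (- 1 / 2)) * of_real (real a powr (- 1 / 2))) *
     ((cis (- (2 * pi * (real m * of_int l / real M))) * cnj (g i ((1 / real a) * of_int l - of_int n))) * g j ((1 / real a) * of_int l)))"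
  proof (intro infsum_cong)
    fix l :: int
    have in_X: "(1 / real a) * of_int l \<in> X" "(1 / real a) * of_int l - of_int n \<in> X"
      by (rule multiplesI, rule X_shift, rule multiplesI)
    have ph: "2 * pi * (\<theta> * real m) * ((1 / real a) * of_int l) = 2 * pi * (real m * of_int l / real M)"
      using a_pos by (simp add: \<theta>_eq field_simps)
    show "g1 j ((1 / real a) * of_int l) * cnj (tf_shift (1 * of_int n, \<theta> * real m) (g1 i) ((1 / real a) * of_int l))
      = (of_real (real a powr (- 1 / 2)) * of_real (real a powr (- 1 / 2))) *
     ((cis (- (2 * pi * (real m * of_int l / real M))) * cnj (g i ((1 / real a) * of_int l - of_int n))) * g j ((1 / real a) * of_int l))"
      unfolding tf_shift_eq ph mult_1 g1_def restr_def if_P[OF in_X(1)] if_P[OF in_X(2)]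
      by (simp add: cis_cnj mult_ac)
  qed
  also have "\<dots> = of_real (1 / real a) * (\<Sum>\<^sub>\<infinity>l::int.
     (cis (- (2 * pi * (real m * of_int l / real M))) * cnj (g i ((1 / real a) * of_int l - of_int n))) * g j ((1 / real a) * of_int l))"
    unfolding powr_square by (rule infsum_cmult_right')
  finally show ?thesis .
qed

lemma coef_ell_one: "ell_one (\<lambda>n. coef j i n m)"
  unfolding coef_eq
proof (rule ell_one_cmult, rule Schur_ell_one[where Y=0 and y="\<lambda>_. 0" and B=bound])
  fix l :: int
  show "sum_bounded bound (\<lambda>n::int. cis (- (2 * pi * (real m * of_int l / real M))) * cnj (g i ((1 / real a) * of_int l - of_int n)))"
    unfolding sum_bounded_def
  proof (intro allI impI)
    fix F :: "int set" assume "finite F"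
    then have "finite ({i} \<times> F)" by simp
    then have "(\<Sum>p\<in>{i} \<times> F. cmod (entry ((1 / real a) * of_int l) p 0)) \<le> bound"
      by (rule fiber.cols[unfolded sum_bounded_def, rule_format])
    then show "(\<Sum>n\<in>F. cmod (cis (- (2 * pi * (real m * of_int l / real M))) * cnj (g i ((1 / real a) * of_int l - of_int n)))) \<le> bound"
      by (simp add: sum.cartesian_product' entry_def norm_mult)
  qed
qed (rule sample_ell_one, simp)

lemma lattice_aZ_bij: "bij_betw (\<lambda>(n, m). (1 * of_int n, \<theta> * real m)) ((UNIV :: int set) \<times> {..<M}) (lattice_aZ \<theta> M)"
proof -
  have "bij_betw (\<lambda>m. \<theta> * real m) {..<M} ((\<lambda>m. \<theta> * real m) ` {..<M})"
    using \<theta>_pos by (intro inj_on_imp_bij_betw) (auto simp: inj_on_def)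
  from bij_betw_map_prod[OF bij_betw_multiples[of 1] this] show ?thesis
    by (simp add: lattice_aZ_def map_prod_def)
qed

lemma coef_summable: "(\<lambda>z. cmod (L2_inner (measure_aZ a) (g1 j) (tf_shift z (g1 i)))) summable_on lattice_aZ \<theta> M"
proof -
  have "(\<lambda>z. norm (case z of (n, m) \<Rightarrow> coef j i n m)) summable_on (SIGMA n:UNIV. {..<M})"
  proof (rule Infinite_Sum.abs_summable_on_Sigma_iff[THEN iffD2], intro conjI ballI)
    have "((\<lambda>n. \<Sum>m<M. cmod (coef j i n m)) has_sum (\<Sum>m<M. \<Sum>\<^sub>\<infinity>n. cmod (coef j i n m))) UNIV"
      by (rule has_sum_finite_sum) (use coef_ell_one in \<open>auto simp: ell_one_def\<close>)
    then show "(\<lambda>n. norm (\<Sum>\<^sub>\<infinity>m\<in>{..<M}. norm (case (n, m) of (n, m) \<Rightarrow> coef j i n m))) summable_on UNIV"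
      by (auto simp: sum_nonneg dest: has_sum_imp_summable)
  qed auto
  then show ?thesis
    using summable_on_reindex_bij_betw[OF lattice_aZ_bij, of "\<lambda>z. cmod (L2_inner (measure_aZ a) (g1 j) (tf_shift z (g1 i)))"]
    by (simp add: coef_def case_prod_unfold)
qed

text \<open>
  With \<open>x = l0 / a\<close>, the modulations contribute \<open>\<Sum>m<M. exp (2 \<pi> i m (l0 - l) / M)\<close> to the sample at
  \<open>l / a\<close>, which keeps exactly the samples at \<open>x + (M / a) k = x + k / \<theta>\<close>.
\<close>

lemma coef_kernel:
  assumes x: "x \<in> X"
  shows "(\<Sum>m<M. coef j i n m * cis (2 * pi * (\<theta> * real m) * x)) = kern j i x (x - of_int n)"
proof -
  obtain l0 :: int where l0: "x = (1 / real a) * of_int l0" using x by (auto simp: multiples_def)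
  define w where "w l = g j ((1 / real a) * of_int l) * cnj (g i ((1 / real a) * of_int l - of_int n))" for l :: int
  define e where "e m l = cis (2 * pi * real m * of_int (l0 - l) / real M)" for m and l :: int
  obtain B where B: "\<And>t. cmod (g i t) \<le> B" using wiener_bounded[OF S0_wiener[OF g_S0]] by blast
  have w: "ell_one w"
    using ell_one_mult_bounded[OF sample_ell_one[of j], of "\<lambda>l. cnj (g i ((1 / real a) * of_int l - of_int n))" B] B
    by (simp add: w_def[abs_def] mult.commute)
  have ew: "(\<lambda>l. e m l * w l) summable_on UNIV" for m
    by (rule ell_one_summable, rule ell_one_mult_bounded[OF w, of _ 1]) (simp add: e_def)
  have 1: "coef j i n m * cis (2 * pi * (\<theta> * real m) * x) = of_real (1 / real a) * (\<Sum>\<^sub>\<infinity>l. e m l * w l)" for m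
  proof -
    have "2 * pi * (\<theta> * real m) * x = 2 * pi * real m * of_int l0 / real M"
      using a_pos by (simp add: \<theta>_eq l0 field_simps)
    then have "coef j i n m * cis (2 * pi * (\<theta> * real m) * x)
        = of_real (1 / real a) * ((\<Sum>\<^sub>\<infinity>l. (cis (- (2 * pi * (real m * of_int l / real M))) * cnj (g i ((1 / real a) * of_int l - of_int n))) * g j ((1 / real a) * of_int l))
          * cis (2 * pi * real m * of_int l0 / real M))"
      by (simp add: coef_eq mult.assoc)
    also have "(\<Sum>\<^sub>\<infinity>l. (cis (- (2 * pi * (real m * of_int l / real M))) * cnj (g i ((1 / real a) * of_int l - of_int n))) * g j ((1 / real a) * of_int l))
          * cis (2 * pi * real m * of_int l0 / real M) = (\<Sum>\<^sub>\<infinity>l. e m l * w l)"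
      unfolding infsum_cmult_left'[symmetric]
    proof (intro infsum_cong)
      fix l :: int
      have "e m l = cis (- (2 * pi * (real m * of_int l / real M))) * cis (2 * pi * real m * of_int l0 / real M)"
        unfolding e_def cis_mult by (rule arg_cong[where f=cis]) (simp add: field_simps diff_divide_distrib)
      then show "(cis (- (2 * pi * (real m * of_int l / real M))) * cnj (g i ((1 / real a) * of_int l - of_int n))) * g j ((1 / real a) * of_int l)
          * cis (2 * pi * real m * of_int l0 / real M) = e m l * w l"
        by (simp add: w_def mult_ac)
    qed
    finally show ?thesis .
  qed
  have "(\<Sum>m<M. coef j i n m * cis (2 * pi * (\<theta> * real m) * x)) = of_real (1 / real a) * (\<Sum>m<M. \<Sum>\<^sub>\<infinity>l. e m l * w l)"
    unfolding 1 sum_distrib_left ..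
  also have "(\<Sum>m<M. \<Sum>\<^sub>\<infinity>l. e m l * w l) = (\<Sum>\<^sub>\<infinity>l. \<Sum>m<M. e m l * w l)"
    by (rule infsumI[symmetric], rule has_sum_finite_sum_complex, rule has_sum_infsum[OF ew])
  also have "\<dots> = (\<Sum>\<^sub>\<infinity>l. (if int M dvd l0 - l then of_nat M else 0) * w l)"
    unfolding sum_distrib_right[symmetric] e_def sum_roots_of_unity[OF M_pos] ..
  also have "\<dots> = (\<Sum>\<^sub>\<infinity>l\<in>range (\<lambda>k. l0 + int M * k). of_nat M * w l)"
  proof (rule infsum_cong_neutral)
    fix l assume "l \<in> UNIV - range (\<lambda>k. l0 + int M * k)"
    then have "\<not> int M dvd l0 - l"
    proof (intro notI)
      assume "int M dvd l0 - l"
      then obtain k where "l0 - l = int M * k" by blast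
      then have "l = l0 + int M * (- k)" by (simp add: algebra_simps)
      then show False using \<open>l \<in> UNIV - range (\<lambda>k. l0 + int M * k)\<close> by blast
    qed
    then show "(if int M dvd l0 - l then of_nat M else 0) * w l = 0" by simp
  qed auto
  also have "\<dots> = (\<Sum>\<^sub>\<infinity>k. of_nat M * w (l0 + int M * k))"
    by (subst infsum_reindex) (use M_pos in \<open>auto simp: inj_on_def o_def\<close>)
  also have "\<dots> = of_nat M * (\<Sum>\<^sub>\<infinity>k. w (l0 + int M * k))" by (rule infsum_cmult_right')
  also have "of_real (1 / real a) * (of_nat M * (\<Sum>\<^sub>\<infinity>k. w (l0 + int M * k))) = kern j i x (x - of_int n)"
  proof -
    have "w (l0 + int M * k) = g j (x + step * of_int k) * cnj (g i (x - of_int n + step * of_int k))" for k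
    proof -
      have "(1 / real a) * of_int (l0 + int M * k) = x + step * of_int k"
        "(1 / real a) * of_int (l0 + int M * k) - of_int n = x - of_int n + step * of_int k"
        by (simp_all add: l0 step_eq distrib_left)
      then show ?thesis by (simp only: w_def)
    qed
    then show ?thesis unfolding kern_def step_eq by simp
  qed
  finally show ?thesis .
qed

lemma alg_inner_aZ:
  assumes h: "h \<in> L2 (measure_aZ a)" and x: "x \<in> X"
  shows "alg_inner (measure_aZ a) tf_shift (lattice_aZ \<theta> M) (g1 j) (g1 i) h x
    = (\<Sum>\<^sub>\<infinity>n::int. kern j i x (x - of_int n) * h (x - of_int n))"
proof -
  interpret contractions "measure_aZ a" tf_shift "lattice_aZ \<theta> M" by (rule contractions_aZ)
  define C where "C z = L2_inner (measure_aZ a) (g1 j) (tf_shift z (g1 i))" for z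
  have s: "(\<lambda>z. C z * tf_shift z h x) summable_on lattice_aZ \<theta> M"
    using AE_summable_op_series[OF coef_summable h subset_refl] x unfolding C_def AE_count_space by blast
  define G where "G = (\<lambda>(n, m). coef j i n m * tf_shift (1 * of_int n, \<theta> * real m) h x)"
  have G: "G summable_on UNIV \<times> {..<M}"
    using summable_on_reindex_bij_betw[OF lattice_aZ_bij, of "\<lambda>z. C z * tf_shift z h x"] s
    by (simp add: G_def case_prod_unfold coef_def C_def)
  have "alg_inner (measure_aZ a) tf_shift (lattice_aZ \<theta> M) (g1 j) (g1 i) h x = (\<Sum>\<^sub>\<infinity>z\<in>lattice_aZ \<theta> M. C z * tf_shift z h x)"
    using alg_inner_op_series(2)[OF coef_summable h] x unfolding C_def AE_count_space by blast
  also have "\<dots> = (\<Sum>\<^sub>\<infinity>z\<in>UNIV \<times> {..<M}. G z)"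
    using infsum_reindex_bij_betw[OF lattice_aZ_bij, of "\<lambda>z. C z * tf_shift z h x"]
    by (simp add: G_def case_prod_unfold coef_def C_def)
  also have "\<dots> = (\<Sum>\<^sub>\<infinity>n. \<Sum>\<^sub>\<infinity>m\<in>{..<M}. G (n, m))"
    using infsum_Sigma_banach[of G UNIV "\<lambda>_. {..<M}"] G by simp
  also have "\<dots> = (\<Sum>\<^sub>\<infinity>n::int. (\<Sum>m<M. coef j i n m * cis (2 * pi * (\<theta> * real m) * x)) * h (x - of_int n))"
    by (simp add: G_def tf_shift_eq sum_distrib_right mult.assoc)
  finally show ?thesis unfolding coef_kernel[OF x] .
qed

text \<open>
  Points of \<open>a\<^sup>-\<^sup>1\<int>\<close> in different cosets of \<open>\<int>\<close> do not interact.
\<close>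

definition K :: "'n \<Rightarrow> 'n \<Rightarrow> real \<Rightarrow> real \<Rightarrow> complex" where
  "K j i x y = (if x - y \<in> \<int> then kern j i x y else 0)"

lemma infsum_K:
  assumes "x \<in> X"
  shows "(\<Sum>\<^sub>\<infinity>y\<in>X. K j i x y * f y) = (\<Sum>\<^sub>\<infinity>n::int. kern j i x (x - of_int n) * f (x - of_int n))"
proof -
  have "(\<Sum>\<^sub>\<infinity>y\<in>X. K j i x y * f y) = (\<Sum>\<^sub>\<infinity>y\<in>range (\<lambda>n::int. x - of_int n). kern j i x y * f y)"
  proof (rule infsum_cong_neutral)
    fix y assume "y \<in> X - range (\<lambda>n::int. x - of_int n)"
    then have "x - y \<notin> \<int>" by (auto simp: Ints_def image_iff algebra_simps)
    then show "K j i x y * f y = 0" by (simp add: K_def)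
  qed (use X_shift[OF assms] in \<open>auto simp: K_def\<close>)
  also have "\<dots> = (\<Sum>\<^sub>\<infinity>n::int. kern j i x (x - of_int n) * f (x - of_int n))"
    by (subst infsum_reindex) (auto simp: inj_on_def o_def)
  finally show ?thesis .
qed

lemma K_bound:
  assumes "x \<in> X" "finite F" "F \<subseteq> UNIV \<times> X"
  shows "(\<Sum>(i, y)\<in>F. cmod (K j i x y)) \<le> step * (bound * bound)"
proof -
  define F' where "F' = (\<lambda>(i, y). (i, \<lfloor>x - y\<rfloor>)) ` {(i, y) \<in> F. x - y \<in> \<int>}"
  have inj: "inj_on (\<lambda>(i, y). (i, \<lfloor>x - y\<rfloor>)) {(i, y) \<in> F. x - y \<in> \<int>}"
  proof -
    have "y = y'" if "x - y \<in> \<int>" "x - y' \<in> \<int>" "\<lfloor>x - y\<rfloor> = \<lfloor>x - y'\<rfloor>" for y y'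
      using that by (auto elim!: Ints_cases)
    then show ?thesis by (auto simp: inj_on_def)
  qed
  have "(\<Sum>(i, y)\<in>F. cmod (K j i x y)) = (\<Sum>(i, y)\<in>{(i, y) \<in> F. x - y \<in> \<int>}. cmod (kern j i x y))"
    by (rule sum.mono_neutral_cong_right) (use assms in \<open>auto simp: K_def split: if_splits\<close>)
  also have "\<dots> = (\<Sum>(i, n)\<in>F'. cmod (kern j i x (x - of_int n)))"
    unfolding F'_def
  proof (subst sum.reindex[OF inj], intro sum.cong refl)
    fix z assume "z \<in> {(i, y) \<in> F. x - y \<in> \<int>}"
    then obtain i y where z: "z = (i, y)" "x - y \<in> \<int>" by auto
    then have "real_of_int \<lfloor>x - y\<rfloor> = x - y" by (auto elim!: Ints_cases)
    then show "(case z of (i, y) \<Rightarrow> cmod (kern j i x y))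
        = ((\<lambda>(i, n). cmod (kern j i x (x - of_int n))) \<circ> (\<lambda>(i, y). (i, \<lfloor>x - y\<rfloor>))) z"
      by (simp add: z)
  qed
  also have "\<dots> \<le> step * (bound * bound)"
    by (rule kern_finite_sum) (use assms in \<open>auto simp: F'_def intro: finite_subset[of _ F]\<close>)
  finally show ?thesis .
qed

text \<open>
  If \<open>x\<close> and \<open>z\<close> lie in one coset of \<open>\<int>\<close>, this is the idempotence of the Gram matrix of that
  coset; otherwise every summand vanishes.
\<close>

lemma K_idempotent:
  assumes "x \<in> X" "z \<in> X"
  shows "(\<Sum>i\<in>UNIV. \<Sum>\<^sub>\<infinity>y\<in>X. K j i x y * K i l y z) = K j l x z"
proof (cases "x - z \<in> \<int>")
  case False
  have z0: "K i l (x - of_int n) z = 0" for i and n :: int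
  proof -
    have "x - of_int n - z \<notin> \<int>"
      using False Ints_add[of "x - of_int n - z" "of_int n"] by auto
    then show ?thesis by (simp add: K_def)
  qed
  have "K j l x z = 0" using False by (simp add: K_def)
  then show ?thesis unfolding infsum_K[OF assms(1)] z0 by simp
next
  case True
  then obtain m :: int where m: "z = x - of_int m" by (auto elim!: Ints_cases simp: algebra_simps)
  have Kz: "K i l (x - of_int n) z = fiber.gram x (of_real step) (i, n) (l, m)" for i and n :: int
  proof -
    have "x - of_int n - z = of_int (m - n)" by (simp add: m)
    then show ?thesis by (simp add: K_def gram_eq_kern m)
  qed
  have s: "(\<lambda>q. fiber.gram x (of_real step) (j, 0) q * fiber.gram x (of_real step) q (l, m)) summable_on UNIV"
  proof -
    have "ell_one (\<lambda>q. fiber.gram x (of_real step) q (l, m) * fiber.gram x (of_real step) (j, 0) q)"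
      by (rule ell_one_mult_bounded[OF fiber.ell_one_gram fiber.gram_le])
    then show ?thesis by (simp add: mult.commute ell_one_summable)
  qed
  have "(\<Sum>i\<in>UNIV. \<Sum>\<^sub>\<infinity>y\<in>X. K j i x y * K i l y z)
      = (\<Sum>i\<in>UNIV. \<Sum>\<^sub>\<infinity>n. fiber.gram x (of_real step) (j, 0) (i, n) * fiber.gram x (of_real step) (i, n) (l, m))"
    unfolding infsum_K[OF assms(1)] Kz by (simp add: gram_eq_kern)
  also have "\<dots> = (\<Sum>\<^sub>\<infinity>q. fiber.gram x (of_real step) (j, 0) q * fiber.gram x (of_real step) q (l, m))"
    by (rule infsum_prod_finite[OF s, symmetric])
  also have "\<dots> = fiber.gram x (of_real step) (j, 0) (l, m)"
    by (rule fiber.gram_idempotent[OF column_fixed[OF P]])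
  also have "\<dots> = K j l x z" using True by (simp add: gram_eq_kern K_def m)
  finally show ?thesis .
qed

theorem sampled_projection:
  "is_projection_in (measure_aZ a) (tf_algebra (measure_aZ a) tf_shift (lattice_aZ \<theta> M))
     (alg_gram (measure_aZ a) tf_shift (lattice_aZ \<theta> M) g1 g1)"
proof (rule kernel_projection[where K=K and B="step * (bound * bound)"])
  interpret contractions "measure_aZ a" tf_shift "lattice_aZ \<theta> M" by (rule contractions_aZ)
  show "alg_gram (measure_aZ a) tf_shift (lattice_aZ \<theta> M) g1 g1 j i \<in> tf_algebra (measure_aZ a) tf_shift (lattice_aZ \<theta> M)" for j i
    unfolding alg_gram_def by (rule alg_inner_op_series(1)[OF coef_summable])
  show "K j i x y = cnj (K i j y x)" for i j x y
    unfolding K_def using kern_herm[of j i x y] minus_in_Ints_iff[of "x - y"] by auto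
  show "alg_gram (measure_aZ a) tf_shift (lattice_aZ \<theta> M) g1 g1 j i h x = (\<Sum>\<^sub>\<infinity>y\<in>X. K j i x y * h y)"
    if "h \<in> L2 (measure_aZ a)" "x \<in> X" for j i h x
    unfolding alg_gram_def using alg_inner_aZ[OF that] infsum_K[OF that(2)] by simp
qed (use K_bound K_idempotent in auto)

end

section \<open>Periodization\<close>

locale periodized_tuple = S0_tuple g \<theta> for g :: "'n::finite \<Rightarrow> real \<Rightarrow> complex" and \<theta> +
  fixes a b M N :: nat
  assumes a_pos: "a > 0" and b_pos: "b > 0" and M_pos: "M > 0" and N_pos: "N > 0"
    and \<theta>_eq: "\<theta> = real a / real M" "\<theta> = real b / real N"
    and P: "is_projection_in lborel (tf_algebra lborel tf_shift (lattice_R \<theta>))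
           (alg_gram lborel tf_shift (lattice_R \<theta>) g g)"
begin

lemma step_b: "step * real b = real N"
  unfolding step_def using \<theta>_eq(2) b_pos by simp

lemma step_M: "step = real M / real a"
  unfolding step_def using \<theta>_eq(1) by simp

lemma aN_eq: "a * N = b * M"
proof -
  have "real a / real M = real b / real N" using \<theta>_eq by simp
  then have "real (a * N) = real (b * M)" using M_pos N_pos by (simp add: field_simps)
  then show ?thesis by (simp only: of_nat_eq_iff)
qed

definition per :: "'n \<Rightarrow> real \<Rightarrow> complex" where
  "per i x = (\<Sum>\<^sub>\<infinity>l::int. g i (x + real N * of_int l))"

lemma per_shift: "per i (x + real N * of_int q) = per i x"
proof -
  have "bij_betw (\<lambda>l::int. q + l) UNIV UNIV" by (rule bij_betw_byWitness[where f'="\<lambda>l. l - q"]) auto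
  from infsum_reindex_bij_betw[OF this, of "\<lambda>l. g i (x + real N * of_int l)"]
  show ?thesis by (simp add: per_def algebra_simps)
qed

text \<open>
  The values on the coset \<open>t + \<int>\<close> of the periodization of \<open>g\<close>, shifted by \<open>step r\<close>.  Since
  \<open>step b = N\<close>, periodizing over \<open>N \<int>\<close> adds up the columns of \<open>entry t\<close> that are congruent to \<open>r\<close>
  modulo \<open>b\<close>.
\<close>

definition pcol :: "real \<Rightarrow> int \<Rightarrow> 'n \<times> int \<Rightarrow> complex" where
  "pcol t r q = per (fst q) (t - of_int (snd q) + step * of_int r)"

lemma pcol_shift: "pcol t r (i, n + int N * l) = pcol t r (i, n)"
proof -
  have "t - of_int (n + int N * l) + step * of_int r = (t - of_int n + step * of_int r) + real N * of_int (- l)" by simp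
  then show ?thesis unfolding pcol_def fst_conv snd_conv by (simp only: per_shift)
qed

lemma per_step_shift: "per i (x + step * of_int (k + int b * l)) = per i (x + step * of_int k)"
proof -
  have "x + step * of_int (k + int b * l) = (x + step * of_int k) + real N * of_int l"
    unfolding step_b[symmetric] by (simp add: algebra_simps)
  then show ?thesis by (simp only: per_shift)
qed

lemma g_per_step: "per i (x + step * of_int r) = (\<Sum>\<^sub>\<infinity>l::int. g i (x + step * of_int (r + int b * l)))"
  unfolding per_def step_b[symmetric] by (intro infsum_cong) (simp add: algebra_simps)

text \<open>
  The indicator of the residue class of \<open>r\<close> modulo \<open>b\<close>; being bounded, it can be paired with the
  columns of \<open>entry t\<close> in \<open>Schur_duality\<close>.
\<close>

definition sieve :: "int \<Rightarrow> int \<Rightarrow> complex" where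
  "sieve r k = (if int b dvd k - r then 1 else 0)"

lemma range_progression: "range (\<lambda>l. r + v * l) = {k :: int. v dvd k - r}"
proof (intro equalityI subsetI)
  fix k assume "k \<in> {k. v dvd k - r}"
  then obtain l where "k - r = v * l" by blast
  then have "k = r + v * l" by simp
  then show "k \<in> range (\<lambda>l. r + v * l)" by blast
qed auto

lemma infsum_progression:
  fixes f :: "int \<Rightarrow> complex"
  assumes "v \<noteq> 0"
  shows "(\<Sum>\<^sub>\<infinity>l. f (r + v * l)) = (\<Sum>\<^sub>\<infinity>k. (if v dvd k - r then 1 else 0) * f k)"
proof -
  have "(\<Sum>\<^sub>\<infinity>l. f (r + v * l)) = (\<Sum>\<^sub>\<infinity>k\<in>range (\<lambda>l. r + v * l). f k)"
    by (subst infsum_reindex) (use assms in \<open>auto simp: inj_on_def o_def\<close>)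
  also have "\<dots> = (\<Sum>\<^sub>\<infinity>k. (if v dvd k - r then 1 else 0) * f k)"
    by (rule infsum_cong_neutral) (auto simp: range_progression)
  finally show ?thesis .
qed

lemma pcol_eq: "pcol t r q = (\<Sum>\<^sub>\<infinity>k. sieve r k * entry t q k)"
  unfolding pcol_def g_per_step sieve_def entry_def
  by (rule infsum_progression[where f="\<lambda>k. g (fst q) (t - of_int (snd q) + step * of_int k)"]) (use b_pos in simp)

lemma pcol_bounded: "cmod (pcol t r q) \<le> bound"
proof -
  have e: "(\<lambda>k. cmod (entry t q k)) summable_on UNIV" using sum_bounded_ell_one[OF fiber.rows] unfolding ell_one_def .
  have s: "(\<lambda>k. cmod (sieve r k * entry t q k)) summable_on UNIV"
    by (rule summable_on_comparison_test[OF e]) (auto simp: sieve_def)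
  have "cmod (pcol t r q) \<le> (\<Sum>\<^sub>\<infinity>k. cmod (sieve r k * entry t q k))"
    unfolding pcol_eq by (rule norm_infsum_bound[OF s])
  also have "\<dots> \<le> (\<Sum>\<^sub>\<infinity>k. cmod (entry t q k))"
    by (rule infsum_mono[OF s e]) (auto simp: sieve_def)
  also have "\<dots> \<le> bound" by (rule sum_bounded_infsum[OF fiber.rows])
  finally show ?thesis .
qed

text \<open>
  Every column of \<open>entry t\<close> is fixed by the Gram matrix, hence so is a sum of columns.
\<close>

lemma gram_pcol: "(\<Sum>\<^sub>\<infinity>q. fiber.gram t (of_real step) p q * pcol t r q) = pcol t r p"
proof -
  have "(\<Sum>\<^sub>\<infinity>q. fiber.gram t (of_real step) p q * pcol t r q)
      = (\<Sum>\<^sub>\<infinity>q. (\<Sum>\<^sub>\<infinity>k. sieve r k * entry t q k) * fiber.gram t (of_real step) p q)"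
    unfolding pcol_eq by (intro infsum_cong) (rule mult.commute)
  also have "\<dots> = (\<Sum>\<^sub>\<infinity>k. sieve r k * (\<Sum>\<^sub>\<infinity>q. entry t q k * fiber.gram t (of_real step) p q))"
    by (rule Schur_duality[where a="\<lambda>k q. entry t q k" and Y=1, OF fiber.rows fiber.ell_one_gram, symmetric])
      (simp add: sieve_def)
  also have "\<dots> = (\<Sum>\<^sub>\<infinity>k. sieve r k * entry t p k)"
  proof (intro infsum_cong)
    fix k
    have "(\<Sum>\<^sub>\<infinity>q. entry t q k * fiber.gram t (of_real step) p q) = (\<Sum>\<^sub>\<infinity>q. fiber.gram t (of_real step) p q * entry t q k)"
      by (intro infsum_cong) (rule mult.commute)
    also have "\<dots> = entry t p k"
      unfolding fiber.gram_apply[OF sum_bounded_le[OF fiber.cols]] by (rule column_fixed[OF P])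
    finally show "sieve r k * (\<Sum>\<^sub>\<infinity>q. entry t q k * fiber.gram t (of_real step) p q) = sieve r k * entry t p k" by simp
  qed
  finally show ?thesis unfolding pcol_eq .
qed

definition kper :: "'n \<Rightarrow> 'n \<Rightarrow> real \<Rightarrow> real \<Rightarrow> complex" where
  "kper j i t s = of_real step * (\<Sum>r\<in>{0..<int b}. per j (t + step * of_int r) * cnj (per i (s + step * of_int r)))"

lemma kper_shift: "kper j i t (s + real N * of_int q) = kper j i t s"
proof -
  have "per i (s + real N * of_int q + step * of_int r) = per i (s + step * of_int r)" for r
    using per_shift[of i "s + step * of_int r" q] by (simp add: algebra_simps)
  then show ?thesis by (simp add: kper_def)
qed

text \<open>
  The left side is the Gram matrix applied to the indicator of \<open>{i} \<times> (n + N \<int>)\<close>.  The analysis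
  of this indicator is the conjugate of the periodization of \<open>g i\<close>, which is \<open>b\<close>-periodic in \<open>k\<close>;
  grouping the synthesis sum into residue classes modulo \<open>b\<close> periodizes \<open>g j\<close> as well.
\<close>

lemma kper_eq: "(\<Sum>\<^sub>\<infinity>l::int. kern j i t (t - of_int (n + int N * l))) = kper j i t (t - of_int n)"
proof -
  define h where "h q = (if fst q = i \<and> int N dvd snd q - n then 1 else 0 :: complex)" for q :: "'n \<times> int"
  have N0: "int N \<noteq> 0" using N_pos by simp
  have pick: "(\<Sum>\<^sub>\<infinity>q. F q * h q) = (\<Sum>\<^sub>\<infinity>l. F (i, n + int N * l))" for F :: "'n \<times> int \<Rightarrow> complex"
  proof -
    have r: "range (\<lambda>l. (i, n + int N * l)) = {q. fst q = i \<and> int N dvd snd q - n}"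
      using range_progression[of n "int N"] by (auto simp: set_eq_iff image_iff)
    have "(\<Sum>\<^sub>\<infinity>l. F (i, n + int N * l)) = (\<Sum>\<^sub>\<infinity>q\<in>range (\<lambda>l. (i, n + int N * l)). F q)"
      by (subst infsum_reindex) (use N0 in \<open>auto simp: inj_on_def o_def\<close>)
    also have "\<dots> = (\<Sum>\<^sub>\<infinity>q. F q * h q)"
      unfolding r by (rule infsum_cong_neutral) (auto simp: h_def)
    finally show ?thesis by simp
  qed
  have an: "fiber.analysis t h k = cnj (per i (t - of_int n + step * of_int k))" for k
  proof -
    have "fiber.analysis t h k = (\<Sum>\<^sub>\<infinity>l. cnj (entry t (i, n + int N * l) k))"
      unfolding fiber.analysis_def by (rule pick)
    also have "\<dots> = cnj (\<Sum>\<^sub>\<infinity>l. entry t (i, n + int N * l) k)" by (rule infsum_cnj)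
    also have "(\<Sum>\<^sub>\<infinity>l. entry t (i, n + int N * l) k) = (\<Sum>\<^sub>\<infinity>l. entry t (i, n + int N * (- l)) k)"
      by (rule infsum_reindex_bij_betw[symmetric]) (rule bij_betw_byWitness[where f'=uminus], auto)
    also have "\<dots> = per i (t - of_int n + step * of_int k)"
      unfolding per_def entry_def by (intro infsum_cong) (simp add: algebra_simps)
    finally show ?thesis .
  qed
  have h1: "cmod (h q) \<le> 1" for q by (simp add: h_def)
  have "(\<Sum>\<^sub>\<infinity>l::int. kern j i t (t - of_int (n + int N * l)))
      = (\<Sum>\<^sub>\<infinity>l::int. fiber.gram t (of_real step) (j, 0) (i, n + int N * l))"
    unfolding gram_eq_kern by simp
  also have "\<dots> = (\<Sum>\<^sub>\<infinity>q. fiber.gram t (of_real step) (j, 0) q * h q)" by (rule pick[symmetric])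
  also have "\<dots> = of_real step * fiber.synthesis t (fiber.analysis t h) (j, 0)" by (rule fiber.gram_apply[OF h1])
  also have "fiber.synthesis t (fiber.analysis t h) (j, 0)
      = (\<Sum>r\<in>{0..<int b}. per j (t + step * of_int r) * cnj (per i (t - of_int n + step * of_int r)))"
  proof -
    define f where "f k = entry t (j, 0) k * fiber.analysis t h k" for k
    have pb: "cmod (fiber.analysis t h k) \<le> bound" for k
      using pcol_bounded[of t k "(i, n)"] by (simp add: an pcol_def)
    have "ell_one (\<lambda>k. fiber.analysis t h k * entry t (j, 0) k)"
      by (rule ell_one_mult_bounded[OF sum_bounded_ell_one[OF fiber.rows] pb])
    then have s: "f summable_on UNIV" unfolding f_def by (simp add: mult.commute ell_one_summable)
    have "fiber.synthesis t (fiber.analysis t h) (j, 0) = (\<Sum>r\<in>{0..<int b}. \<Sum>\<^sub>\<infinity>l. f (r + int b * l))"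
      unfolding fiber.synthesis_def f_def[symmetric] by (rule infsum_residues[OF s]) (use b_pos in simp)
    also have "\<dots> = (\<Sum>r\<in>{0..<int b}. per j (t + step * of_int r) * cnj (per i (t - of_int n + step * of_int r)))"
    proof (intro sum.cong refl)
      fix r
      have "(\<Sum>\<^sub>\<infinity>l. f (r + int b * l))
          = (\<Sum>\<^sub>\<infinity>l. g j (t + step * of_int (r + int b * l)) * cnj (per i (t - of_int n + step * of_int r)))"
        unfolding f_def an per_step_shift by (simp add: entry_def)
      also have "\<dots> = per j (t + step * of_int r) * cnj (per i (t - of_int n + step * of_int r))"
        unfolding g_per_step[of j] by (rule infsum_cmult_left')
      finally show "(\<Sum>\<^sub>\<infinity>l. f (r + int b * l)) = per j (t + step * of_int r) * cnj (per i (t - of_int n + step * of_int r))" .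
    qed
    finally show ?thesis .
  qed
  finally show ?thesis unfolding kper_def .
qed

text \<open>
  The identity of \<open>gram_pcol\<close>, with the sum over \<open>n \<in> \<int>\<close> grouped into residue classes modulo
  \<open>N\<close>: the function \<open>pcol\<close> is constant on them, and the kernel adds up to \<open>kper\<close>.
\<close>

lemma kper_per: "(\<Sum>i\<in>UNIV. \<Sum>n\<in>{0..<int N}. kper j i t (t - of_int n) * per i (t - of_int n + step * of_int r))
    = per j (t + step * of_int r)"
proof -
  define F where "F q = fiber.gram t (of_real step) (j, 0) q * pcol t r q" for q
  have "ell_one (\<lambda>q. pcol t r q * fiber.gram t (of_real step) (j, 0) q)"
    by (rule ell_one_mult_bounded[OF fiber.ell_one_gram pcol_bounded])
  then have e: "ell_one F" by (simp add: F_def[abs_def] mult.commute)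
  then have s: "F summable_on UNIV" by (rule ell_one_summable)
  have si: "(\<lambda>n. F (i, n)) summable_on UNIV" for i
    using summable_on_reindex[of "\<lambda>n. (i, n)" UNIV F] summable_on_subset_banach[OF s, of "range (\<lambda>n. (i, n))"]
    by (auto simp: inj_on_def o_def)
  have "per j (t + step * of_int r) = (\<Sum>\<^sub>\<infinity>q. F q)"
    unfolding F_def gram_pcol by (simp add: pcol_def)
  also have "\<dots> = (\<Sum>i\<in>UNIV. \<Sum>\<^sub>\<infinity>n. F (i, n))" by (rule infsum_prod_finite[OF s])
  also have "\<dots> = (\<Sum>i\<in>UNIV. \<Sum>n\<in>{0..<int N}. \<Sum>\<^sub>\<infinity>l. F (i, n + int N * l))"
    by (intro sum.cong refl infsum_residues si) (use N_pos in simp)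
  also have "\<dots> = (\<Sum>i\<in>UNIV. \<Sum>n\<in>{0..<int N}. kper j i t (t - of_int n) * per i (t - of_int n + step * of_int r))"
  proof (intro sum.cong refl)
    fix i and n :: int
    have "(\<Sum>\<^sub>\<infinity>l. F (i, n + int N * l)) = (\<Sum>\<^sub>\<infinity>l. kern j i t (t - of_int (n + int N * l)) * pcol t r (i, n))"
      unfolding F_def pcol_shift gram_eq_kern by simp
    also have "\<dots> = kper j i t (t - of_int n) * pcol t r (i, n)"
      unfolding kper_eq[symmetric] by (rule infsum_cmult_left')
    finally show "(\<Sum>\<^sub>\<infinity>l. F (i, n + int N * l)) = kper j i t (t - of_int n) * per i (t - of_int n + step * of_int r)"
      by (simp add: pcol_def)
  qed
  finally show ?thesis by simp
qed

lemma kper_idempotent: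
  "(\<Sum>i\<in>UNIV. \<Sum>n\<in>{0..<int N}. kper j i t (t - of_int n) * kper i l (t - of_int n) s) = kper j l t s"
proof -
  have "(\<Sum>i\<in>UNIV. \<Sum>n\<in>{0..<int N}. kper j i t (t - of_int n) * kper i l (t - of_int n) s)
      = (\<Sum>i\<in>UNIV. \<Sum>n\<in>{0..<int N}. \<Sum>r\<in>{0..<int b}.
          of_real step * ((kper j i t (t - of_int n) * per i (t - of_int n + step * of_int r)) * cnj (per l (s + step * of_int r))))"
    unfolding kper_def[of _ l] sum_distrib_left by (intro sum.cong refl) (simp add: mult_ac)
  also have "\<dots> = (\<Sum>i\<in>UNIV. \<Sum>r\<in>{0..<int b}. \<Sum>n\<in>{0..<int N}.
          of_real step * ((kper j i t (t - of_int n) * per i (t - of_int n + step * of_int r)) * cnj (per l (s + step * of_int r))))"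
    by (intro sum.cong refl sum.swap)
  also have "\<dots> = (\<Sum>r\<in>{0..<int b}. \<Sum>i\<in>UNIV. \<Sum>n\<in>{0..<int N}.
          of_real step * ((kper j i t (t - of_int n) * per i (t - of_int n + step * of_int r)) * cnj (per l (s + step * of_int r))))"
    by (rule sum.swap)
  also have "\<dots> = (\<Sum>r\<in>{0..<int b}. of_real step * ((\<Sum>i\<in>UNIV. \<Sum>n\<in>{0..<int N}.
          kper j i t (t - of_int n) * per i (t - of_int n + step * of_int r)) * cnj (per l (s + step * of_int r))))"
    by (simp only: sum_distrib_left sum_distrib_right)
  also have "\<dots> = kper j l t s"
    unfolding kper_per unfolding kper_def sum_distrib_left ..
  finally show ?thesis .
qed

definition d :: nat where "d = a * N"

lemma d_eq: "int d = int a * int N" "int d = int M * int b"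
  using aN_eq by (simp_all add: d_def mult.commute flip: of_nat_mult)

lemma d_pos: "d > 0" using a_pos N_pos by (simp add: d_def)

abbreviation Y :: "int set" where "Y \<equiv> {0..<int d}"

definition sample :: "int \<Rightarrow> real" where "sample s = of_int s / real a"

definition g2 :: "'n \<Rightarrow> int \<Rightarrow> complex" where
  "g2 j t = of_real (real a powr (- 1 / 2)) * periodize (1 / real a) d (restr (1 / real a) (g j)) t"

lemma g2_eq: "g2 j s = of_real (real a powr (- 1 / 2)) * per j (sample s)"
proof -
  have aN: "1 / real a * real d = real N" using a_pos by (simp add: d_def)
  have b1: "bij_betw (\<lambda>l::int. real N * of_int l) UNIV (multiples (1 / real a * real d))"
    unfolding aN by (rule bij_betw_multiples) (use N_pos in simp)
  have b2: "bij_betw (\<lambda>l::int. - l) UNIV UNIV" by (rule bij_betw_byWitness[where f'=uminus]) auto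
  have r: "restr (1 / real a) (g j) (1 / real a * of_int s - real N * of_int l) = g j (sample s + real N * of_int (- l))" for l :: int
  proof -
    have "1 / real a * of_int s - real N * of_int l = (1 / real a) * of_int (s - int (a * N) * l)"
      using a_pos by (simp add: field_simps)
    then have "1 / real a * of_int s - real N * of_int l \<in> multiples (1 / real a)"
      unfolding multiples_def by (metis rangeI)
    then show ?thesis by (simp add: restr_def sample_def)
  qed
  have "periodize (1 / real a) d (restr (1 / real a) (g j)) s = (\<Sum>\<^sub>\<infinity>l::int. g j (sample s + real N * of_int (- l)))"
    unfolding periodize_def by (subst infsum_reindex_bij_betw[OF b1, symmetric]) (simp only: r)
  also have "\<dots> = per j (sample s)"
    unfolding per_def by (rule infsum_reindex_bij_betw[OF b2])
  finally show ?thesis by (simp add: g2_def)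
qed

lemma sample_mod: "sample (s mod int d) = sample s + real N * of_int (- (s div int d))"
proof -
  have "s mod int d = s - int d * (s div int d)" by (simp add: minus_mult_div_eq_mod)
  then have "real_of_int (s mod int d) = of_int s - real d * of_int (s div int d)" by simp
  then show ?thesis using a_pos by (simp add: sample_def d_def field_simps)
qed

lemma per_sample_mod: "per i (sample (s mod int d) + x) = per i (sample s + x)"
  using per_shift[of i "sample s + x" "- (s div int d)"] by (simp add: sample_mod algebra_simps)

lemma shift_bij: "bij_betw (\<lambda>t. (t - x) mod int d) Y Y"
proof (rule bij_betw_byWitness[where f'="\<lambda>t. (t + x) mod int d"])
  show "\<forall>t\<in>Y. ((t - x) mod int d + x) mod int d = t" "\<forall>t\<in>Y. ((t + x) mod int d - x) mod int d = t"
    by (simp_all add: mod_add_left_eq mod_diff_left_eq)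
qed (use d_pos in auto)

lemma L2_Zd: "h \<in> L2 (measure_Zd d)"
  by (simp add: L2_count_space)

lemma contractions_Zd: "contractions (measure_Zd d) (tf_shift_mod d) (lattice_Zd a b M N)"
proof
  show "countable (lattice_Zd a b M N)" by (simp add: lattice_Zd_def)
  fix z :: "int \<times> int" and h
  show "tf_shift_mod d z h \<in> L2 (measure_Zd d)" by (rule L2_Zd)
  have c: "cmod (tf_shift_mod d z h t) = cmod (h ((t - fst z) mod int d))" for t
  proof -
    have "complex_of_real (2 * pi) * \<i> * of_int (snd z) * of_int t / of_nat d = \<i> * of_real (2 * pi * of_int (snd z) * of_int t / real d)"
      by simp
    then show ?thesis by (simp only: tf_shift_mod_def case_prod_unfold norm_mult norm_exp_i_times mult_1)
  qed
  show "L2_norm (measure_Zd d) (tf_shift_mod d z h) \<le> L2_norm (measure_Zd d) h"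
    unfolding L2_norm_count_space c
    using infsum_reindex_bij_betw[OF shift_bij, of "\<lambda>t. (cmod (h t))\<^sup>2" "fst z"] by simp
qed

lemma tf_shift_mod_eq:
  "tf_shift_mod d (int (a * n), int (b * m)) h t = cis (2 * pi * real m * of_int t / real M) * h ((t - int a * int n) mod int d)"
proof -
  have bd: "real b / real d = 1 / real M" using b_pos M_pos aN_eq by (simp add: d_def)
  have "2 * complex_of_real pi * \<i> * of_int (int (b * m)) * of_int t / of_nat d
      = \<i> * of_real (2 * pi * real m * of_int t * (real b / real d))" by simp
  then show ?thesis unfolding bd by (simp add: tf_shift_mod_def cis_conv_exp)
qed

definition coef :: "'n \<Rightarrow> 'n \<Rightarrow> nat \<Rightarrow> nat \<Rightarrow> complex" where
  "coef j i n m = L2_inner (measure_Zd d) (g2 j) (tf_shift_mod d (int (a * n), int (b * m)) (g2 i))"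

text \<open>
  Because \<open>b / d = 1 / M\<close>, the sum over the modulations keeps the points \<open>s\<close> of \<open>\<int>\<^sub>d\<close> that are
  congruent to \<open>x\<close> modulo \<open>M\<close>.  They are the \<open>b\<close> points \<open>x + M r\<close>, and \<open>M / a = step\<close>.
\<close>

lemma coef_kernel:
  "(\<Sum>m<M. coef j i n m * cis (2 * pi * real m * of_int x / real M)) = kper j i (sample x) (sample x - of_int (int n))"
proof -
  define C where "C = complex_of_real (1 / real a)"
  have CC: "complex_of_real (real a powr (- 1 / 2)) * complex_of_real (real a powr (- 1 / 2)) = C"
  proof -
    have "real a powr (- 1 / 2) * real a powr (- 1 / 2) = 1 / real a"
      using a_pos by (simp add: powr_add[symmetric] powr_minus_divide)
    then show ?thesis unfolding C_def by (simp only: of_real_mult[symmetric])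
  qed
  define w where "w s = per j (sample s) * cnj (per i (sample s - of_int (int n)))" for s
  have sn: "sample (s - int a * int n) = sample s - of_int (int n)" for s
    using a_pos by (simp add: sample_def field_simps)
  have g2n: "g2 i ((s - int a * int n) mod int d) = of_real (real a powr (- 1 / 2)) * per i (sample s - of_int (int n))" for s
    unfolding g2_eq using per_sample_mod[of i "s - int a * int n" 0] by (simp add: sn)
  have "coef j i n m = (\<Sum>s\<in>Y. C * (cis (- (2 * pi * real m * of_int s / real M)) * w s))" for m
  proof -
    have "coef j i n m = (\<Sum>s\<in>Y. g2 j s * cnj (tf_shift_mod d (int (a * n), int (b * m)) (g2 i) s))"
      unfolding coef_def L2_inner_count_space by simp
    also have "\<dots> = (\<Sum>s\<in>Y. (of_real (real a powr (- 1 / 2)) * of_real (real a powr (- 1 / 2))) * (cis (- (2 * pi * real m * of_int s / real M)) * w s))"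
      unfolding tf_shift_mod_eq g2n g2_eq[of j] w_def by (intro sum.cong refl) (simp add: cis_cnj mult_ac)
    finally show ?thesis unfolding CC .
  qed
  then have "(\<Sum>m<M. coef j i n m * cis (2 * pi * real m * of_int x / real M))
      = (\<Sum>m<M. \<Sum>s\<in>Y. C * (cis (2 * pi * real m * of_int (x - s) / real M) * w s))"
  proof (simp only: sum_distrib_right, intro sum.cong refl)
    fix m and s :: int
    have "cis (2 * pi * real m * of_int (x - s) / real M)
        = cis (- (2 * pi * real m * of_int s / real M)) * cis (2 * pi * real m * of_int x / real M)"
      unfolding cis_mult by (rule arg_cong[where f=cis]) (simp add: right_diff_distrib diff_divide_distrib)
    then show "C * (cis (- (2 * pi * real m * of_int s / real M)) * w s) * cis (2 * pi * real m * of_int x / real M)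
        = C * (cis (2 * pi * real m * of_int (x - s) / real M) * w s)"
      by (simp only: mult_ac)
  qed
  also have "\<dots> = (\<Sum>s\<in>Y. \<Sum>m<M. C * (cis (2 * pi * real m * of_int (x - s) / real M) * w s))"
    by (rule sum.swap)
  also have "\<dots> = (\<Sum>s\<in>Y. C * ((if int M dvd x - s then of_nat M else 0) * w s))"
    unfolding sum_distrib_left[symmetric] sum_distrib_right[symmetric] sum_roots_of_unity[OF M_pos] ..
  also have "\<dots> = (\<Sum>s\<in>{s \<in> Y. int M dvd x - s}. C * (of_nat M * w s))"
    by (rule sum.mono_neutral_cong_right) auto
  also have "\<dots> = (\<Sum>r\<in>{0..<int b}. C * (of_nat M * w ((x + 1 * (int M * r)) mod (int M * int b))))"
    unfolding d_eq(2)
    by (rule sum.reindex_bij_betw[OF bij_betw_residues, symmetric]) (use M_pos b_pos in auto)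
  also have "\<dots> = kper j i (sample x) (sample x - of_int (int n))"
    unfolding kper_def sum_distrib_left
  proof (intro sum.cong refl)
    fix r
    have sr: "sample (x + int M * r) = sample x + step * of_int r"
      by (simp add: sample_def step_M add_divide_distrib)
    have p1: "per j (sample ((x + int M * r) mod int d)) = per j (sample x + step * of_int r)"
      using per_sample_mod[of j "x + int M * r" 0] unfolding sr by simp
    have p2: "per i (sample ((x + int M * r) mod int d) - of_int (int n)) = per i (sample x - of_int (int n) + step * of_int r)"
      using per_sample_mod[of i "x + int M * r" "- of_int (int n)"] unfolding sr by (simp add: algebra_simps)
    have "w ((x + 1 * (int M * r)) mod (int M * int b))
        = per j (sample x + step * of_int r) * cnj (per i (sample x - of_int (int n) + step * of_int r))"
      unfolding w_def d_eq(2)[symmetric] mult_1 p1 p2 ..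
    moreover have "C * of_nat M = of_real step" by (simp add: C_def step_M)
    ultimately show "C * (of_nat M * w ((x + 1 * (int M * r)) mod (int M * int b)))
        = of_real step * (per j (sample x + step * of_int r) * cnj (per i (sample x - of_int (int n) + step * of_int r)))"
      by (simp only: mult.assoc[symmetric])
  qed
  finally show ?thesis .
qed

lemma finite_lattice_Zd: "finite (lattice_Zd a b M N)"
  by (simp add: lattice_Zd_def)

lemma lattice_Zd_bij: "bij_betw (\<lambda>(n, m). (int (a * n), int (b * m))) ({..<N} \<times> {..<M}) (lattice_Zd a b M N)"
proof -
  have "bij_betw (\<lambda>n. int (a * n)) {..<N} ((\<lambda>n. int (a * n)) ` {..<N})"
    "bij_betw (\<lambda>m. int (b * m)) {..<M} ((\<lambda>m. int (b * m)) ` {..<M})"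
    using a_pos b_pos by (intro inj_on_imp_bij_betw; auto simp: inj_on_def)+
  from bij_betw_map_prod[OF this] show ?thesis
    by (simp add: lattice_Zd_def map_prod_def)
qed

text \<open>
  A translation by \<open>a n\<close> in \<open>\<int>\<^sub>d\<close> is a translation by \<open>n\<close> on the real line, so only points that
  are congruent modulo \<open>a\<close> interact.
\<close>

definition K :: "'n \<Rightarrow> 'n \<Rightarrow> int \<Rightarrow> int \<Rightarrow> complex" where
  "K j i x y = (if int a dvd x - y then kper j i (sample x) (sample y) else 0)"

lemma sum_K: "(\<Sum>\<^sub>\<infinity>y\<in>Y. K j i x y * f y)
    = (\<Sum>n\<in>{0..<int N}. kper j i (sample x) (sample x - of_int n) * f ((x - int a * n) mod int d))"
proof -
  have "(\<Sum>\<^sub>\<infinity>y\<in>Y. K j i x y * f y) = (\<Sum>y\<in>{y \<in> Y. int a dvd x - y}. kper j i (sample x) (sample y) * f y)"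
    by (simp, rule sum.mono_neutral_cong_right) (auto simp: K_def)
  also have "\<dots> = (\<Sum>n\<in>{0..<int N}. kper j i (sample x) (sample ((x + (-1) * (int a * n)) mod (int a * int N)))
      * f ((x + (-1) * (int a * n)) mod (int a * int N)))"
    unfolding d_eq(1)
    by (rule sum.reindex_bij_betw[OF bij_betw_residues, symmetric]) (use a_pos N_pos in auto)
  also have "\<dots> = (\<Sum>n\<in>{0..<int N}. kper j i (sample x) (sample x - of_int n) * f ((x - int a * n) mod int d))"
  proof (intro sum.cong refl)
    fix n
    have sn: "sample (x - int a * n) = sample x - of_int n" using a_pos by (simp add: sample_def field_simps)
    have "kper j i (sample x) (sample ((x - int a * n) mod int d)) = kper j i (sample x) (sample x - of_int n)"
      unfolding sample_mod kper_shift sn ..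
    then show "kper j i (sample x) (sample ((x + (-1) * (int a * n)) mod (int a * int N)))
      * f ((x + (-1) * (int a * n)) mod (int a * int N))
      = kper j i (sample x) (sample x - of_int n) * f ((x - int a * n) mod int d)"
      unfolding d_eq(1)[symmetric] by simp
  qed
  finally show ?thesis .
qed

lemma alg_inner_Zd:
  assumes x: "x \<in> Y"
  shows "alg_inner (measure_Zd d) (tf_shift_mod d) (lattice_Zd a b M N) (g2 j) (g2 i) h x
    = (\<Sum>\<^sub>\<infinity>y\<in>Y. K j i x y * h y)"
proof -
  interpret contractions "measure_Zd d" "tf_shift_mod d" "lattice_Zd a b M N" by (rule contractions_Zd)
  define C where "C z = L2_inner (measure_Zd d) (g2 j) (tf_shift_mod d z (g2 i))" for z
  have s: "(\<lambda>z. cmod (L2_inner (measure_Zd d) (g2 j) (tf_shift_mod d z (g2 i)))) summable_on lattice_Zd a b M N"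
    by (rule summable_on_finite[OF finite_lattice_Zd])
  have "alg_inner (measure_Zd d) (tf_shift_mod d) (lattice_Zd a b M N) (g2 j) (g2 i) h x
      = (\<Sum>z\<in>lattice_Zd a b M N. C z * tf_shift_mod d z h x)"
    using alg_inner_op_series(2)[OF s L2_Zd, of h] x finite_lattice_Zd unfolding C_def AE_count_space by simp
  also have "\<dots> = (\<Sum>(n, m)\<in>{..<N} \<times> {..<M}. coef j i n m * tf_shift_mod d (int (a * n), int (b * m)) h x)"
    using sum.reindex_bij_betw[OF lattice_Zd_bij, of "\<lambda>z. C z * tf_shift_mod d z h x"]
    by (simp only: case_prod_unfold coef_def C_def)
  also have "\<dots> = (\<Sum>n<N. \<Sum>m<M. coef j i n m * tf_shift_mod d (int (a * n), int (b * m)) h x)"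
    by (rule sum.cartesian_product[symmetric])
  also have "\<dots> = (\<Sum>n<N. (\<Sum>m<M. coef j i n m * cis (2 * pi * real m * of_int x / real M)) * h ((x - int a * int n) mod int d))"
    unfolding tf_shift_mod_eq sum_distrib_right by (simp only: mult.assoc)
  also have "\<dots> = (\<Sum>n<N. kper j i (sample x) (sample x - of_int (int n)) * h ((x - int a * int n) mod int d))"
    unfolding coef_kernel ..
  also have "\<dots> = (\<Sum>n\<in>int ` {..<N}. kper j i (sample x) (sample x - of_int n) * h ((x - int a * n) mod int d))"
    by (subst sum.reindex) (auto simp: o_def)
  also have "int ` {..<N} = {0..<int N}"
    by (simp add: image_int_atLeastLessThan[of 0 N, simplified] lessThan_atLeast0)
  finally show ?thesis unfolding sum_K .
qed

lemma K_idempotent: "(\<Sum>i\<in>UNIV. \<Sum>\<^sub>\<infinity>y\<in>Y. K j i x y * K i l y z) = K j l x z"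
proof -
  have Ky: "K i l ((x - int a * n) mod int d) z
      = (if int a dvd x - z then kper i l (sample x - of_int n) (sample z) else 0)" for i n
  proof -
    define y where "y = (x - int a * n) mod int d"
    have "int d dvd (x - int a * n) - y" unfolding y_def by (rule dvd_minus_mod)
    then have "int a dvd (x - int a * n) - y" unfolding d_eq(1) by (rule dvd_mult_left)
    then have "int a dvd (x - z) - int a * n \<longleftrightarrow> int a dvd y - z"
      using dvd_add_right_iff[of "int a" "(x - int a * n) - y" "y - z"] by (simp add: algebra_simps)
    then have dv: "int a dvd y - z \<longleftrightarrow> int a dvd x - z"
      using dvd_diff_left_iff[of "int a" "int a * n" "x - z"] by simp
    have "kper i l (sample y) (sample z) = kper i l (sample x - of_int n) (sample z)"
    proof -
      have sn: "sample (x - int a * n) = sample x - of_int n" using a_pos by (simp add: sample_def field_simps)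
      show ?thesis unfolding kper_def y_def per_sample_mod sn ..
    qed
    then show ?thesis using dv unfolding K_def y_def[symmetric] by simp
  qed
  show ?thesis
  proof (cases "int a dvd x - z")
    case True
    have "(\<Sum>i\<in>UNIV. \<Sum>\<^sub>\<infinity>y\<in>Y. K j i x y * K i l y z) = kper j l (sample x) (sample z)"
      unfolding sum_K Ky if_P[OF True] by (rule kper_idempotent)
    then show ?thesis using True by (simp add: K_def)
  next
    case False
    then show ?thesis unfolding sum_K Ky if_not_P[OF False] by (simp add: K_def)
  qed
qed

lemma kper_herm: "kper j i t s = cnj (kper i j s t)"
  by (simp add: kper_def mult.commute)

theorem periodized_projection:
  "is_projection_in (measure_Zd d) (tf_algebra (measure_Zd d) (tf_shift_mod d) (lattice_Zd a b M N))
     (alg_gram (measure_Zd d) (tf_shift_mod d) (lattice_Zd a b M N) g2 g2)"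
proof (rule kernel_projection[where K=K and B="\<Sum>j\<in>UNIV. \<Sum>x\<in>Y. \<Sum>q\<in>UNIV \<times> Y. cmod (K j (fst q) x (snd q))"])
  interpret contractions "measure_Zd d" "tf_shift_mod d" "lattice_Zd a b M N" by (rule contractions_Zd)
  show "alg_gram (measure_Zd d) (tf_shift_mod d) (lattice_Zd a b M N) g2 g2 j i
      \<in> tf_algebra (measure_Zd d) (tf_shift_mod d) (lattice_Zd a b M N)" for j i
    unfolding alg_gram_def by (rule alg_inner_op_series(1)[OF summable_on_finite[OF finite_lattice_Zd]])
  show "K j i x y = cnj (K i j y x)" for i j x y
    unfolding K_def using kper_herm[of j i "sample x" "sample y"] dvd_diff_commute[of "int a" x y] by simp
  show "alg_gram (measure_Zd d) (tf_shift_mod d) (lattice_Zd a b M N) g2 g2 j i h x = (\<Sum>\<^sub>\<infinity>y\<in>Y. K j i x y * h y)"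
    if "x \<in> Y" for j i h x
    unfolding alg_gram_def by (rule alg_inner_Zd[OF that])
  show "(\<Sum>(i, y)\<in>F. cmod (K j i x y)) \<le> (\<Sum>j\<in>UNIV. \<Sum>x\<in>Y. \<Sum>q\<in>UNIV \<times> Y. cmod (K j (fst q) x (snd q)))"
    if x: "x \<in> Y" and F: "finite F" "F \<subseteq> UNIV \<times> Y" for j x F
  proof -
    have "(\<Sum>(i, y)\<in>F. cmod (K j i x y)) = (\<Sum>q\<in>F. cmod (K j (fst q) x (snd q)))" by (simp add: case_prod_unfold)
    also have "\<dots> \<le> (\<Sum>q\<in>UNIV \<times> Y. cmod (K j (fst q) x (snd q)))" by (rule sum_mono2) (use F in auto)
    also have "\<dots> \<le> (\<Sum>x\<in>Y. \<Sum>q\<in>UNIV \<times> Y. cmod (K j (fst q) x (snd q)))"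
      using x by (intro member_le_sum) (auto intro: sum_nonneg)
    also have "\<dots> \<le> (\<Sum>j\<in>UNIV. \<Sum>x\<in>Y. \<Sum>q\<in>UNIV \<times> Y. cmod (K j (fst q) x (snd q)))"
      by (rule member_le_sum[where f="\<lambda>j. \<Sum>x\<in>Y. \<Sum>q\<in>UNIV \<times> Y. cmod (K j (fst q) x (snd q))"]) (auto intro!: sum_nonneg)
    finally show ?thesis .
  qed
qed (rule K_idempotent)

end

theorem theorem6p1:
  fixes a b M N d :: nat and \<theta> :: real
    and g :: "'n::finite \<Rightarrow> real \<Rightarrow> complex"
    and g1 :: "'n \<Rightarrow> real \<Rightarrow> complex"
    and g2 :: "'n \<Rightarrow> int \<Rightarrow> complex"
  assumes "a > 0" "b > 0" "M > 0" "N > 0"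
    and "\<theta> = real a / real M" and "\<theta> = real b / real N"
    and "d = a * N"
    and "\<And>j. g j \<in> S0"
    and "is_projection_in lborel (tf_algebra lborel tf_shift (lattice_R \<theta>))
           (alg_gram lborel tf_shift (lattice_R \<theta>) g g)"
    and "g1 = (\<lambda>j t. of_real (real a powr (- 1 / 2)) * restr (1 / real a) (g j) t)"
    and "g2 = (\<lambda>j t. of_real (real a powr (- 1 / 2)) *
                 periodize (1 / real a) d (restr (1 / real a) (g j)) t)"
  shows "module_norm lborel tf_shift (lattice_R \<theta>) g \<le> adjoint_const \<theta> g
    \<and> ((\<forall>j. g1 j \<in> ell1 (multiples (1 / real a))) \<and>
       is_projection_in (measure_aZ a) (tf_algebra (measure_aZ a) tf_shift (lattice_aZ \<theta> M))
         (alg_gram (measure_aZ a) tf_shift (lattice_aZ \<theta> M) g1 g1) \<and>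
       module_norm (measure_aZ a) tf_shift (lattice_aZ \<theta> M) g1 \<le> adjoint_const \<theta> g)
    \<and> (is_projection_in (measure_Zd d) (tf_algebra (measure_Zd d) (tf_shift_mod d) (lattice_Zd a b M N))
         (alg_gram (measure_Zd d) (tf_shift_mod d) (lattice_Zd a b M N) g2 g2) \<and>
       module_norm (measure_Zd d) (tf_shift_mod d) (lattice_Zd a b M N) g2 \<le> adjoint_const \<theta> g)"
proof -
  have \<theta>_pos: "\<theta> > 0" using assms by simp
  interpret S0_tuple g \<theta> by standard (use \<theta>_pos assms in auto)
  interpret s: sampled_tuple g \<theta> a M by standard (use assms in auto)
  interpret p: periodized_tuple g \<theta> a b M N by standard (use assms in auto)
  have g1: "s.g1 = g1" unfolding assms(10) by (intro ext) (rule s.g1_def)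
  have d: "p.d = d" using assms(7) by (simp add: p.d_def)
  have g2: "p.g2 = g2" unfolding assms(11) d[symmetric] by (intro ext) (rule p.g2_def)
  note P1 = s.sampled_projection[unfolded g1]
  note P2 = p.periodized_projection[unfolded g2 d]
  have norms: "module_norm lborel tf_shift (lattice_R \<theta>) g \<le> adjoint_const \<theta> g \<and>
      module_norm (measure_aZ a) tf_shift (lattice_aZ \<theta> M) g1 \<le> adjoint_const \<theta> g \<and>
      module_norm (measure_Zd d) (tf_shift_mod d) (lattice_Zd a b M N) g2 \<le> adjoint_const \<theta> g"
  proof (cases "\<exists>j t. g j t \<noteq> 0")
    case True
    then have "1 \<le> adjoint_const \<theta> g" using one_le_adjoint_const[OF assms(9)] by blast
    then show ?thesis
      using module_norm_le_one[OF assms(9)] module_norm_le_one[OF P1] module_norm_le_one[OF P2] by linarith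
  next
    case False
    then have z: "g j = (\<lambda>_. 0)" for j by (intro ext) simp
    have z1: "g1 j = (\<lambda>_. 0)" for j
      unfolding g1[symmetric] by (intro ext) (simp add: s.g1_def restr_def z)
    have z2: "g2 j = (\<lambda>_. 0)" for j
      unfolding g2[symmetric] by (intro ext) (simp add: p.g2_eq p.per_def z)
    have "module_norm lborel tf_shift (lattice_R \<theta>) g = 0"
      by (rule contractions.module_norm_zero[OF contractions_lborel]) (simp add: z L2_inner_def)
    moreover have "module_norm (measure_aZ a) tf_shift (lattice_aZ \<theta> M) g1 = 0"
      by (rule contractions.module_norm_zero[OF s.contractions_aZ]) (simp add: z1 L2_inner_def)
    moreover have "module_norm (measure_Zd d) (tf_shift_mod d) (lattice_Zd a b M N) g2 = 0"
      by (rule contractions.module_norm_zero[OF p.contractions_Zd[unfolded d]]) (simp add: z2 L2_inner_def)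
    moreover have "0 \<le> adjoint_const \<theta> g"
      unfolding adjoint_const_def using \<theta>_pos
      by (intro mult_nonneg_nonneg sum_nonneg infsum_nonneg) auto
    ultimately show ?thesis by simp
  qed
  show ?thesis using norms P1 P2 s.g1_ell1[unfolded g1] by blast
qed

end
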